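(* Let $\lambda\in(0,1)$ and $t\in\mathbb{R}$. If $\lambda^t=\frac12$, then the system $((0,1],F_\lambda,\Phi_t)$ is null recurrent.
   Context: For $\lambda\in(0,1)$ and $n\ge1$ let $W_n:=(\lambda^n,\lambda^{n-1}]$, and define $F=F_\lambda:(0,1]\to(0,1]$ by $F_\lambda(x)=\frac{x-\lambda}{1-\lambda}$ if $x\in W_1$ and $F_\lambda(x)=\frac{x-\lambda^n}{\lambda(1-\lambda)}$ if $x\in W_n$, $n\ge2$. Let $\Phi_t:=-t\log|F_\lambda'|$, where at the discontinuity points the one-sided derivative of the branch containing the point is used, so $|F_\lambda'|=\frac1{1-\lambda}$ on $W_1$ and $|F_\lambda'|=\frac1{\lambda(1-\lambda)}$ on $W_n$, $n\ge2$. The pressure is $P(\Phi_t):=\sup\{h(\mu)+\int\Phi_t\,d\mu:\mu\in\mathcal{M},\ -\int\Phi_t\,d\mu<\infty\}$, with $\mathcal{M}$ the set of $F_\lambda$-invariant Borel probability measures and $h(\mu)$ the measure-theoretic entropy. A Borel probability measure $m$ on $(0,1]$ is $(\Phi_t-p)$-conformal if $m(F(A))=\int_Ae^{p-\Phi_t}\,dm$ whenever $A$ is measurable and $F$ is one-to-one on $A$. A measurable set $W$ is wandering if the sets $F^{-n}(W)$, $n\ge0$, are pairwise disjoint; $m$ is conservative if every wandering set has $m$-measure $0$. The system $((0,1],F_\lambda,\Phi_t)$ is recurrent if there is a conservative $(\Phi_t-P(\Phi_t))$-conformal measure $m$. If it is recurrent, it is positive recurrent if there exists an $F_\lambda$-invariant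 probability measure $\mu\ll m$, and null recurrent otherwise. *)

theory Defs
  imports "HOL-Probability.Probability"
begin

definition W :: "real \<Rightarrow> nat \<Rightarrow> real set"
  where "W lam n = {lam ^ n <.. lam ^ (n - 1)}"

definition F :: "real \<Rightarrow> real \<Rightarrow> real"
  where "F lam x =
    (if x \<in> W lam 1 then (x - lam) / (1 - lam)
     else (x - lam ^ (THE n. 2 \<le> n \<and> x \<in> W lam n)) / (lam * (1 - lam)))"

definition left_deriv :: "(real \<Rightarrow> real) \<Rightarrow> real \<Rightarrow> real"
  where "left_deriv f x = (THE D. (f has_real_derivative D) (at_left x))"

(* Each branch domain W lam n is closed on the right, so the one-sided derivative of the branch
   containing an endpoint is the left derivative; elsewhere this is the ordinary derivative. *)
definition Phi :: "real \<Rightarrow> real \<Rightarrow> real \<Rightarrow> real"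
  where "Phi lam t x = - t * ln \<bar>left_deriv (F lam) x\<bar>"

definition borel_prob :: "'a::topological_space set \<Rightarrow> 'a measure \<Rightarrow> bool"
  where "borel_prob X \<mu> \<longleftrightarrow> prob_space \<mu> \<and> sets \<mu> = sets (restrict_space borel X)"

definition invariant_probs ::
    "'a::topological_space set \<Rightarrow> ('a \<Rightarrow> 'a) \<Rightarrow> 'a measure set"
  where "invariant_probs X T = {\<mu>. borel_prob X \<mu> \<and> T \<in> \<mu> \<rightarrow>\<^sub>M \<mu> \<and> distr \<mu> \<mu> T = \<mu>}"

definition finite_partitions :: "'a measure \<Rightarrow> 'a set set set"
  where "finite_partitions \<mu> = {\<P>. finite \<P> \<and> partition_on (space \<mu>) \<P> \<and> \<P> \<subseteq> sets \<mu>}"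

(* Common refinement of the preimages of \<P> under T ^^ i for i < n. *)
definition refinement ::
    "'a measure \<Rightarrow> ('a \<Rightarrow> 'a) \<Rightarrow> 'a set set \<Rightarrow> nat \<Rightarrow> 'a set set"
  where "refinement \<mu> T \<P> n =
    (\<lambda>a. {x \<in> space \<mu>. \<forall>i<n. (T ^^ i) x \<in> a i}) ` ({..<n} \<rightarrow>\<^sub>E \<P>) - {{}}"

(* The convention 0 * log 0 = 0 holds automatically. *)
definition partition_entropy :: "'a measure \<Rightarrow> 'a set set \<Rightarrow> real"
  where "partition_entropy \<mu> \<P> = - (\<Sum>A\<in>\<P>. measure \<mu> A * ln (measure \<mu> A))"

definition entropy_rate :: "'a measure \<Rightarrow> ('a \<Rightarrow> 'a) \<Rightarrow> 'a set set \<Rightarrow> real"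
  where "entropy_rate \<mu> T \<P> = lim (\<lambda>n. partition_entropy \<mu> (refinement \<mu> T \<P> n) / real n)"

(* Kolmogorov-Sinai entropy *)
definition ks_entropy :: "'a measure \<Rightarrow> ('a \<Rightarrow> 'a) \<Rightarrow> ereal"
  where "ks_entropy \<mu> T = (SUP \<P>\<in>finite_partitions \<mu>. ereal (entropy_rate \<mu> T \<P>))"

(* Integral with values in the extended reals, so that integrals equal to -\<infinity> or \<infinity> are seen
   as such (the Bochner integral would be 0). *)
definition ext_integral :: "'a measure \<Rightarrow> ('a \<Rightarrow> real) \<Rightarrow> ereal"
  where "ext_integral \<mu> f =
    enn2ereal (\<integral>\<^sup>+ x. ennreal (f x) \<partial>\<mu>) - enn2ereal (\<integral>\<^sup>+ x. ennreal (- f x) \<partial>\<mu>)"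

definition pressure ::
    "'a::topological_space set \<Rightarrow> ('a \<Rightarrow> 'a) \<Rightarrow> ('a \<Rightarrow> real) \<Rightarrow> ereal"
  where "pressure X T \<phi> =
    Sup {ks_entropy \<mu> T + ext_integral \<mu> \<phi> | \<mu>.
           \<mu> \<in> invariant_probs X T \<and> - ext_integral \<mu> \<phi> < \<infinity>}"

definition conformal ::
    "'a::topological_space set \<Rightarrow> ('a \<Rightarrow> 'a) \<Rightarrow> ('a \<Rightarrow> real) \<Rightarrow> real \<Rightarrow> 'a measure \<Rightarrow> bool"
  where "conformal X T \<phi> p m \<longleftrightarrow> borel_prob X m \<and>
    (\<forall>A\<in>sets m. inj_on T A \<longrightarrow>
       emeasure m (T ` A) = (\<integral>\<^sup>+ x\<in>A. ennreal (exp (p - \<phi> x)) \<partial>m))"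

definition wandering :: "'a measure \<Rightarrow> ('a \<Rightarrow> 'a) \<Rightarrow> 'a set \<Rightarrow> bool"
  where "wandering m T V \<longleftrightarrow>
    V \<in> sets m \<and> disjoint_family (\<lambda>n::nat. (T ^^ n) -` V \<inter> space m)"

definition conservative :: "'a measure \<Rightarrow> ('a \<Rightarrow> 'a) \<Rightarrow> bool"
  where "conservative m T \<longleftrightarrow> (\<forall>V. wandering m T V \<longrightarrow> emeasure m V = 0)"

(* Conservative conformal measures at the critical parameter; the pressure has to be finite for
   subtracting it from the potential to make sense. *)
definition recurrence_measure ::
    "'a::topological_space set \<Rightarrow> ('a \<Rightarrow> 'a) \<Rightarrow> ('a \<Rightarrow> real) \<Rightarrow> 'a measure \<Rightarrow> bool"
  where "recurrence_measure X T \<phi> m \<longleftrightarrow>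
    (\<exists>p. pressure X T \<phi> = ereal p \<and> conformal X T \<phi> p m) \<and> conservative m T"

definition recurrent ::
    "'a::topological_space set \<Rightarrow> ('a \<Rightarrow> 'a) \<Rightarrow> ('a \<Rightarrow> real) \<Rightarrow> bool"
  where "recurrent X T \<phi> \<longleftrightarrow> (\<exists>m. recurrence_measure X T \<phi> m)"

(* absolutely_continuous m \<mu> means that \<mu> is absolutely continuous with respect to m. *)
definition positive_recurrent ::
    "'a::topological_space set \<Rightarrow> ('a \<Rightarrow> 'a) \<Rightarrow> ('a \<Rightarrow> real) \<Rightarrow> bool"
  where "positive_recurrent X T \<phi> \<longleftrightarrow>
    (\<exists>m. recurrence_measure X T \<phi> m \<and>
       (\<exists>\<mu>\<in>invariant_probs X T. absolutely_continuous m \<mu>))"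

definition null_recurrent ::
    "'a::topological_space set \<Rightarrow> ('a \<Rightarrow> 'a) \<Rightarrow> ('a \<Rightarrow> real) \<Rightarrow> bool"
  where "null_recurrent X T \<phi> \<longleftrightarrow> recurrent X T \<phi> \<and> \<not> positive_recurrent X T \<phi>"

lemma W_unique:
  assumes "0 < lam" "lam < 1" "1 \<le> n" "1 \<le> k" "x \<in> W lam n" "x \<in> W lam k"
  shows "n = k"
proof -
  have *: False if "1 \<le> a" "a < b" "x \<in> W lam a" "x \<in> W lam b" for a b :: nat
  proof -
    have "lam ^ (b - 1) \<le> lam ^ a"
      using that assms by (intro power_decreasing) auto
    then show False using that by (auto simp: W_def)
  qed
  show ?thesis
    using *[of n k] *[of k n] assms by (cases n k rule: linorder_cases) auto
qed

lemma F_W1: "x \<in> W lam 1 \<Longrightarrow> F lam x = (x - lam) / (1 - lam)"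
  by (simp add: F_def)

lemma F_W:
  assumes "0 < lam" "lam < 1" "2 \<le> n" "x \<in> W lam n"
  shows "F lam x = (x - lam ^ n) / (lam * (1 - lam))"
proof -
  have "x \<notin> W lam 1"
    using W_unique[of lam n 1 x] assms by auto
  moreover have "(THE n. 2 \<le> n \<and> x \<in> W lam n) = n"
    using assms W_unique[of lam _ n x] by (intro the_equality) auto
  ultimately show ?thesis by (simp add: F_def)
qed

lemma left_deriv_eqI:
  assumes "(f has_real_derivative D) (at_left x)"
  shows "left_deriv f x = D"
  unfolding left_deriv_def
proof (rule the_equality)
  show "(f has_real_derivative D) (at_left x)" by (rule assms)
next
  fix E assume "(f has_real_derivative E) (at_left x)"
  then show "E = D"
    using assms tendsto_unique[OF trivial_limit_at_left_real]
    unfolding has_field_derivative_iff by blast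
qed

lemma left_deriv_affine:
  fixes f :: "real \<Rightarrow> real"
  assumes "a < x" and "\<And>y. a < y \<Longrightarrow> y \<le> x \<Longrightarrow> f y = (y - c) / d"
  shows "left_deriv f x = 1 / d"
proof (rule left_deriv_eqI)
  have "((\<lambda>y. (y - c) / d) has_real_derivative 1 / d) (at_left x)"
    by (auto intro!: derivative_eq_intros simp: divide_inverse)
  moreover have "eventually (\<lambda>y. y \<in> {a<..<x}) (at_left x)"
    using assms(1) by (rule eventually_at_left_real)
  then have "eventually (\<lambda>y. (y - c) / d = f y) (at_left x)"
    by eventually_elim (use assms(2) in auto)
  ultimately show "(f has_real_derivative 1 / d) (at_left x)"
    using assms by (subst (asm) has_field_derivative_cong_eventually) auto
qed

lemma abs_left_deriv_F_W1:
  assumes "0 < lam" "lam < 1" "x \<in> W lam 1"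
  shows "\<bar>left_deriv (F lam) x\<bar> = 1 / (1 - lam)"
proof -
  have "left_deriv (F lam) x = 1 / (1 - lam)"
    by (rule left_deriv_affine[where a = lam and c = lam])
       (use assms in \<open>auto simp: W_def intro!: F_W1\<close>)
  then show ?thesis using assms by simp
qed

lemma abs_left_deriv_F_W:
  assumes "0 < lam" "lam < 1" "2 \<le> n" "x \<in> W lam n"
  shows "\<bar>left_deriv (F lam) x\<bar> = 1 / (lam * (1 - lam))"
proof -
  have "left_deriv (F lam) x = 1 / (lam * (1 - lam))"
    by (rule left_deriv_affine[where a = "lam ^ n" and c = "lam ^ n"])
       (use assms in \<open>auto simp: W_def intro!: F_W\<close>)
  then show ?thesis using assms by simp
qed

end

theory Submission
  imports Defs
begin

text \<open>Let \<open>n\<close> be the code of the points of \<open>W lam n\<close>. If \<open>lam powr t = 1 / 2\<close> and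
  \<open>p = ln 2 + t * ln (1 - lam)\<close>, then under a conformal measure with parameter \<open>p\<close> the codes along an
  orbit form a random walk on the positive integers with steps \<open>j - 1\<close> of probability
  \<open>(1 / 2) ^ (j + 1)\<close>, reflected at \<open>1\<close>: mean zero, hence null recurrent. Write \<open>c n k\<close> for the
  probability that the code is \<open>k + 1\<close> at time \<open>n\<close>. These numbers decrease in \<open>k\<close>, the first column
  decreases in \<open>n\<close>, and linear relations force all columns to the same limit, which is \<open>0\<close>
  because every row sums to at most \<open>1\<close>; this excludes absolutely continuous invariant
  probabilities. The same relations show that no column is summable, which gives conservativity.

  All the maps \<open>F lam\<close> are conjugate, so the conformal measure is the image of Lebesgue measure under
  the conjugacy with \<open>F (1 / 2)\<close>. That \<open>p\<close> is the pressure follows in one direction from Gibbs'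
  inequality against the conformal measure, in the other from the walks reflected at \<open>N\<close>.\<close>

section \<open>Branches and codes\<close>

text \<open>The constant \<open>p\<close> is forced. If the first branch has weight \<open>w\<close>
  and the others \<open>w / 2\<close>, the masses \<open>T n\<close> of \<open>{0<..lam ^ n}\<close>
  under a conformal measure satisfy \<open>T (n + 2) = T (n + 1) - w / 2 * T n\<close>. For
  \<open>w > 1 / 2\<close> the characteristic roots are not real and \<open>T\<close> would change
  sign; \<open>w = 1 / 2\<close>, the double root, belongs to the smallest parameter that admits a
  conformal measure.

  The main obstacle is the entropy: \<open>ks_entropy\<close> is a supremum over all finite
  measurable partitions, while the partition into the sets \<open>W lam n\<close> is infinite. The
  upper bound therefore treats an arbitrary finite partition. Its cells are guessed from nearby
  points, and averaging the guesses along orbits over the conformal measure gives weights on words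
  for Gibbs' inequality. The resulting bound contains the mass of \<open>{0<..lam}\<close> with the
  sign opposite to the integral of the potential, so the sum is the same for all invariant
  probabilities.

  Positive recurrence quantifies over all conformal measures. The walk argument is thus based on an
  identity for single branches that all of them share, which replaces a uniqueness proof.\<close>

definition code :: "real \<Rightarrow> real \<Rightarrow> nat"
  where "code lam x = (LEAST n. lam ^ n < x)"

text \<open>The reciprocal slope of the branch on \<open>W lam n\<close>: the length of
  \<open>W lam n\<close> divided by the length of its image \<open>{0<..lam ^ (n - 2)}\<close>, not
  the length itself.\<close>

definition width :: "real \<Rightarrow> nat \<Rightarrow> real"
  where "width lam n = (if n = 1 then 1 - lam else lam * (1 - lam))"

text \<open>The mass ratio of the branches for the conformal measure at the critical parameter: there
  \<open>exp (Phi lam t x - p)\<close> is \<open>1 / 2\<close> on \<open>W lam 1\<close> and \<open>1 / 4\<close> elsewhere.\<close>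

definition weight :: "nat \<Rightarrow> real"
  where "weight n = (if n = 1 then 1 / 2 else 1 / 4)"

locale contraction =
  fixes lam :: real
  assumes lam_pos: "0 < lam" and lam_less_1: "lam < 1"
begin

lemma code_le_iff:
  assumes "0 < x"
  shows "code lam x \<le> n \<longleftrightarrow> lam ^ n < x"
proof -
  obtain k where "lam ^ k < x"
    using real_arch_pow_inv[OF assms lam_less_1] by blast
  then have *: "lam ^ code lam x < x"
    unfolding code_def by (rule LeastI)
  show ?thesis
  proof
    assume "code lam x \<le> n"
    then have "lam ^ n \<le> lam ^ code lam x"
      using lam_pos lam_less_1 by (intro power_decreasing) auto
    with * show "lam ^ n < x" by simp
  qed (simp add: code_def Least_le)
qed

lemma less_code_iff: "0 < x \<Longrightarrow> n < code lam x \<longleftrightarrow> x \<le> lam ^ n"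
  using code_le_iff[of x n] by linarith

lemma code_pos: "x \<in> {0<..1} \<Longrightarrow> 1 \<le> code lam x"
  using less_code_iff[of x 0] by auto

lemma W_subset: "W lam n \<subseteq> {0<..1}"
proof
  fix x assume "x \<in> W lam n"
  then have "lam ^ n < x" "x \<le> lam ^ (n - 1)" by (auto simp: W_def)
  moreover have "0 < lam ^ n" "lam ^ (n - 1) \<le> 1"
    using lam_pos lam_less_1 by (auto simp: power_le_one)
  ultimately show "x \<in> {0<..1}" unfolding greaterThanAtMost_iff by linarith
qed

lemma in_W_iff:
  assumes "1 \<le> n"
  shows "x \<in> W lam n \<longleftrightarrow> x \<in> {0<..1} \<and> code lam x = n"
proof -
  have "x \<in> W lam n \<longleftrightarrow> x \<in> {0<..1} \<and> x \<in> W lam n"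
    using W_subset by blast
  also have "\<dots> \<longleftrightarrow> x \<in> {0<..1} \<and> code lam x \<le> n \<and> n - 1 < code lam x"
    by (auto simp: W_def code_le_iff less_code_iff)
  also have "\<dots> \<longleftrightarrow> x \<in> {0<..1} \<and> code lam x = n"
    using assms by auto
  finally show ?thesis .
qed

lemma W_eq: "1 \<le> n \<Longrightarrow> W lam n = {x \<in> {0<..1}. code lam x = n}"
  using in_W_iff by auto

lemma in_W_code: "x \<in> {0<..1} \<Longrightarrow> x \<in> W lam (code lam x)"
  using in_W_iff code_pos by blast

lemma W_1: "W lam 1 = {lam<..1}"
  by (simp add: W_def)

lemma width_pos: "0 < width lam n"
  using lam_pos lam_less_1 by (simp add: width_def)

lemma width_le: "width lam n \<le> 1 - lam"
  using lam_pos lam_less_1 by (simp add: width_def mult_left_le_one_le)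

text \<open>The length of \<open>W lam n\<close> is its reciprocal slope times the length of its
  image. The truncated subtraction is intended: \<open>n = 1\<close> and \<open>n = 2\<close> both
  give exponent 0, as both branches map onto \<open>{0<..1}\<close>.\<close>

lemma power_eq_width: "1 \<le> n \<Longrightarrow> lam ^ (n - 1) = lam ^ n + width lam n * lam ^ (n - 2)"
proof (cases "n = 1")
  case False
  moreover assume "1 \<le> n"
  ultimately have "n = Suc (Suc (n - 2))" by simp
  then obtain k where "n = Suc (Suc k)" ..
  then show ?thesis by (simp add: width_def algebra_simps)
qed (simp add: width_def)

lemma F_eq:
  assumes "x \<in> {0<..1}"
  shows "F lam x = (x - lam ^ code lam x) / width lam (code lam x)"
proof (cases "code lam x = 1")
  case True
  then show ?thesis
    using in_W_code[OF assms] by (simp add: F_W1 width_def)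
next
  case False
  then have "2 \<le> code lam x" using code_pos[OF assms] by linarith
  then show ?thesis
    using F_W[OF lam_pos lam_less_1 _ in_W_code[OF assms]] False by (simp add: width_def)
qed

lemma F_range:
  assumes "x \<in> {0<..1}"
  shows "F lam x \<in> {0<..lam ^ (code lam x - 2)}"
proof -
  have "lam ^ code lam x < x" "x \<le> lam ^ (code lam x - 1)"
    using in_W_code[OF assms] by (auto simp: W_def)
  with power_eq_width[OF code_pos[OF assms]] show ?thesis
    using width_pos[of "code lam x"]
    by (simp add: F_eq[OF assms] pos_divide_le_eq mult.commute)
qed

lemma lam_power_le_1: "lam ^ n \<le> 1"
  using lam_pos lam_less_1 by (simp add: power_le_one)

lemma F_closed: "x \<in> {0<..1} \<Longrightarrow> F lam x \<in> {0<..1}"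
  using F_range[of x] lam_power_le_1[of "code lam x - 2"] by auto

lemma F_funpow_closed: "x \<in> {0<..1} \<Longrightarrow> (F lam ^^ k) x \<in> {0<..1}"
  by (induction k) (simp_all add: F_closed del: greaterThanAtMost_iff)

lemma code_F: "x \<in> {0<..1} \<Longrightarrow> code lam x - 1 \<le> code lam (F lam x)"
  using F_range[of x] F_closed[of x] code_pos[of "F lam x"]
    less_code_iff[of "F lam x" "code lam x - 2"] by auto

text \<open>Turns membership in the image of branch \<open>n\<close> into the transition rule that a
  code drops by at most one; for \<open>n \<le> 2\<close> both sides hold at every point.\<close>

lemma le_code_iff: "x \<in> {0<..1} \<Longrightarrow> n - 1 \<le> code lam x \<longleftrightarrow> x \<le> lam ^ (n - 2)"
  using code_pos[of x] less_code_iff[of x "n - 2"] by auto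

lemma F_image_W:
  assumes "1 \<le> n" "E \<subseteq> {0<..1}"
  shows "F lam ` (W lam n \<inter> F lam -` E) = E \<inter> {0<..lam ^ (n - 2)}"
proof
  show "F lam ` (W lam n \<inter> F lam -` E) \<subseteq> E \<inter> {0<..lam ^ (n - 2)}"
    using F_range in_W_iff[OF assms(1)] by auto
  show "E \<inter> {0<..lam ^ (n - 2)} \<subseteq> F lam ` (W lam n \<inter> F lam -` E)"
  proof
    fix y assume y: "y \<in> E \<inter> {0<..lam ^ (n - 2)}"
    define x where "x = lam ^ n + width lam n * y"
    have "width lam n * y \<le> width lam n * lam ^ (n - 2)" "0 < width lam n * y"
      using y width_pos by auto
    then have "x \<in> W lam n"
      unfolding W_def x_def using power_eq_width[OF assms(1)] by auto
    moreover have "F lam x = y"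
      using calculation in_W_iff[OF assms(1), of x] F_eq[of x] width_pos[of n]
      by (simp add: x_def)
    ultimately show "y \<in> F lam ` (W lam n \<inter> F lam -` E)" using y by blast
  qed
qed

lemma F_diff:
  assumes "x \<in> {0<..1}" "y \<in> {0<..1}" "code lam x = code lam y"
  shows "x - y = width lam (code lam x) * (F lam x - F lam y)"
  using assms width_pos[of "code lam y"] by (simp add: F_eq flip: diff_divide_distrib)

lemma F_inj_on_W:
  assumes "1 \<le> n" shows "inj_on (F lam) (W lam n)"
proof (rule inj_onI)
  fix x y assume "x \<in> W lam n" "y \<in> W lam n" "F lam x = F lam y"
  then show "x = y"
    using F_diff[of x y] in_W_iff[OF assms] by simp
qed

lemma sets_W [measurable]: "W lam n \<in> sets borel"
  by (simp add: W_def)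

lemma sets_unit_iff: "A \<in> sets (restrict_space borel {0<..1::real}) \<longleftrightarrow> A \<in> sets borel \<and> A \<subseteq> {0<..1}"
  by (subst sets_restrict_space_iff) auto

lemma code_measurable [measurable]:
  "code lam \<in> restrict_space borel {0<..1} \<rightarrow>\<^sub>M count_space UNIV"
proof -
  have "code lam -` {n} \<inter> space (restrict_space borel {0<..1}) \<in> sets (restrict_space borel {0<..1})" for n :: nat
  proof (cases "1 \<le> n")
    case True
    then have "code lam -` {n} \<inter> space (restrict_space borel {0<..1}) = W lam n"
      by (auto simp: space_restrict_space W_eq)
    then show ?thesis using W_subset by (simp add: sets_unit_iff)
  next
    case False
    then have "code lam -` {n} \<inter> space (restrict_space borel {0<..1}) = {}"
      using code_pos by (fastforce simp: space_restrict_space)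
    then show ?thesis by (simp only: sets.empty_sets)
  qed
  then show ?thesis
    by (subst measurable_count_space_eq2_countable) auto
qed

lemma F_measurable [measurable]:
  "F lam \<in> restrict_space borel {0<..1} \<rightarrow>\<^sub>M restrict_space borel {0<..1}"
proof (rule measurable_restrict_space2)
  have "(\<lambda>x. f (code lam x)) \<in> borel_measurable (restrict_space borel {0<..1})" for f :: "nat \<Rightarrow> real"
    by measurable
  then have "(\<lambda>x. (x - lam ^ code lam x) / width lam (code lam x))
      \<in> restrict_space borel {0<..1} \<rightarrow>\<^sub>M borel"
    by (intro borel_measurable_divide borel_measurable_diff)
       (auto intro: measurable_restrict_space1)
  then show "F lam \<in> restrict_space borel {0<..1} \<rightarrow>\<^sub>M borel"
    by (rule measurable_cong[THEN iffD2, rotated]) (simp add: space_restrict_space F_eq)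
qed (use F_closed in \<open>auto simp: space_restrict_space\<close>)

text \<open>Since \<open>t * ln lam = - ln 2\<close>, the additional factor \<open>lam\<close> in
  the slope of the later branches costs exactly a factor 2, so the mass ratios do not depend on
  \<open>lam\<close>.\<close>

lemma exp_minus_Phi:
  assumes "lam powr t = 1 / 2" "1 \<le> n" "x \<in> W lam n"
  shows "exp (ln 2 + t * ln (1 - lam) - Phi lam t x) = 1 / weight n"
    and "Phi lam t x = t * ln (1 - lam) - (if n = 1 then 0 else ln 2)"
proof -
  have "t * ln lam = ln (lam powr t)" using lam_pos by (simp add: ln_powr)
  also have "\<dots> = - ln 2" by (simp add: assms ln_div)
  finally have *: "t * ln lam = - ln 2" .
  show "Phi lam t x = t * ln (1 - lam) - (if n = 1 then 0 else ln 2)"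
  proof (cases "n = 1")
    case True
    then show ?thesis using abs_left_deriv_F_W1[OF lam_pos lam_less_1] assms lam_less_1
      by (simp add: Phi_def ln_div)
  next
    case False
    then have "2 \<le> n" using assms by auto
    have "ln (1 / (lam * (1 - lam))) = - ln lam - ln (1 - lam)"
      using lam_pos lam_less_1 by (subst ln_div) (simp_all add: ln_mult del: right_diff_distrib')
    then have "Phi lam t x = t * ln lam + t * ln (1 - lam)"
      unfolding Phi_def abs_left_deriv_F_W[OF lam_pos lam_less_1 \<open>2 \<le> n\<close> assms(3)]
      by (simp only:) (simp add: right_diff_distrib)
    then show ?thesis using False * by simp
  qed
  then show "exp (ln 2 + t * ln (1 - lam) - Phi lam t x) = 1 / weight n"
    by (simp add: weight_def exp_add)
qed

end

section \<open>Entropy of finite partitions\<close>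

lemma measurable_funpow:
  assumes "T \<in> M \<rightarrow>\<^sub>M M"
  shows "T ^^ k \<in> M \<rightarrow>\<^sub>M M"
proof (induction k)
  case (Suc k)
  then show ?case using measurable_comp[OF Suc assms] by (simp add: comp_def)
qed simp

text \<open>Fekete's lemma: division of \<open>n\<close> by a fixed \<open>m\<close> bounds
  \<open>a n / n\<close> by \<open>a m / m\<close> up to a constant over \<open>n\<close>. It makes
  the \<open>lim\<close> in \<open>entropy_rate\<close> a genuine limit.\<close>

lemma subadditive_convergent:
  fixes a :: "nat \<Rightarrow> real"
  assumes nonneg: "\<And>n. 0 \<le> a n" and sub: "\<And>m n. a (m + n) \<le> a m + a n"
  shows "convergent (\<lambda>n. a n / real n)"
proof -
  define L where "L = Inf ((\<lambda>n. a n / real n) ` {1..})"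
  have bdd: "bdd_below ((\<lambda>n. a n / real n) ` {1..})"
    using nonneg by (intro bdd_belowI[of _ 0]) auto
  have lower: "L \<le> a n / real n" if "1 \<le> n" for n
    unfolding L_def using that by (intro cInf_lower bdd) auto
  have mult: "a (q * m) \<le> real q * a m + a 0" for q m
  proof (induction q)
    case (Suc q)
    then show ?case using sub[of m "q * m"] by (simp add: algebra_simps)
  qed simp
  have "(\<lambda>n. a n / real n) \<longlonglongrightarrow> L"
  proof (rule LIMSEQ_I)
    fix e :: real assume "0 < e"
    then obtain m where m: "1 \<le> m" "a m / real m < L + e / 2"
      using cInf_lessD[of "(\<lambda>n. a n / real n) ` {1..}" "L + e / 2"] by (auto simp: L_def)
    \<comment> \<open>Pays for the remainder \<open>n mod m\<close> by summing over all remainders,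
      and for the \<open>a 0\<close> left over in \<open>mult\<close>.\<close>
    define C where "C = a 0 + (\<Sum>r<m. a r)"
    have upper: "a n \<le> real n * (a m / real m) + C" for n
    proof -
      have "a n = a (n div m * m + n mod m)" by simp
      also have "\<dots> \<le> a (n div m * m) + a (n mod m)" by (rule sub)
      also have "a (n mod m) \<le> (\<Sum>r<m. a r)"
        using m nonneg by (intro member_le_sum) auto
      also have "a (n div m * m) \<le> real (n div m) * a m + a 0" by (rule mult)
      also have "real (n div m) * a m \<le> real n / real m * a m"
        using nonneg by (intro mult_right_mono of_nat_div_le_of_nat)
      finally show ?thesis by (simp add: C_def)
    qed
    obtain N where N: "2 * C / e < real N" using reals_Archimedean2 by blast
    have "norm (a n / real n - L) < e" if n: "Suc N \<le> n" for n
    proof -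
      have "2 * C / e < real n" using N n by linarith
      then have "C / real n < e / 2" using \<open>0 < e\<close> n by (simp add: field_simps)
      moreover have "a n / real n \<le> a m / real m + C / real n"
        using upper[of n] n by (simp add: field_simps)
      ultimately have "a n / real n < L + e" using m(2) by linarith
      with lower[of n] n show ?thesis by simp
    qed
    then show "\<exists>no. \<forall>n\<ge>no. norm (a n / real n - L) < e" by blast
  qed
  then show ?thesis by (rule convergentI)
qed

section \<open>Itineraries and the entropy rate\<close>

definition cell :: "'a set set \<Rightarrow> 'a \<Rightarrow> 'a set"
  where "cell P x = (THE A. A \<in> P \<and> x \<in> A)"

definition itinerary :: "('a \<Rightarrow> 'a) \<Rightarrow> 'a set set \<Rightarrow> nat \<Rightarrow> 'a \<Rightarrow> nat \<Rightarrow> 'a set"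
  where "itinerary T P n x = (\<lambda>i\<in>{..<n}. cell P ((T ^^ i) x))"

lemma cell_eq:
  assumes "partition_on S P" "A \<in> P" "x \<in> A"
  shows "cell P x = A"
  unfolding cell_def
proof (rule the_equality)
  fix B assume "B \<in> P \<and> x \<in> B"
  then show "B = A"
    using assms partition_onD2[OF assms(1)] by (auto simp: disjoint_def)
qed (use assms in auto)

lemma cell_in:
  assumes "partition_on S P" "x \<in> S"
  shows "cell P x \<in> P" "x \<in> cell P x"
proof -
  obtain A where "A \<in> P" "x \<in> A"
    using assms by (auto simp: partition_on_def)
  with cell_eq[OF assms(1) this] show "cell P x \<in> P" "x \<in> cell P x" by auto
qed

lemma (in prob_space) sum_prob_simple_function:
  fixes f :: "'b \<Rightarrow> real"
  assumes "simple_function M X"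
  shows "(\<Sum>a\<in>X ` space M. prob (X -` {a} \<inter> space M) * f a) = (\<integral>x. f (X x) \<partial>M)"
proof -
  have fin: "finite (X ` space M)" and meas: "X -` {a} \<inter> space M \<in> sets M" for a
    using simple_functionD[OF assms] by auto
  have "(\<integral>x. f (X x) \<partial>M) = (\<integral>x. (\<Sum>a\<in>X ` space M. f a * indicator (X -` {a} \<inter> space M) x) \<partial>M)"
  proof (rule Bochner_Integration.integral_cong[OF refl])
    fix x assume x: "x \<in> space M"
    have "(\<Sum>a\<in>X ` space M. f a * indicator (X -` {a} \<inter> space M) x) =
        (\<Sum>a\<in>X ` space M. if a = X x then f a else 0)"
      using x by (intro sum.cong) (auto simp: indicator_def)
    then show "f (X x) = (\<Sum>a\<in>X ` space M. f a * indicator (X -` {a} \<inter> space M) x)"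
      using x fin by simp
  qed
  also have "\<dots> = (\<Sum>a\<in>X ` space M. (\<integral>x. f a * indicator (X -` {a} \<inter> space M) x \<partial>M))"
    using meas by (intro Bochner_Integration.integral_sum integrable_mult_right)
      (auto simp: emeasure_eq_measure intro!: integrable_real_indicator)
  also have "\<dots> = (\<Sum>a\<in>X ` space M. prob (X -` {a} \<inter> space M) * f a)"
    using meas by (simp add: mult.commute)
  finally show ?thesis ..
qed

lemma (in prob_space) sum_prob_simple_function_1:
  assumes "simple_function M X"
  shows "(\<Sum>a\<in>X ` space M. prob (X -` {a} \<inter> space M)) = 1"
  using sum_prob_simple_function[OF assms, of "\<lambda>_. 1"] prob_space by simp

text \<open>Gibbs' inequality: \<open>- ln (q a)\<close> plays the role of a code length for the word \<open>a\<close>.\<close>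

lemma (in prob_space) entropy_le_integral:
  assumes X: "simple_function M X"
    and pos: "\<And>a. a \<in> X ` space M \<Longrightarrow> 0 < q a" and le1: "(\<Sum>a\<in>X ` space M. q a) \<le> 1"
    and B: "integrable M B" "\<And>x. x \<in> space M \<Longrightarrow> - ln (q (X x)) \<le> B x"
  shows "- (\<Sum>a\<in>X ` space M. prob (X -` {a} \<inter> space M) * ln (prob (X -` {a} \<inter> space M)))
    \<le> (\<integral>x. B x \<partial>M)"
proof -
  define p where "p a = prob (X -` {a} \<inter> space M)" for a
  have fin: "finite (X ` space M)" using simple_functionD(1)[OF X] .
  have "p a * ln (q a) - p a * ln (p a) \<le> q a - p a" if "a \<in> X ` space M" for a
  proof (cases "p a = 0")
    case False
    then have "0 < p a" by (simp add: p_def zero_less_measure_iff)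
    moreover have "ln (q a / p a) \<le> q a / p a - 1"
      using pos[OF that] \<open>0 < p a\<close> by (intro ln_le_minus_one) simp
    ultimately have "p a * ln (q a / p a) \<le> p a * (q a / p a - 1)"
      by (intro mult_left_mono) auto
    then show ?thesis
      using pos[OF that] \<open>0 < p a\<close> by (simp add: ln_div right_diff_distrib)
  qed (use pos[OF that] in simp)
  then have "(\<Sum>a\<in>X ` space M. p a * ln (q a) - p a * ln (p a)) \<le> (\<Sum>a\<in>X ` space M. q a - p a)"
    by (intro sum_mono)
  also have "\<dots> \<le> 0"
    using le1 sum_prob_simple_function_1[OF X] by (simp add: sum_subtractf p_def)
  finally have "- (\<Sum>a\<in>X ` space M. p a * ln (p a)) \<le> (\<Sum>a\<in>X ` space M. p a * - ln (q a))"
    by (simp add: sum_subtractf sum_negf)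
  also have "\<dots> = (\<integral>x. - ln (q (X x)) \<partial>M)"
    unfolding p_def by (rule sum_prob_simple_function[OF X])
  also have "\<dots> \<le> (\<integral>x. B x \<partial>M)"
  proof (rule integral_mono[OF _ B])
    have "simple_function M (\<lambda>x. - ln (q (X x)))"
      using X by (rule simple_function_compose1)
    then show "integrable M (\<lambda>x. - ln (q (X x)))"
      by (intro integrable_simple_function) (auto simp: emeasure_eq_measure)
  qed
  finally show ?thesis by (simp add: p_def)
qed

text \<open>Counterpart of \<open>entropy_le_integral\<close> for the lower bound of the pressure: a
  word of mass at most \<open>u a\<close> carries information at least
  \<open>- ln (u a)\<close>.\<close>

lemma (in prob_space) integral_le_entropy:
  assumes X: "simple_function M X"
    and u: "\<And>a. a \<in> X ` space M \<Longrightarrow> prob (X -` {a} \<inter> space M) \<le> u a" "\<And>a. a \<in> X ` space M \<Longrightarrow> 0 < u a"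
  shows "(\<integral>x. - ln (u (X x)) \<partial>M)
    \<le> - (\<Sum>a\<in>X ` space M. prob (X -` {a} \<inter> space M) * ln (prob (X -` {a} \<inter> space M)))"
proof -
  have "(\<integral>x. - ln (u (X x)) \<partial>M) = (\<Sum>a\<in>X ` space M. prob (X -` {a} \<inter> space M) * - ln (u a))"
    by (rule sum_prob_simple_function[OF X, symmetric])
  also have "\<dots> \<le> (\<Sum>a\<in>X ` space M. prob (X -` {a} \<inter> space M) * - ln (prob (X -` {a} \<inter> space M)))"
  proof (rule sum_mono)
    fix a assume a: "a \<in> X ` space M"
    show "prob (X -` {a} \<inter> space M) * - ln (u a)
        \<le> prob (X -` {a} \<inter> space M) * - ln (prob (X -` {a} \<inter> space M))"
    proof (cases "prob (X -` {a} \<inter> space M) = 0")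
      case False
      then have "0 < prob (X -` {a} \<inter> space M)" by (simp add: zero_less_measure_iff)
      then show ?thesis using u[OF a] by (intro mult_left_mono) auto
    qed simp
  qed
  finally show ?thesis by (simp add: sum_negf)
qed

text \<open>Base \<open>exp 1\<close> makes the logarithm of information theory equal to
  \<open>ln\<close>, so that facts on \<open>entropy_Pow\<close> apply to
  \<open>partition_entropy\<close>.\<close>

locale measure_preserving = information_space M "exp 1" for M :: "'a measure" +
  fixes T :: "'a \<Rightarrow> 'a"
  assumes T_meas: "T \<in> M \<rightarrow>\<^sub>M M" and T_distr: "distr M M T = M"
begin

lemma funpow_meas: "T ^^ k \<in> M \<rightarrow>\<^sub>M M"
  by (rule measurable_funpow[OF T_meas])

lemma funpow_space: "x \<in> space M \<Longrightarrow> (T ^^ k) x \<in> space M"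
  using measurable_space[OF funpow_meas] .

lemma funpow_distr: "distr M M (T ^^ k) = M"
proof (induction k)
  case 0
  show ?case using distr_id[of M] by (simp add: id_def)
next
  case (Suc k)
  have "distr M M (T ^^ Suc k) = distr (distr M M (T ^^ k)) M T"
    unfolding funpow.simps(2) by (rule distr_distr[OF T_meas funpow_meas, symmetric])
  then show ?case unfolding Suc T_distr .
qed

lemma prob_funpow_vimage:
  assumes "A \<in> sets M"
  shows "prob ((T ^^ k) -` A \<inter> space M) = prob A"
  using measure_distr[OF funpow_meas assms] by (simp add: funpow_distr)

lemma integral_funpow:
  fixes f :: "'a \<Rightarrow> real"
  assumes "f \<in> borel_measurable M"
  shows "(\<integral>x. f ((T ^^ k) x) \<partial>M) = (\<integral>x. f x \<partial>M)"
  using integral_distr[OF funpow_meas, of f] assms by (simp add: funpow_distr)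

lemma integrable_funpow:
  fixes f :: "'a \<Rightarrow> real"
  assumes "integrable M f"
  shows "integrable M (\<lambda>x. f ((T ^^ k) x))"
  using integrable_distr[OF funpow_meas, where f = f and k1 = k] assms by (simp add: funpow_distr)

end

locale partitioned = measure_preserving M T for M :: "'a measure" and T +
  fixes P :: "'a set set"
  assumes P: "P \<in> finite_partitions M"
begin

lemma P_finite: "finite P" and P_part: "partition_on (space M) P" and P_sets: "P \<subseteq> sets M"
  using P by (auto simp: finite_partitions_def)

lemma cell_funpow:
  assumes "x \<in> space M"
  shows "cell P ((T ^^ i) x) \<in> P" "(T ^^ i) x \<in> cell P ((T ^^ i) x)"
  using cell_in[OF P_part funpow_space[OF assms]] .

lemma itinerary_PiE: "x \<in> space M \<Longrightarrow> itinerary T P n x \<in> {..<n} \<rightarrow>\<^sub>E P"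
  by (simp add: itinerary_def cell_funpow)

lemma itinerary_eq_iff:
  assumes "a \<in> {..<n} \<rightarrow>\<^sub>E P" "x \<in> space M"
  shows "itinerary T P n x = a \<longleftrightarrow> (\<forall>i<n. (T ^^ i) x \<in> a i)"
proof
  assume "\<forall>i<n. (T ^^ i) x \<in> a i"
  then have "cell P ((T ^^ i) x) = a i" if "i < n" for i
    using cell_eq[OF P_part, of "a i"] assms(1) that by (auto simp: PiE_iff)
  then show "itinerary T P n x = a"
    using assms(1) unfolding itinerary_def
    by (auto simp: PiE_iff extensional_def fun_eq_iff)
qed (use cell_funpow[OF assms(2)] in \<open>auto simp: itinerary_def\<close>)

lemma itinerary_vimage:
  assumes "a \<in> {..<n} \<rightarrow>\<^sub>E P"
  shows "itinerary T P n -` {a} \<inter> space M = {x \<in> space M. \<forall>i<n. (T ^^ i) x \<in> a i}"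
  using itinerary_eq_iff[OF assms] by auto

lemma itinerary_image_finite: "finite (itinerary T P n ` space M)"
  by (rule finite_subset[OF image_subsetI[OF itinerary_PiE] finite_PiE]) (simp_all add: P_finite)

lemma itinerary_simple: "simple_function M (itinerary T P n)"
  unfolding simple_function_def
proof (intro conjI ballI itinerary_image_finite)
  fix a assume "a \<in> itinerary T P n ` space M"
  then have a: "a \<in> {..<n} \<rightarrow>\<^sub>E P" using itinerary_PiE by blast
  have "(T ^^ i) -` a i \<inter> space M \<in> sets M" if "i < n" for i
  proof (rule measurable_sets[OF funpow_meas])
    show "a i \<in> sets M" using a P_sets that by auto
  qed
  then have "(\<Inter>i\<in>{..<n}. (T ^^ i) -` a i \<inter> space M) \<in> sets M" if "n \<noteq> 0"
    using that by (intro sets.finite_INT) auto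
  then have "space M \<inter> (\<Inter>i\<in>{..<n}. (T ^^ i) -` a i \<inter> space M) \<in> sets M"
    by (cases "n = 0") (auto simp del: INT_simps)
  moreover have "space M \<inter> (\<Inter>i\<in>{..<n}. (T ^^ i) -` a i \<inter> space M) =
      itinerary T P n -` {a} \<inter> space M"
    unfolding itinerary_vimage[OF a] by auto
  ultimately show "itinerary T P n -` {a} \<inter> space M \<in> sets M" by simp
qed

text \<open>Makes partition entropy the Shannon entropy of a simple random variable, the itinerary.
  Removing \<open>{}\<close> in \<open>refinement\<close> matches keeping only the words that
  occur.\<close>

lemma refinement_eq:
  "refinement M T P n = (\<lambda>a. itinerary T P n -` {a} \<inter> space M) ` (itinerary T P n ` space M)"
  (is "?L = ?R")
proof
  show "?L \<subseteq> ?R"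
  proof
    fix A assume "A \<in> ?L"
    then obtain a where a: "a \<in> {..<n} \<rightarrow>\<^sub>E P" "A = {x \<in> space M. \<forall>i<n. (T ^^ i) x \<in> a i}" "A \<noteq> {}"
      unfolding refinement_def by blast
    then have A: "A = itinerary T P n -` {a} \<inter> space M" using itinerary_vimage by simp
    with a(3) obtain x where "x \<in> space M" "itinerary T P n x = a" by blast
    with A show "A \<in> ?R" by blast
  qed
  show "?R \<subseteq> ?L"
  proof
    fix A assume "A \<in> ?R"
    then obtain x where x: "x \<in> space M" "A = itinerary T P n -` {itinerary T P n x} \<inter> space M"
      by blast
    then show "A \<in> ?L"
      using itinerary_vimage[OF itinerary_PiE[OF x(1)]] itinerary_PiE[OF x(1)]
      unfolding refinement_def by blast
  qed
qed

lemma partition_entropy_eq: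
  "partition_entropy M (refinement M T P n) =
    - (\<Sum>a\<in>itinerary T P n ` space M. prob (itinerary T P n -` {a} \<inter> space M) *
        ln (prob (itinerary T P n -` {a} \<inter> space M)))"
proof -
  have "inj_on (\<lambda>a. itinerary T P n -` {a} \<inter> space M) (itinerary T P n ` space M)"
    by (rule inj_onI) blast
  then show ?thesis
    unfolding partition_entropy_def refinement_eq by (simp add: sum.reindex)
qed

text \<open>The superset \<open>S\<close> serves the itinerary started at a later time, which may
  take fewer values than the itinerary itself; values not taken contribute
  \<open>0 * ln 0 = 0\<close>.\<close>

lemma entropy_simple:
  assumes "simple_function M X" "finite S" "X ` space M \<subseteq> S"
  shows "entropy_Pow (X) = - (\<Sum>a\<in>S. prob (X -` {a} \<inter> space M) * ln (prob (X -` {a} \<inter> space M)))"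
proof -
  have "entropy_Pow (X) = - (\<Sum>a\<in>X ` space M. prob (X -` {a} \<inter> space M) * ln (prob (X -` {a} \<inter> space M)))"
    using entropy_simple_distributed[OF simple_distributedI[OF assms(1) measure_nonneg refl]]
    by (simp add: log_def)
  also have "\<dots> = - (\<Sum>a\<in>S. prob (X -` {a} \<inter> space M) * ln (prob (X -` {a} \<inter> space M)))"
  proof -
    have "X -` {a} \<inter> space M = {}" if "a \<notin> X ` space M" for a using that by blast
    then show ?thesis using assms by (intro arg_cong[where f = uminus] sum.mono_neutral_left) auto
  qed
  finally show ?thesis .
qed

lemma partition_entropy_eq_H: "partition_entropy M (refinement M T P n) = entropy_Pow (itinerary T P n)"
  unfolding partition_entropy_eq
  by (rule entropy_simple[OF itinerary_simple itinerary_image_finite order_refl, symmetric])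

lemma partition_entropy_nonneg: "0 \<le> partition_entropy M (refinement M T P n)"
proof -
  have "prob A * ln (prob A) \<le> 0" for A
    by (cases "prob A = 0") (auto simp: zero_less_measure_iff intro!: mult_nonneg_nonpos)
  then show ?thesis unfolding partition_entropy_def by (simp add: sum_nonpos)
qed

text \<open>A word of length \<open>m + n\<close> is glued from the itinerary \<open>X\<close> up to
  time \<open>m\<close> and the itinerary \<open>Y\<close> from time \<open>m\<close> on. Joint
  entropy is at most the sum of both entropies, and by invariance \<open>Y\<close> has the law of an
  itinerary of length \<open>n\<close>.\<close>

lemma partition_entropy_subadditive:
  "partition_entropy M (refinement M T P (m + n))
    \<le> partition_entropy M (refinement M T P m) + partition_entropy M (refinement M T P n)"
proof -
  define X where "X = itinerary T P m"
  define Y where "Y = (\<lambda>x. itinerary T P n ((T ^^ m) x))"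
  define f where "f = (\<lambda>(a, b). \<lambda>i\<in>{..<m + n}. if i < m then a i else b (i - m) :: 'a set)"
  have X: "simple_function M X" by (simp add: X_def itinerary_simple)
  have Y_vimage: "Y -` {a} \<inter> space M = (T ^^ m) -` (itinerary T P n -` {a} \<inter> space M) \<inter> space M" for a
    using funpow_space by (auto simp: Y_def)
  have Y_image: "Y ` space M \<subseteq> itinerary T P n ` space M"
    using funpow_space by (auto simp: Y_def)
  have Y: "simple_function M Y"
    unfolding simple_function_def Y_vimage
  proof (intro conjI ballI)
    show "finite (Y ` space M)" using Y_image itinerary_image_finite by (rule finite_subset)
    fix a
    show "(T ^^ m) -` (itinerary T P n -` {a} \<inter> space M) \<inter> space M \<in> sets M"
      by (intro measurable_sets[OF funpow_meas] simple_functionD(2)[OF itinerary_simple])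
  qed
  have "entropy_Pow (Y) = - (\<Sum>a\<in>itinerary T P n ` space M. prob (Y -` {a} \<inter> space M) * ln (prob (Y -` {a} \<inter> space M)))"
    by (rule entropy_simple[OF Y itinerary_image_finite Y_image])
  also have "\<dots> = entropy_Pow (itinerary T P n)"
    unfolding Y_vimage prob_funpow_vimage[OF simple_functionD(2)[OF itinerary_simple]]
    by (rule entropy_simple[OF itinerary_simple itinerary_image_finite order_refl, symmetric])
  finally have HY: "entropy_Pow (Y) = entropy_Pow (itinerary T P n)" .
  have "itinerary T P (m + n) = f \<circ> (\<lambda>x. (X x, Y x))"
  proof (intro ext)
    fix x i
    have "(T ^^ i) x = (T ^^ (i - m)) ((T ^^ m) x)" if "\<not> i < m"
      using that by (simp add: funpow_add[of "i - m" m, simplified, symmetric, unfolded comp_def]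
          flip: comp_apply[of "T ^^ (i - m)" "T ^^ m"] funpow_add)
    then show "itinerary T P (m + n) x i = (f \<circ> (\<lambda>x. (X x, Y x))) x i"
      by (auto simp: itinerary_def f_def X_def Y_def)
  qed
  then have "entropy_Pow (itinerary T P (m + n)) \<le> entropy_Pow (\<lambda>x. (X x, Y x))"
    using entropy_data_processing[OF simple_function_Pair[OF X Y]] by simp
  also have "\<dots> = entropy_Pow (X) + conditional_entropy_Pow Y X" by (rule entropy_chain_rule[OF X Y])
  also have "\<dots> \<le> entropy_Pow (X) + entropy_Pow (Y)" using conditional_entropy_less_eq_entropy[OF Y X] by simp
  finally show ?thesis unfolding partition_entropy_eq_H HY X_def .
qed

lemma entropy_rate_lim:
  "(\<lambda>n. partition_entropy M (refinement M T P n) / real n) \<longlonglongrightarrow> entropy_rate M T P"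
  unfolding entropy_rate_def
  using subadditive_convergent[OF partition_entropy_nonneg partition_entropy_subadditive]
  by (simp add: convergent_LIMSEQ_iff)

lemma entropy_rate_le:
  assumes "\<And>n. 1 \<le> n \<Longrightarrow> partition_entropy M (refinement M T P n) \<le> real n * L + C"
  shows "entropy_rate M T P \<le> L"
proof (rule LIMSEQ_le[OF entropy_rate_lim])
  have "(\<lambda>n. L + C * inverse (real n)) \<longlonglongrightarrow> L + C * 0"
    by (intro tendsto_intros lim_inverse_n)
  then show "(\<lambda>n. L + C * inverse (real n)) \<longlonglongrightarrow> L" by simp
  show "\<exists>N. \<forall>n\<ge>N. partition_entropy M (refinement M T P n) / real n \<le> L + C * inverse (real n)"
  proof (intro exI[of _ 1] allI impI)
    fix n :: nat assume "1 \<le> n"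
    then have "L + C * inverse (real n) = (real n * L + C) / real n" by (simp add: field_simps)
    then show "partition_entropy M (refinement M T P n) / real n \<le> L + C * inverse (real n)"
      using divide_right_mono[OF assms[OF \<open>1 \<le> n\<close>], of "real n"] by (simp only: of_nat_0_le_iff)
  qed
qed

lemma entropy_rate_ge:
  assumes "\<And>n. 1 \<le> n \<Longrightarrow> real n * L - C \<le> partition_entropy M (refinement M T P n)"
  shows "L \<le> entropy_rate M T P"
proof (rule LIMSEQ_le[OF _ entropy_rate_lim])
  have "(\<lambda>n. L - C * inverse (real n)) \<longlonglongrightarrow> L - C * 0"
    by (intro tendsto_intros lim_inverse_n)
  then show "(\<lambda>n. L - C * inverse (real n)) \<longlonglongrightarrow> L" by simp
  show "\<exists>N. \<forall>n\<ge>N. L - C * inverse (real n) \<le> partition_entropy M (refinement M T P n) / real n"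
  proof (intro exI[of _ 1] allI impI)
    fix n :: nat assume "1 \<le> n"
    then have "L - C * inverse (real n) = (real n * L - C) / real n" by (simp add: field_simps)
    then show "L - C * inverse (real n) \<le> partition_entropy M (refinement M T P n) / real n"
      using divide_right_mono[OF assms[OF \<open>1 \<le> n\<close>], of "real n"] by (simp only: of_nat_0_le_iff)
  qed
qed

end

section \<open>Coding of orbits\<close>

text \<open>Since \<open>lam ^ n\<close> is the left endpoint of \<open>W lam n\<close>, inverting the branches along the orbit of \<open>x\<close>
  expands \<open>x\<close> into this series in its codes.\<close>

definition decode :: "real \<Rightarrow> (nat \<Rightarrow> nat) \<Rightarrow> real"
  where "decode lam a = (\<Sum>k. lam ^ a k * (\<Prod>i<k. width lam (a i)))"

context contraction
begin

lemma decode_term_bounds: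
  "0 < lam ^ a k * (\<Prod>i<k. width lam (a i))"
  "lam ^ a k * (\<Prod>i<k. width lam (a i)) \<le> (1 - lam) ^ k"
proof -
  show "0 < lam ^ a k * (\<Prod>i<k. width lam (a i))"
    using lam_pos width_pos by (intro mult_pos_pos prod_pos) auto
  have "(\<Prod>i<k. width lam (a i)) \<le> (\<Prod>i<k. 1 - lam)"
    using width_pos width_le by (intro prod_mono) (auto intro: less_imp_le)
  moreover have "0 \<le> (\<Prod>i<k. width lam (a i))"
    using width_pos by (intro prod_nonneg) (auto intro: less_imp_le)
  ultimately have "lam ^ a k * (\<Prod>i<k. width lam (a i)) \<le> 1 * (1 - lam) ^ k"
    using lam_power_le_1 lam_pos by (intro mult_mono) auto
  then show "lam ^ a k * (\<Prod>i<k. width lam (a i)) \<le> (1 - lam) ^ k" by simp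
qed

lemma decode_summable: "summable (\<lambda>k. lam ^ a k * (\<Prod>i<k. width lam (a i)))"
proof (rule summable_comparison_test'[of "\<lambda>k. (1 - lam) ^ k" 0])
  show "summable (\<lambda>k. (1 - lam) ^ k)"
    using lam_pos lam_less_1 by (intro summable_geometric) auto
  show "norm (lam ^ a k * (\<Prod>i<k. width lam (a i))) \<le> (1 - lam) ^ k" for k
    using decode_term_bounds[of a k] by simp
qed

text \<open>Splitting off the first term exhibits the series as the inverse of branch
  \<open>a 0\<close> applied to the decoded tail, so that \<open>F lam\<close> acts on decoded
  points by shifting the sequence.\<close>

lemma decode_shift: "decode lam a = lam ^ a 0 + width lam (a 0) * decode lam (\<lambda>k. a (Suc k))"
proof -
  have "decode lam a = lam ^ a 0 + (\<Sum>k. lam ^ a (Suc k) * (\<Prod>i<Suc k. width lam (a i)))"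
    unfolding decode_def using suminf_split_head[OF decode_summable[of a]] by simp
  also have "(\<lambda>k. lam ^ a (Suc k) * (\<Prod>i<Suc k. width lam (a i))) =
      (\<lambda>k. width lam (a 0) * (lam ^ a (Suc k) * (\<Prod>i<k. width lam (a (Suc i)))))"
    unfolding prod.lessThan_Suc_shift by (simp add: mult_ac)
  also have "(\<Sum>k. width lam (a 0) * (lam ^ a (Suc k) * (\<Prod>i<k. width lam (a (Suc i))))) =
      width lam (a 0) * decode lam (\<lambda>k. a (Suc k))"
    unfolding decode_def by (rule suminf_mult[OF decode_summable[of "\<lambda>k. a (Suc k)"]])
  finally show ?thesis .
qed

lemma decode_pos: "0 < decode lam a"
  unfolding decode_def using decode_term_bounds(1) by (intro suminf_pos decode_summable) auto

text \<open>By the transition rule the tail stays below \<open>lam ^ (a 0 - 2)\<close>, the right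
  end of the image of branch \<open>a 0\<close>, and \<open>power_eq_width\<close> closes the
  induction on partial sums. The limit preserves only a weak inequality, which suits domains closed
  on the right.\<close>

lemma decode_le:
  assumes "\<And>k. 1 \<le> a k" "\<And>k. a k - 1 \<le> a (Suc k)"
  shows "decode lam a \<le> lam ^ (a 0 - 1)"
proof -
  have "(\<Sum>k<n. lam ^ a k * (\<Prod>i<k. width lam (a i))) \<le> lam ^ (a 0 - 1)" for n
    using assms
  proof (induction n arbitrary: a)
    case 0
    then show ?case using lam_pos by simp
  next
    case (Suc n)
    have "(\<Sum>k<Suc n. lam ^ a k * (\<Prod>i<k. width lam (a i))) =
        lam ^ a 0 + width lam (a 0) * (\<Sum>k<n. lam ^ a (Suc k) * (\<Prod>i<k. width lam (a (Suc i))))"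
      unfolding sum.lessThan_Suc_shift prod.lessThan_Suc_shift
      by (simp add: sum_distrib_left mult_ac)
    also have "\<dots> \<le> lam ^ a 0 + width lam (a 0) * lam ^ (a (Suc 0) - 1)"
      using Suc.IH[of "\<lambda>k. a (Suc k)"] Suc.prems width_pos[of "a 0"]
      by (intro add_left_mono mult_left_mono) auto
    also have "lam ^ (a (Suc 0) - 1) \<le> lam ^ (a 0 - 2)"
      using Suc.prems(2)[of 0] lam_pos lam_less_1 by (intro power_decreasing) auto
    also have "lam ^ a 0 + width lam (a 0) * lam ^ (a 0 - 2) = lam ^ (a 0 - 1)"
      using power_eq_width[OF Suc.prems(1)[of 0]] by simp
    finally show ?case using width_pos[of "a 0"] by (simp add: mult_left_mono less_imp_le)
  qed
  then show ?thesis
    unfolding decode_def by (intro suminf_le_const decode_summable) auto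
qed

lemma
  assumes "\<And>k. 1 \<le> a k" "\<And>k. a k - 1 \<le> a (Suc k)"
  shows decode_in: "decode lam a \<in> {0<..1}"
    and code_decode: "code lam (decode lam a) = a 0"
    and F_decode: "F lam (decode lam a) = decode lam (\<lambda>k. a (Suc k))"
proof -
  have "lam ^ a 0 < decode lam a"
    using decode_shift[of a] decode_pos[of "\<lambda>k. a (Suc k)"] width_pos[of "a 0"] by simp
  then have "decode lam a \<in> W lam (a 0)"
    using decode_le[of a, OF assms] by (auto simp: W_def)
  then show *: "decode lam a \<in> {0<..1}" "code lam (decode lam a) = a 0"
    using in_W_iff assms(1) by blast+
  show "F lam (decode lam a) = decode lam (\<lambda>k. a (Suc k))"
    unfolding F_eq[OF *(1)] *(2) using decode_shift[of a] width_pos[of "a 0"] by simp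
qed

end

text \<open>A system with an \<open>\<nat>\<close>-valued observable obeying the transition rule of the branches
  \<open>W lam n\<close> is mapped into \<open>F lam\<close> by expanding the sequence of observations.\<close>

locale coded_system = contraction lam for lam :: real +
  fixes S :: "'a measure" and G :: "'a \<Rightarrow> 'a" and b :: "'a \<Rightarrow> nat"
  assumes G_meas: "G \<in> S \<rightarrow>\<^sub>M S" and b_meas: "b \<in> S \<rightarrow>\<^sub>M count_space UNIV"
    and b_pos: "x \<in> space S \<Longrightarrow> 1 \<le> b x"
    and b_step: "x \<in> space S \<Longrightarrow> b x - 1 \<le> b (G x)"
begin

text \<open>Used for two systems: the dyadic map with its own codes, where it transports Lebesgue
  measure to a conformal measure, and the reflected walk, where it transports a stationary measure
  to an invariant one.\<close>

definition theta :: "'a \<Rightarrow> real"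
  where "theta x = decode lam (\<lambda>k. b ((G ^^ k) x))"

lemma G_funpow_meas: "G ^^ k \<in> S \<rightarrow>\<^sub>M S"
  by (rule measurable_funpow[OF G_meas])

lemma G_funpow_space: "x \<in> space S \<Longrightarrow> (G ^^ k) x \<in> space S"
  using measurable_space[OF G_funpow_meas] .

lemma
  assumes "x \<in> space S"
  shows theta_in: "theta x \<in> {0<..1}"
    and code_theta: "code lam (theta x) = b x"
    and F_theta: "F lam (theta x) = theta (G x)"
proof -
  have *: "1 \<le> b ((G ^^ k) x)" "b ((G ^^ k) x) - 1 \<le> b ((G ^^ Suc k) x)" for k
    using b_pos b_step G_funpow_space[OF assms] by auto
  show "theta x \<in> {0<..1}" "code lam (theta x) = b x"
    unfolding theta_def
    using decode_in[of "\<lambda>k. b ((G ^^ k) x)", OF *] code_decode[of "\<lambda>k. b ((G ^^ k) x)", OF *]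
    by simp_all
  show "F lam (theta x) = theta (G x)"
    unfolding theta_def using F_decode[of "\<lambda>k. b ((G ^^ k) x)", OF *] by (simp add: funpow_swap1)
qed

lemma F_funpow_theta: "x \<in> space S \<Longrightarrow> (F lam ^^ k) (theta x) = theta ((G ^^ k) x)"
  by (induction k) (simp_all add: F_theta G_funpow_space)

lemma theta_meas: "theta \<in> S \<rightarrow>\<^sub>M restrict_space borel {0<..1}"
proof (rule measurable_restrict_space2)
  have "(\<lambda>x. f (b ((G ^^ k) x))) \<in> borel_measurable S" for f :: "nat \<Rightarrow> real" and k
    by (rule measurable_compose[OF measurable_compose[OF G_funpow_meas b_meas]]) simp
  then show "theta \<in> borel_measurable S"
    unfolding theta_def decode_def
    by (intro borel_measurable_suminf borel_measurable_times borel_measurable_prod)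
qed (use theta_in in auto)

definition pushed :: "'a measure \<Rightarrow> real measure"
  where "pushed \<kappa> = distr \<kappa> (restrict_space borel {0<..1}) theta"

lemma sets_pushed: "sets (pushed \<kappa>) = sets (restrict_space borel {0<..1})"
  by (simp add: pushed_def)

lemma space_pushed: "space (pushed \<kappa>) = {0<..1}"
  by (simp add: pushed_def space_restrict_space)

lemma
  assumes "sets \<kappa> = sets S"
  shows measure_pushed: "A \<in> sets (restrict_space borel {0<..1}) \<Longrightarrow>
      measure (pushed \<kappa>) A = measure \<kappa> (theta -` A \<inter> space S)"
    and prob_space_pushed: "prob_space \<kappa> \<Longrightarrow> prob_space (pushed \<kappa>)"
proof -
  have *: "theta \<in> \<kappa> \<rightarrow>\<^sub>M restrict_space borel {0<..1}"
    using theta_meas measurable_cong_sets[OF assms refl] by blast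
  show "A \<in> sets (restrict_space borel {0<..1}) \<Longrightarrow>
      measure (pushed \<kappa>) A = measure \<kappa> (theta -` A \<inter> space S)"
    unfolding pushed_def using measure_distr[OF *] sets_eq_imp_space_eq[OF assms] by simp
  show "prob_space \<kappa> \<Longrightarrow> prob_space (pushed \<kappa>)"
    unfolding pushed_def by (rule prob_space.prob_space_distr[OF _ *])
qed

lemma pushed_invariant:
  assumes \<kappa>: "sets \<kappa> = sets S" "prob_space \<kappa>" "distr \<kappa> \<kappa> G = \<kappa>"
  shows "pushed \<kappa> \<in> invariant_probs {0<..1} (F lam)"
proof -
  have theta: "theta \<in> \<kappa> \<rightarrow>\<^sub>M restrict_space borel {0<..1}" and G: "G \<in> \<kappa> \<rightarrow>\<^sub>M \<kappa>"
    using theta_meas G_meas measurable_cong_sets[OF \<kappa>(1) refl] measurable_cong_sets[OF \<kappa>(1) \<kappa>(1)]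
    by blast+
  have F: "F lam \<in> pushed \<kappa> \<rightarrow>\<^sub>M pushed \<kappa>"
    using F_measurable measurable_cong_sets[OF sets_pushed sets_pushed] by blast
  have "distr (pushed \<kappa>) (pushed \<kappa>) (F lam) =
      distr (pushed \<kappa>) (restrict_space borel {0<..1}) (F lam)"
    by (rule distr_cong) (simp_all add: sets_pushed)
  also have "\<dots> = distr \<kappa> (restrict_space borel {0<..1}) (F lam \<circ> theta)"
    unfolding pushed_def by (rule distr_distr[OF F_measurable theta])
  also have "\<dots> = distr \<kappa> (restrict_space borel {0<..1}) (theta \<circ> G)"
    using F_theta sets_eq_imp_space_eq[OF \<kappa>(1)] by (intro distr_cong) auto
  also have "\<dots> = distr (distr \<kappa> \<kappa> G) (restrict_space borel {0<..1}) theta"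
    by (rule distr_distr[OF theta G, symmetric])
  finally have "distr (pushed \<kappa>) (pushed \<kappa>) (F lam) = pushed \<kappa>"
    by (simp add: \<kappa>(3) pushed_def)
  with F prob_space_pushed[OF \<kappa>(1,2)] show ?thesis
    by (simp add: invariant_probs_def borel_prob_def sets_pushed)
qed

end

section \<open>Lebesgue measure under the dyadic map\<close>

lemma measure_lborel_affine_branch:
  fixes c :: real
  assumes "0 < c" "E \<in> sets borel"
  shows "measure lborel ({a<..a + h} \<inter> {x. (x - a) / c \<in> E}) = c * measure lborel (E \<inter> {0<..h / c})"
proof -
  have meas: "{a<..a + h} \<inter> {x. (x - a) / c \<in> E} \<in> sets borel"
  proof -
    have "(\<lambda>x. (x - a) / c) -` E \<inter> space borel \<in> sets borel"
      by (rule measurable_sets[OF _ assms(2)]) simp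
    then show ?thesis by (auto simp: vimage_def)
  qed
  have "emeasure lborel ({a<..a + h} \<inter> {x. (x - a) / c \<in> E}) =
      (\<integral>\<^sup>+x. indicator ({a<..a + h} \<inter> {x. (x - a) / c \<in> E}) x \<partial>lborel)"
    using meas by simp
  also have "\<dots> = ennreal \<bar>c\<bar> * (\<integral>\<^sup>+x. indicator ({a<..a + h} \<inter> {x. (x - a) / c \<in> E}) (a + c * x) \<partial>lborel)"
    using assms meas by (intro nn_integral_real_affine) auto
  also have "(\<lambda>x. indicator ({a<..a + h} \<inter> {x. (x - a) / c \<in> E}) (a + c * x)) =
      (indicator (E \<inter> {0<..h / c}) :: real \<Rightarrow> ennreal)"
  proof
    fix x
    have "a + c * x \<in> {a<..a + h} \<longleftrightarrow> x \<in> {0<..h / c}"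
      using assms(1) by (simp add: zero_less_mult_iff pos_le_divide_eq mult.commute)
    then show "indicator ({a<..a + h} \<inter> {x. (x - a) / c \<in> E}) (a + c * x) =
        (indicator (E \<inter> {0<..h / c}) x :: ennreal)"
      using assms(1) by (auto simp: indicator_def)
  qed
  also have "(\<integral>\<^sup>+x. indicator (E \<inter> {0<..h / c}) x \<partial>lborel) = emeasure lborel (E \<inter> {0<..h / c})"
    using assms by simp
  finally show ?thesis
    using assms(1) by (simp add: measure_def enn2real_mult)
qed

definition unit_lebesgue :: "real measure"
  where "unit_lebesgue = restrict_space lborel {0<..1}"

lemma sets_unit_lebesgue: "sets unit_lebesgue = sets (restrict_space borel {0<..1})"
  unfolding unit_lebesgue_def by (rule sets_restrict_space_cong) simp

lemma space_unit_lebesgue: "space unit_lebesgue = {0<..1}"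
  by (simp add: unit_lebesgue_def space_restrict_space)

lemma measure_unit_lebesgue: "A \<subseteq> {0<..1} \<Longrightarrow> measure unit_lebesgue A = measure lborel A"
  unfolding unit_lebesgue_def by (rule measure_restrict_space) auto

lemma prob_space_unit_lebesgue: "prob_space unit_lebesgue"
  by (rule prob_spaceI)
     (simp add: unit_lebesgue_def space_restrict_space emeasure_restrict_space)

interpretation half: contraction "1 / 2"
  by standard auto

text \<open>At parameter \<open>1 / 2\<close> every \<open>width\<close> equals the corresponding
  \<open>weight\<close>, so Lebesgue measure itself is conformal; this is the case
  \<open>t = 1\<close>, \<open>p = 0\<close>.\<close>

lemma measure_half_branch:
  assumes "1 \<le> n" "E \<in> sets unit_lebesgue"
  shows "measure unit_lebesgue (W (1 / 2) n \<inter> F (1 / 2) -` E) =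
    weight n * measure unit_lebesgue (E \<inter> {0<..(1 / 2) ^ (n - 2)})"
proof -
  have E: "E \<in> sets borel" "E \<subseteq> {0<..1}"
    using assms(2) by (auto simp: sets_unit_lebesgue half.sets_unit_iff)
  have w: "width (1 / 2) n = weight n" by (simp add: width_def weight_def)
  have "(1 / 2 :: real) ^ (n - 1) = (1 / 2) ^ n + weight n * (1 / 2) ^ (n - 2)"
    using half.power_eq_width[OF assms(1)] by (simp add: w)
  then have "W (1 / 2) n \<inter> F (1 / 2) -` E =
      {(1 / 2) ^ n<..(1 / 2) ^ n + weight n * (1 / 2) ^ (n - 2)} \<inter> {x. (x - (1 / 2) ^ n) / weight n \<in> E}"
    using half.in_W_iff[OF assms(1)] half.F_eq w unfolding W_def[of "1 / 2" n] by auto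
  moreover have "W (1 / 2) n \<inter> F (1 / 2) -` E \<subseteq> {0<..1}"
    using half.W_subset by blast
  moreover have "weight n * (1 / 2) ^ (n - 2) / weight n = (1 / 2) ^ (n - 2)" "0 < weight n"
    by (simp_all add: weight_def)
  moreover have "E \<inter> {0<..(1 / 2) ^ (n - 2)} \<subseteq> {0<..1}" using E(2) by blast
  ultimately show ?thesis
    using measure_lborel_affine_branch[of "weight n" E "(1 / 2) ^ n" "weight n * (1 / 2) ^ (n - 2)"] E(1)
    by (simp add: measure_unit_lebesgue)
qed

section \<open>The random walk of codes\<close>

text \<open>The walk jumps up arbitrarily far, but its step law is geometric of ratio
  \<open>1 / 2\<close>: moving the target one column to the right halves the mass arriving from all
  earlier sources and adds one new source. \<open>step_Suc\<close> records this, and so relates two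
  entries of the same row \<open>Suc n\<close>.\<close>

locale oscillating_walk =
  fixes c :: "nat \<Rightarrow> nat \<Rightarrow> real"
  assumes start: "c 0 k = (1 / 2) ^ Suc k"
    and step_0: "c (Suc n) 0 = (c n 0 + c n 1) / 2"
    and step_Suc: "c (Suc n) (Suc k) = (c (Suc n) k + c n (k + 2)) / 2"
    and nonneg: "0 \<le> c n k"
    and sum_le_1: "(\<Sum>k<K. c n k) \<le> 1"
begin

text \<open>What keeps the rows decreasing: \<open>step_Suc\<close> averages
  \<open>c (Suc n) k\<close> with \<open>c n (k + 2)\<close>, so the new row drops after column
  \<open>k\<close> as soon as the latter term is the smaller one.\<close>

lemma shift_le_step:
  assumes "\<And>k. c n (Suc k) \<le> c n k"
  shows "c n (Suc k) \<le> c (Suc n) k"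
proof (induction k)
  case 0
  show ?case using assms[of 0] by (simp add: step_0)
next
  case (Suc k)
  then show ?case using assms[of "Suc k"] by (simp add: step_Suc)
qed

lemma antitone: "c n (Suc k) \<le> c n k"
proof (induction n arbitrary: k)
  case 0
  show ?case by (simp add: start)
next
  case (Suc n)
  have "c n (k + 2) \<le> c (Suc n) k"
    using shift_le_step[OF Suc, of k] Suc[of "Suc k"] by simp
  then show ?case by (simp add: step_Suc)
qed

lemma tendsto_zero: "(\<lambda>n. c n k) \<longlonglongrightarrow> 0"
proof -
  have "decseq (\<lambda>n. c n 0)"
    using antitone[of _ 0] by (intro decseq_SucI) (simp add: step_0)
  then obtain b where b: "(\<lambda>n. c n 0) \<longlonglongrightarrow> b"
    using decseq_convergent[of "\<lambda>n. c n 0" 0] nonneg by metis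
  \<comment> \<open>Two neighbouring columns are treated together because \<open>step_Suc\<close>,
    solved for its last term, expresses column \<open>k + 2\<close> by the two columns before
    it.\<close>
  have lim: "(\<lambda>n. c n k) \<longlonglongrightarrow> b \<and> (\<lambda>n. c n (Suc k)) \<longlonglongrightarrow> b" for k
  proof (induction k)
    case 0
    have "(\<lambda>n. 2 * c (Suc n) 0 - c n 0) \<longlonglongrightarrow> 2 * b - b"
      by (intro tendsto_intros b LIMSEQ_Suc)
    moreover have "2 * c (Suc n) 0 - c n 0 = c n (Suc 0)" for n
      using step_0[of n] by simp
    ultimately show ?case using b by simp
  next
    case (Suc k)
    then have "(\<lambda>n. 2 * c (Suc n) (Suc k) - c (Suc n) k) \<longlonglongrightarrow> 2 * b - b"
      by (intro tendsto_intros LIMSEQ_Suc) auto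
    moreover have "2 * c (Suc n) (Suc k) - c (Suc n) k = c n (Suc (Suc k))" for n
      using step_Suc[of n k] by simp
    ultimately show ?case using Suc by simp
  qed
  have "real K * b \<le> 1" for K
  proof (rule LIMSEQ_le_const2)
    have "(\<lambda>n. \<Sum>k<K. c n k) \<longlonglongrightarrow> (\<Sum>k<K. b)"
      using lim by (intro tendsto_sum) auto
    then show "(\<lambda>n. \<Sum>k<K. c n k) \<longlonglongrightarrow> real K * b" by simp
  qed (use sum_le_1 in auto)
  then have "b \<le> 0"
    using reals_Archimedean3[of b] by (meson not_le)
  moreover have "0 \<le> b"
    using b nonneg by (intro LIMSEQ_le_const) auto
  ultimately show ?thesis using lim by simp
qed

text \<open>If one column were summable then all would be, and the column sums would decrease
  by \<open>1\<close> from each column to the next.\<close>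

lemma not_summable: "\<not> summable (\<lambda>n. c n k)"
proof
  assume *: "summable (\<lambda>n. c n k)"
  \<comment> \<open>Carries summability from column \<open>k\<close> back to column 0: from code 1
    the walk reaches code \<open>k + 1\<close> in one step with probability
    \<open>(1 / 2) ^ Suc k\<close>.\<close>
  have lower: "(1 / 2) ^ Suc k * c n 0 \<le> c (Suc n) k" for n k
  proof (induction k)
    case 0
    show ?case using nonneg[of n 1] by (simp add: step_0)
  next
    case (Suc k)
    have "(1 / 2) ^ Suc (Suc k) * c n 0 = ((1 / 2) ^ Suc k * c n 0) / 2" by simp
    also have "\<dots> \<le> c (Suc n) (Suc k)"
      unfolding step_Suc[of n k]
      by (intro divide_right_mono order_trans[OF Suc]) (simp_all add: nonneg)
    finally show ?case .
  qed
  have "summable (\<lambda>n. (1 / 2) ^ Suc k * c n 0)"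
    by (rule summable_comparison_test'[of "\<lambda>n. c (Suc n) k" 0])
       (use lower nonneg * in \<open>auto simp: summable_Suc_iff[of "\<lambda>n. c n k"]\<close>)
  then have "summable (\<lambda>n. c n 0)"
    by (subst (asm) summable_cmult_iff) auto
  moreover have le: "c n k \<le> c n 0" for n k
    by (induction k) (auto intro: order_trans[OF antitone])
  ultimately have sm: "summable (\<lambda>n. c n k)" for k
    by (intro summable_comparison_test'[of "\<lambda>n. c n 0" 0 "\<lambda>n. c n k"])
       (simp_all add: nonneg)
  define B where "B k = (\<Sum>n. c n k)" for k
  have shift: "(\<Sum>n. c (Suc n) k) = B k - (1 / 2) ^ Suc k" for k
    using suminf_split_head[OF sm] by (simp add: B_def start)
  have smS: "summable (\<lambda>n. c (Suc n) k)" for k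
    using sm summable_Suc_iff[of "\<lambda>n. c n k"] by blast
  \<comment> \<open>In the relations summed over \<open>n\<close> the starting masses cancel for
    \<open>k > 0\<close>, leaving second differences equal to zero; only the relation for column 0
    keeps its \<open>1 / 2\<close>, and this fixes the slope at -1.\<close>
  have "B k = B 0 - real k \<and> B (Suc k) = B 0 - real (Suc k)" for k
  proof (induction k)
    case 0
    have "(\<Sum>n. c (Suc n) 0) = (B 0 + B 1) / 2"
      unfolding step_0 B_def by (subst suminf_divide) (auto intro: sm summable_add simp: suminf_add sm)
    then show ?case using shift[of 0] by simp
  next
    case (Suc k)
    have "(\<Sum>n. c (Suc n) (Suc k)) = (B k - (1 / 2) ^ Suc k + B (k + 2)) / 2"
      unfolding step_Suc shift[symmetric] unfolding B_def
      by (subst suminf_divide)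
         (use suminf_add[OF smS[of k] sm[of "k + 2"]] summable_add[OF smS sm] in auto)
    then have "B (k + 2) = 2 * B (Suc k) - B k"
      using shift[of "Suc k"] by simp
    then show ?case using Suc by simp
  qed
  moreover have "0 \<le> B k" for k
    unfolding B_def using nonneg sm by (intro suminf_nonneg)
  moreover obtain k where "B 0 < real k" using reals_Archimedean2 by blast
  ultimately show False by (metis diff_less_0_iff_less not_le)
qed

end

text \<open>Conformality tested only on sets inside one branch domain, with \<open>E\<close> cut
  down to the image of the branch. If \<open>lam powr t = 1 / 2\<close>, this is equivalent to
  conformality at the critical parameter by \<open>conformal_imp_fair\<close> and
  \<open>conformal\<close>.\<close>

locale fair_conformal = contraction lam + prob_space m for lam and m :: "real measure" +
  assumes sets_m: "sets m = sets (restrict_space borel {0<..1})"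
    and measure_branch: "1 \<le> n \<Longrightarrow> E \<in> sets m \<Longrightarrow>
      prob (W lam n \<inter> F lam -` E) = weight n * prob (E \<inter> {0<..lam ^ (n - 2)})"
begin

lemma space_m: "space m = {0<..1}"
  using sets_eq_imp_space_eq[OF sets_m] by (simp add: space_restrict_space)

lemma sets_m_iff: "A \<in> sets m \<longleftrightarrow> A \<in> sets borel \<and> A \<subseteq> {0<..1}"
  by (simp add: sets_m sets_unit_iff)

lemma F_meas_m: "F lam \<in> m \<rightarrow>\<^sub>M m"
  using F_measurable measurable_cong_sets[OF sets_m sets_m] by blast

lemma W_in_sets: "W lam n \<in> sets m"
  using W_subset by (simp add: sets_m_iff)

lemma head_in_sets: "{0<..lam ^ n} \<in> sets m"
  using lam_power_le_1[of n] unfolding sets_m_iff by auto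

lemma W_Int_vimage: "W lam n \<inter> F lam -` space m = W lam n"
  unfolding space_m using F_closed W_subset[of n] by blast

text \<open>The masses satisfy a second-order recursion with characteristic polynomial
  \<open>(z - 1 / 2)\<^sup>2\<close>; the starting values 1 and \<open>1 / 2\<close> select the
  purely geometric solution.\<close>

lemma prob_head: "prob {0<..lam ^ n} = (1 / 2) ^ n"
proof -
  have W: "prob (W lam n) = weight n * prob {0<..lam ^ (n - 2)}" if "1 \<le> n" for n
  proof -
    have "W lam n \<inter> F lam -` space m = W lam n"
      by (rule W_Int_vimage)
    moreover have "space m \<inter> {0<..lam ^ (n - 2)} = {0<..lam ^ (n - 2)}"
      using lam_power_le_1[of "n - 2"] by (auto simp: space_m)
    ultimately show ?thesis
      using measure_branch[OF that sets.top] by simp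
  qed
  have diff: "prob {0<..lam ^ Suc n} = prob {0<..lam ^ n} - prob (W lam (Suc n))" for n
  proof -
    have le: "lam ^ Suc n \<le> lam ^ n"
      using lam_pos lam_less_1 by (intro power_decreasing) auto
    have "{0<..lam ^ n} = {0<..lam ^ Suc n} \<union> W lam (Suc n)"
    proof (intro set_eqI)
      fix x
      have "0 < lam ^ Suc n" using lam_pos by simp
      then show "x \<in> {0<..lam ^ n} \<longleftrightarrow> x \<in> {0<..lam ^ Suc n} \<union> W lam (Suc n)"
        using le unfolding W_def Un_iff greaterThanAtMost_iff diff_Suc_1 by linarith
    qed
    moreover have "{0<..lam ^ Suc n} \<inter> W lam (Suc n) = {}"
      by (auto simp: W_def)
    ultimately show ?thesis
      using finite_measure_Union[OF head_in_sets[of "Suc n"] W_in_sets[of "Suc n"]] by simp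
  qed
  have "prob {0<..lam ^ n} = (1 / 2) ^ n \<and> prob {0<..lam ^ Suc n} = (1 / 2) ^ Suc n"
  proof (induction n)
    case 0
    have "prob {0<..lam ^ 0} = 1" using prob_space by (simp add: space_m)
    then show ?case using diff[of 0] W[of 1] by (simp add: weight_def)
  next
    case (Suc n)
    have "prob (W lam (Suc (Suc n))) = (1 / 2) ^ n / 4"
      using Suc W[of "Suc (Suc n)"] by (simp add: weight_def)
    then show ?case using Suc diff[of "Suc n"] by simp
  qed
  then show ?thesis ..
qed

lemma prob_W:
  assumes "1 \<le> n" shows "prob (W lam n) = (1 / 2) ^ n"
proof -
  have "W lam n \<inter> F lam -` space m = W lam n"
    by (rule W_Int_vimage)
  moreover have "space m \<inter> {0<..lam ^ (n - 2)} = {0<..lam ^ (n - 2)}"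
    using lam_power_le_1[of "n - 2"] by (auto simp: space_m)
  ultimately have *: "prob (W lam n) = weight n * (1 / 2) ^ (n - 2)"
    using measure_branch[OF assms sets.top] prob_head by simp
  show ?thesis
  proof (cases "n = 1")
    case False
    then have "(1 / 2 :: real) ^ n = (1 / 2) ^ ((n - 2) + 2)"
      using assms by (intro arg_cong[where f = "\<lambda>k. (1 / 2) ^ k"]) simp
    then have "(1 / 2 :: real) ^ n = (1 / 2) ^ (n - 2) * (1 / 2)\<^sup>2"
      by (simp only: power_add)
    then show ?thesis using * False by (simp add: weight_def power2_eq_square)
  qed (use * in \<open>simp add: weight_def\<close>)
qed

definition pre :: "nat \<Rightarrow> real set \<Rightarrow> real set"
  where "pre k A = (F lam ^^ k) -` A \<inter> {0<..1}"

lemma pre_0: "A \<subseteq> {0<..1} \<Longrightarrow> pre 0 A = A"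
  by (auto simp: pre_def)

lemma pre_in_sets: "A \<in> sets m \<Longrightarrow> pre k A \<in> sets m"
  using measurable_sets[OF measurable_funpow[OF F_meas_m]] by (simp add: pre_def space_m)

lemma pre_Suc: "A \<subseteq> {0<..1} \<Longrightarrow> pre (Suc k) A = pre k (F lam -` A \<inter> {0<..1})"
  using F_funpow_closed by (auto simp: pre_def)

text \<open>One application of the transfer operator to a density that is constant on each
  \<open>W lam i\<close>. The induction hypothesis of \<open>prob_pre\<close> is an assumption here
  because the formula is used inside that induction and again after it, for the recursion
  \<open>prob_pre_Suc\<close>.\<close>

lemma prob_pre_Suc_of_prob_pre:
  assumes IH: "\<And>i B. 1 \<le> i \<Longrightarrow> B \<in> sets m \<Longrightarrow> B \<subseteq> W lam i \<Longrightarrow>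
      prob (pre k B) = 2 ^ i * prob (pre k (W lam i)) * prob B"
    and n: "1 \<le> n" and A: "A \<in> sets m" "A \<subseteq> W lam n"
  shows "prob (pre (Suc k) A) =
    (\<Sum>i\<in>{1..Suc n}. 2 ^ i * weight i * prob (pre k (W lam i))) * prob A"
proof -
  define D where "D i = W lam i \<inter> F lam -` A" for i
  have A_sub: "A \<subseteq> {0<..1}" using A by (simp add: sets_m_iff)
  have D_sets: "D i \<in> sets m" for i
  proof -
    have "D i = W lam i \<inter> (F lam -` A \<inter> space m)"
      using W_subset by (auto simp: D_def space_m)
    then show ?thesis
      using measurable_sets[OF F_meas_m A(1)] W_in_sets by (metis sets.Int)
  qed
  have D_disj: "disjoint_family_on D {1..Suc n}"
    unfolding disjoint_family_on_def D_def using in_W_iff by auto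
  have "code lam x \<in> {1..Suc n}" if "x \<in> {0<..1}" "F lam x \<in> A" for x
    using code_pos[OF that(1)] code_F[OF that(1)] that(2) A(2) in_W_iff[OF n] by fastforce
  then have "F lam -` A \<inter> {0<..1} = (\<Union>i\<in>{1..Suc n}. D i)"
    using W_subset in_W_code unfolding D_def by blast
  then have "pre (Suc k) A = (\<Union>i\<in>{1..Suc n}. pre k (D i))"
    unfolding pre_Suc[OF A_sub] by (auto simp: pre_def)
  also have "prob \<dots> = (\<Sum>i\<in>{1..Suc n}. prob (pre k (D i)))"
    using D_disj D_sets pre_in_sets
    by (intro finite_measure_finite_Union)
       (auto simp: disjoint_family_on_def pre_def)
  also have "\<dots> = (\<Sum>i\<in>{1..Suc n}. 2 ^ i * weight i * prob (pre k (W lam i)) * prob A)"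
  proof (rule sum.cong[OF refl])
    fix i assume i: "i \<in> {1..Suc n}"
    have "A \<subseteq> {0<..lam ^ (i - 2)}"
    proof
      fix x assume "x \<in> A"
      then have "x \<in> {0<..1}" "code lam x = n" using A(2) in_W_iff[OF n] by auto
      then show "x \<in> {0<..lam ^ (i - 2)}"
        using le_code_iff[of x i] i by auto
    qed
    then have "prob (D i) = weight i * prob A"
      using measure_branch[of i A] A(1) i unfolding D_def
      by (simp add: Int_absorb2)
    moreover have "D i \<subseteq> W lam i" by (auto simp: D_def)
    ultimately show "prob (pre k (D i)) = 2 ^ i * weight i * prob (pre k (W lam i)) * prob A"
      using IH[of i "D i"] D_sets i by simp
  qed
  finally show ?thesis by (simp only: sum_distrib_right)
qed

text \<open>A Markov property: given code \<open>n\<close> at time \<open>k\<close>, the point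
  reached is distributed as \<open>m\<close> conditioned on \<open>W lam n\<close>, where
  \<open>2 ^ n\<close> is the reciprocal of \<open>prob (W lam n)\<close>. It holds because each
  branch has a constant Jacobian and its image is a union of whole sets
  \<open>W lam n\<close>.\<close>

lemma prob_pre:
  assumes "1 \<le> n" "A \<in> sets m" "A \<subseteq> W lam n"
  shows "prob (pre k A) = 2 ^ n * prob (pre k (W lam n)) * prob A"
  using assms
proof (induction k arbitrary: n A)
  case 0
  then show ?case
    unfolding pre_0[OF W_subset] pre_0[OF order_trans[OF 0(3) W_subset]] prob_W[OF 0(1)]
    by (simp add: power_one_over)
next
  case (Suc k)
  have *: "prob (pre (Suc k) B) =
      (\<Sum>i\<in>{1..Suc n}. 2 ^ i * weight i * prob (pre k (W lam i))) * prob B"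
    if "B \<in> sets m" "B \<subseteq> W lam n" for B
    by (rule prob_pre_Suc_of_prob_pre[OF _ Suc.prems(1) that]) (rule Suc.IH)
  show ?case
    unfolding *[OF Suc.prems(2,3)] *[OF W_in_sets order_refl] prob_W[OF Suc.prems(1)]
    by (simp add: power_one_over)
qed

lemma prob_pre_Suc:
  assumes "1 \<le> n"
  shows "prob (pre (Suc k) (W lam n)) =
    (\<Sum>i\<in>{1..Suc n}. 2 ^ i * weight i * prob (pre k (W lam i))) * (1 / 2) ^ n"
  unfolding prob_W[OF assms, symmetric]
  by (rule prob_pre_Suc_of_prob_pre[OF _ assms W_in_sets order_refl]) (rule prob_pre)

sublocale walk: oscillating_walk "\<lambda>k n. prob (pre k (W lam (Suc n)))"
proof
  fix k n K :: nat
  show "prob (pre 0 (W lam (Suc n))) = (1 / 2) ^ Suc n"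
  proof -
    show ?thesis using prob_W[of "Suc n"] by (simp add: pre_0[OF W_subset])
  qed
  have "{1..Suc (Suc 0)} = {1, 2::nat}" by auto
  then show "prob (pre (Suc k) (W lam (Suc 0))) =
      (prob (pre k (W lam (Suc 0))) + prob (pre k (W lam (Suc 1)))) / 2"
    by (subst prob_pre_Suc) (auto simp: weight_def numeral_2_eq_2)
  show "prob (pre (Suc k) (W lam (Suc (Suc n)))) =
      (prob (pre (Suc k) (W lam (Suc n))) + prob (pre k (W lam (Suc (n + 2))))) / 2"
  proof -
    \<comment> \<open>The mass arriving from codes up to \<open>n + 2\<close>: it halves when the
      target moves from code \<open>n + 1\<close> to \<open>n + 2\<close>, and \<open>n + 3\<close>
      is the only new source.\<close>
    define S where "S = (\<Sum>i\<in>{1..Suc (Suc n)}. 2 ^ i * weight i * prob (pre k (W lam i)))"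
    have "{1..Suc (Suc (Suc n))} = insert (n + 3) {1..Suc (Suc n)}" by auto
    then have "(\<Sum>i\<in>{1..Suc (Suc (Suc n))}. 2 ^ i * weight i * prob (pre k (W lam i))) =
        S + 2 ^ Suc n * prob (pre k (W lam (n + 3)))"
      by (simp add: S_def weight_def power_add)
    then have "prob (pre (Suc k) (W lam (Suc (Suc n)))) =
        (S + 2 ^ Suc n * prob (pre k (W lam (n + 3)))) * (1 / 2) ^ Suc (Suc n)"
      using prob_pre_Suc[of "Suc (Suc n)" k] by simp
    moreover have "prob (pre (Suc k) (W lam (Suc n))) = S * (1 / 2) ^ Suc n"
      using prob_pre_Suc[of "Suc n" k] by (simp add: S_def)
    moreover have "(S + 2 ^ Suc n * P) * (1 / 2) ^ Suc (Suc n) = (S * (1 / 2) ^ Suc n + P) / 2" for P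
      by (simp add: field_simps power_one_over)
    moreover have "n + 3 = Suc (n + 2)" by simp
    ultimately show ?thesis by (simp only:)
  qed
  show "0 \<le> prob (pre k (W lam (Suc n)))" by simp
  have "(\<Sum>n<K. prob (pre k (W lam (Suc n)))) = prob (\<Union>n<K. pre k (W lam (Suc n)))"
    using pre_in_sets W_in_sets in_W_iff
    by (intro finite_measure_finite_Union[symmetric])
       (auto simp: disjoint_family_on_def pre_def)
  then show "(\<Sum>n<K. prob (pre k (W lam (Suc n)))) \<le> 1" by simp
qed

lemma space_eq_UN_W: "{0<..1} = (\<Union>n. W lam (Suc n))"
proof
  show "{0<..1} \<subseteq> (\<Union>n. W lam (Suc n))"
  proof
    fix x :: real assume x: "x \<in> {0<..1}"
    then have "x \<in> W lam (Suc (code lam x - 1))"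
      using in_W_code[OF x] code_pos[OF x] by simp
    then show "x \<in> (\<Union>n. W lam (Suc n))" by blast
  qed
qed (use W_subset in blast)

text \<open>The preimages of a wandering set have summable masses. If the set has positive mass, so
  has its part in some \<open>W lam (Suc n)\<close>, and by \<open>prob_pre\<close> the masses of
  the preimages of that part are a positive multiple of a column of the walk, which is not
  summable.\<close>

lemma conservative: "conservative m (F lam)"
  unfolding conservative_def
proof (intro allI impI, rule ccontr)
  fix V assume V: "wandering m (F lam) V" and "emeasure m V \<noteq> 0"
  then have V_sets: "V \<in> sets m" and disj: "disjoint_family (\<lambda>k. pre k V)"
    by (auto simp: wandering_def space_m pre_def)
  have "\<exists>n. prob (W lam (Suc n) \<inter> V) \<noteq> 0"
  proof (rule ccontr)
    assume "\<not> ?thesis"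
    then have "(\<Union>n. W lam (Suc n) \<inter> V) \<in> null_sets m"
      using W_in_sets V_sets by (intro null_sets_UN) (auto simp: null_sets_def emeasure_eq_measure)
    moreover have "(\<Union>n. W lam (Suc n) \<inter> V) = V"
      using space_eq_UN_W V_sets by (auto simp: sets_m_iff)
    ultimately show False using \<open>emeasure m V \<noteq> 0\<close> by auto
  qed
  then obtain n where "prob (W lam (Suc n) \<inter> V) \<noteq> 0" ..
  then have pos: "0 < prob (W lam (Suc n) \<inter> V)" by (simp add: zero_less_measure_iff)
  define a where "a = 2 ^ Suc n * prob (W lam (Suc n) \<inter> V)"
  have "0 < a" using pos by (simp add: a_def)
  have le: "a * prob (pre k (W lam (Suc n))) \<le> prob (pre k V)" for k
  proof -
    have "a * prob (pre k (W lam (Suc n))) = prob (pre k (W lam (Suc n) \<inter> V))"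
      using prob_pre[of "Suc n" "W lam (Suc n) \<inter> V" k] W_in_sets V_sets by (simp add: a_def)
    also have "\<dots> \<le> prob (pre k V)"
      by (intro finite_measure_mono pre_in_sets V_sets) (auto simp: pre_def)
    finally show ?thesis .
  qed
  have "(\<lambda>k. prob (pre k V)) sums prob (\<Union>k. pre k V)"
    using disj pre_in_sets V_sets by (intro finite_measure_UNION) auto
  then have "summable (\<lambda>k. prob (pre k V))" by (rule sums_summable)
  moreover have "norm (a * prob (pre k (W lam (Suc n)))) \<le> prob (pre k V)" for k
    using le[of k] \<open>0 < a\<close> by (simp only: real_norm_def abs_of_nonneg mult_nonneg_nonneg
        less_imp_le measure_nonneg)
  ultimately have "summable (\<lambda>k. a * prob (pre k (W lam (Suc n))))"
    by (rule summable_comparison_test'[where N = 0])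
  then have "summable (\<lambda>k. prob (pre k (W lam (Suc n))))"
    using \<open>0 < a\<close> by (subst (asm) summable_cmult_iff) auto
  with walk.not_summable show False by blast
qed

text \<open>Invariance keeps the \<open>\<mu>\<close>-mass of all preimages of
  \<open>W lam (Suc n)\<close> constant while their \<open>m\<close>-mass tends to 0. Along times
  with summable \<open>m\<close>-masses the limit superior is \<open>m\<close>-null by
  Borel-Cantelli, hence \<open>\<mu>\<close>-null, although its \<open>\<mu>\<close>-mass is at
  least that of \<open>W lam (Suc n)\<close>.\<close>

lemma no_invariant_density:
  assumes "\<mu> \<in> invariant_probs {0<..1} (F lam)"
  shows "\<not> absolutely_continuous m \<mu>"
proof
  assume ac: "absolutely_continuous m \<mu>"
  interpret \<mu>: prob_space \<mu>
    using assms by (auto simp: invariant_probs_def borel_prob_def)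
  have sets_\<mu>: "sets \<mu> = sets m"
    using assms by (auto simp: invariant_probs_def borel_prob_def sets_m)
  then have space_\<mu>: "space \<mu> = {0<..1}"
    using space_m sets_eq_imp_space_eq by blast
  have F\<mu>: "F lam \<in> \<mu> \<rightarrow>\<^sub>M \<mu>" "distr \<mu> \<mu> (F lam) = \<mu>"
    using assms by (auto simp: invariant_probs_def)
  have inv: "\<mu>.prob (pre k A) = \<mu>.prob A" if "A \<in> sets m" for k A
    using that
  proof (induction k arbitrary: A)
    case 0
    then show ?case by (simp add: pre_def sets_m_iff Int_absorb2)
  next
    case (Suc k)
    have "\<mu>.prob (pre (Suc k) A) = \<mu>.prob (pre k (F lam -` A \<inter> space \<mu>))"
      using Suc(2) by (subst pre_Suc) (auto simp: sets_m_iff space_\<mu>)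
    also have "\<dots> = \<mu>.prob (F lam -` A \<inter> space \<mu>)"
      using measurable_sets[OF F\<mu>(1)] Suc sets_\<mu> by blast
    also have "\<dots> = measure (distr \<mu> \<mu> (F lam)) A"
      using F\<mu>(1) Suc(2) sets_\<mu> by (simp add: measure_distr)
    finally show ?case using F\<mu>(2) by simp
  qed
  have null: "\<mu>.prob (W lam (Suc n)) = 0" for n
  proof -
    have "\<exists>k. prob (pre k (W lam (Suc n))) < (1 / 2) ^ i" for i :: nat
      using order_tendstoD(2)[OF walk.tendsto_zero[of n], of "(1 / 2) ^ i"]
      by (auto dest: eventually_happens)
    then obtain r where r: "\<And>i::nat. prob (pre (r i) (W lam (Suc n))) < (1 / 2) ^ i"
      by metis
    define A where "A i = pre (r i) (W lam (Suc n))" for i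
    have A_sets: "A i \<in> sets m" for i
      by (simp add: A_def pre_in_sets W_in_sets)
    define L where "L = (\<Inter>k. \<Union>i\<in>{k..}. A i)"
    have "limsup A \<in> null_sets m"
    proof (rule borel_cantelli_limsup1)
      show "summable (\<lambda>i. prob (A i))"
        by (rule summable_comparison_test'[of "\<lambda>i. (1 / 2) ^ i" 0])
           (use r in \<open>auto simp: A_def intro: less_imp_le summable_geometric\<close>)
    qed (use A_sets in \<open>auto simp: emeasure_eq_measure\<close>)
    then have "L \<in> null_sets \<mu>"
      using ac by (auto simp: absolutely_continuous_def L_def limsup_INF_SUP)
    then have "\<mu>.prob L = 0" by (simp add: null_setsD1 measure_def)
    moreover have "(\<lambda>k. \<mu>.prob (\<Union>i\<in>{k..}. A i)) \<longlonglongrightarrow> \<mu>.prob L"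
      unfolding L_def using A_sets sets_\<mu>
      by (intro \<mu>.finite_Lim_measure_decseq) (auto simp: decseq_def, meson atLeast_iff order_trans)
    moreover have "\<mu>.prob (W lam (Suc n)) \<le> \<mu>.prob (\<Union>i\<in>{k..}. A i)" for k
    proof -
      have "\<mu>.prob (W lam (Suc n)) = \<mu>.prob (A k)"
        using inv W_in_sets by (simp add: A_def)
      also have "\<dots> \<le> \<mu>.prob (\<Union>i\<in>{k..}. A i)"
        using A_sets sets_\<mu> by (intro \<mu>.finite_measure_mono) auto
      finally show ?thesis .
    qed
    ultimately have "\<mu>.prob (W lam (Suc n)) \<le> 0"
      by (intro LIMSEQ_le_const[of "\<lambda>k. \<mu>.prob (\<Union>i\<in>{k..}. A i)"]) auto
    then show ?thesis using measure_nonneg[of \<mu>] by (simp add: order_antisym)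
  qed
  then have "(\<Union>n. W lam (Suc n)) \<in> null_sets \<mu>"
    using W_in_sets sets_\<mu> by (intro null_sets_UN) (auto simp: null_sets_def \<mu>.emeasure_eq_measure)
  then have "emeasure \<mu> (space \<mu>) = 0"
    using space_eq_UN_W space_\<mu> by auto
  then show False using \<mu>.emeasure_space_1 by simp
qed

end

section \<open>Approximation of finite partitions\<close>

lemma finite_compact_family_separated:
  fixes K :: "'i \<Rightarrow> 'a::heine_borel set"
  assumes "finite I" "\<And>i. i \<in> I \<Longrightarrow> compact (K i)"
    and disj: "\<And>i j. i \<in> I \<Longrightarrow> j \<in> I \<Longrightarrow> i \<noteq> j \<Longrightarrow> K i \<inter> K j = {}"
  obtains \<eta> where "0 < \<eta>"
    "\<And>i j x y. i \<in> I \<Longrightarrow> j \<in> I \<Longrightarrow> i \<noteq> j \<Longrightarrow> x \<in> K i \<Longrightarrow> y \<in> K j \<Longrightarrow> \<eta> \<le> dist x y"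
proof -
  have "\<exists>d>0. i \<in> I \<and> j \<in> I \<and> i \<noteq> j \<longrightarrow> (\<forall>x\<in>K i. \<forall>y\<in>K j. d \<le> dist x y)" for i j
  proof (cases "i \<in> I \<and> j \<in> I \<and> i \<noteq> j")
    case True
    then show ?thesis
      using separate_compact_closed[of "K i" "K j"] assms(2) disj compact_imp_closed by metis
  qed (auto intro: exI[of _ 1])
  then obtain d where d: "\<And>i j. 0 < d i j"
    "\<And>i j. i \<in> I \<and> j \<in> I \<and> i \<noteq> j \<longrightarrow> (\<forall>x\<in>K i. \<forall>y\<in>K j. d i j \<le> dist x y)"
    by metis
  \<comment> \<open>The inserted 1 keeps \<open>Min\<close> meaningful for empty \<open>I\<close>;
    diagonal pairs may take part because every \<open>d i j\<close> is positive.\<close>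
  define \<eta> where "\<eta> = Min (insert 1 ((\<lambda>(i, j). d i j) ` (I \<times> I)))"
  have fin: "finite (insert 1 ((\<lambda>(i, j). d i j) ` (I \<times> I)))" using assms(1) by simp
  show ?thesis
  proof
    show "0 < \<eta>" unfolding \<eta>_def using fin d(1) by (subst Min_gr_iff) auto
    fix i j x y assume ij: "i \<in> I" "j \<in> I" "i \<noteq> j" "x \<in> K i" "y \<in> K j"
    have "\<eta> \<le> d i j" unfolding \<eta>_def using fin ij by (intro Min_le) force+
    also have "d i j \<le> dist x y" using d(2) ij by blast
    finally show "\<eta> \<le> dist x y" .
  qed
qed

text \<open>Inner regularity is applied to the image of \<open>\<mu>\<close> on the whole Polish
  space, which agrees with \<open>\<mu>\<close> on Borel subsets of \<open>X\<close>.\<close>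

lemma inner_regular_restrict:
  fixes X :: "'a::polish_space set"
  assumes "borel_prob X \<mu>" and X: "X \<in> sets borel" and A: "A \<in> sets \<mu>" and "0 < e"
  obtains K where "K \<subseteq> A" "compact K" "measure \<mu> (A - K) \<le> e"
proof -
  interpret prob_space \<mu> using assms(1) by (simp add: borel_prob_def)
  have sets: "sets \<mu> = sets (restrict_space borel X)"
    using assms(1) by (simp add: borel_prob_def)
  have sets_iff: "B \<in> sets \<mu> \<longleftrightarrow> B \<in> sets borel \<and> B \<subseteq> X" for B
    using X by (subst sets, subst sets_restrict_space_iff) auto
  have space: "space \<mu> = X"
    using sets_eq_imp_space_eq[OF sets] by (simp add: space_restrict_space)
  have id: "(\<lambda>x. x) \<in> \<mu> \<rightarrow>\<^sub>M borel"
    using measurable_cong_sets[OF sets refl] measurable_restrict_space1[OF measurable_ident[of borel]]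
    by (auto simp: id_def)
  define \<nu> where "\<nu> = distr \<mu> borel (\<lambda>x. x)"
  interpret \<nu>: prob_space \<nu> unfolding \<nu>_def by (rule prob_space_distr[OF id])
  have eq: "emeasure \<nu> B = emeasure \<mu> B" if "B \<in> sets \<mu>" for B
    using that emeasure_distr[OF id, of B] sets_iff[of B] space by (simp add: \<nu>_def Int_absorb2)
  have reg: "emeasure \<nu> A = (SUP K\<in>{K. K \<subseteq> A \<and> compact K}. emeasure \<nu> K)"
    using A sets_iff by (intro inner_regular) (auto simp: \<nu>_def \<nu>.emeasure_eq_measure[unfolded \<nu>_def])
  show ?thesis
  proof (cases "prob A \<le> e")
    case True
    then show ?thesis using that[of "{}"] by simp
  next
    case False
    then have "ennreal (prob A - e) < emeasure \<nu> A"
      using \<open>0 < e\<close> eq[OF A] by (simp add: emeasure_eq_measure ennreal_less_iff)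
    then obtain K where K: "K \<subseteq> A" "compact K" "ennreal (prob A - e) < emeasure \<nu> K"
      unfolding reg less_SUP_iff by auto
    have K_sets: "K \<in> sets \<mu>"
      using K A compact_imp_closed[OF K(2)] sets_iff by auto
    have "prob A - e < prob K"
      using K(3) eq[OF K_sets] False by (simp add: emeasure_eq_measure ennreal_less_iff)
    then have "prob (A - K) \<le> e"
      using finite_measure_Diff[OF A K_sets K(1)] by simp
    with K show ?thesis using that by blast
  qed
qed

text \<open>The kernel \<open>r\<close> puts almost all its mass on a cell near a large compact subset of it; \<open>\<kappa>\<close> is the
  logarithmic loss of guessing the cell of \<open>x\<close> by \<open>r\<close> evaluated at a nearby point.\<close>

lemma partition_kernel:
  fixes X :: "'a::{polish_space, heine_borel} set"
  assumes \<mu>: "borel_prob X \<mu>" and X: "X \<in> sets borel" and P: "P \<in> finite_partitions \<mu>" and e: "0 < e"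
  obtains r :: "'a set \<Rightarrow> 'a \<Rightarrow> real" and \<kappa> :: "'a \<Rightarrow> real" and \<eta> :: real
  where "\<And>A. r A \<in> borel_measurable borel" "\<And>A y. 0 < r A y" "\<And>A y. r A y \<le> 1"
    "\<And>y. (\<Sum>A\<in>P. r A y) \<le> 1" "integrable \<mu> \<kappa>" "(\<integral>x. \<kappa> x \<partial>\<mu>) \<le> e" "0 < \<eta>"
    "\<And>x y. x \<in> X \<Longrightarrow> dist x y < \<eta> \<Longrightarrow> exp (- \<kappa> x) \<le> r (cell P x) y"
proof -
  interpret prob_space \<mu> using \<mu> by (simp add: borel_prob_def)
  have sets: "sets \<mu> = sets (restrict_space borel X)"
    using \<mu> by (simp add: borel_prob_def)
  have space: "space \<mu> = X"
    using sets_eq_imp_space_eq[OF sets] by (simp add: space_restrict_space)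
  have P_fin: "finite P" and P_part: "partition_on X P" and P_sets: "P \<subseteq> sets \<mu>"
    using P by (auto simp: finite_partitions_def space)
  have "P \<noteq> {}" using P_part not_empty space by (auto simp: partition_on_def)
  define k where "k = real (card P)"
  have k: "1 \<le> k" using \<open>P \<noteq> {}\<close> P_fin by (simp add: k_def Suc_le_eq card_gt_0_iff)
  \<comment> \<open>The budget \<open>e\<close> is halved: on the compact sets the loss
    \<open>- ln (1 - \<delta>)\<close> is at most \<open>e / 2\<close>; off them it is
    \<open>c\<close>, and \<open>\<epsilon>\<close> below is chosen so that this part has mean at
    most \<open>e / 2\<close>.\<close>
  define \<delta> where "\<delta> = min (1 / 2) (1 - exp (- (e / 2)))"
  have \<delta>: "0 < \<delta>" "\<delta> \<le> 1 / 2" "exp (- (e / 2)) \<le> 1 - \<delta>"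
    using e min.cobounded1[of "1 / 2" "1 - exp (- (e / 2))"] min.cobounded2[of "1 / 2" "1 - exp (- (e / 2))"]
    by (simp_all add: \<delta>_def)
  have \<delta>k: "0 < \<delta> / k" "\<delta> / k \<le> \<delta>" using \<delta> k by (auto simp: field_simps)
  define c where "c = - ln (\<delta> / k)"
  have c: "0 \<le> c" using \<delta>k \<delta> by (simp add: c_def)
  define \<epsilon> where "\<epsilon> = e / 2 / (k * (c + 1))"
  have \<epsilon>: "0 < \<epsilon>" using e k c by (simp add: \<epsilon>_def)
  have "\<exists>K. K \<subseteq> A \<and> compact K \<and> prob (A - K) \<le> \<epsilon>" if "A \<in> P" for A
    using inner_regular_restrict[OF \<mu> X _ \<epsilon>, of A] P_sets that by (metis subsetD)
  then obtain K where K: "\<And>A. A \<in> P \<Longrightarrow> K A \<subseteq> A" "\<And>A. A \<in> P \<Longrightarrow> compact (K A)"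
    "\<And>A. A \<in> P \<Longrightarrow> prob (A - K A) \<le> \<epsilon>" by metis
  have K_disj: "K A \<inter> K B = {}" if "A \<in> P" "B \<in> P" "A \<noteq> B" for A B
  proof -
    have "A \<inter> B = {}" using partition_onD2[OF P_part] that by (auto simp: disjoint_def)
    then show ?thesis using K(1)[OF that(1)] K(1)[OF that(2)] by blast
  qed
  obtain \<eta> where \<eta>: "0 < \<eta>"
    "\<And>A B x y. A \<in> P \<Longrightarrow> B \<in> P \<Longrightarrow> A \<noteq> B \<Longrightarrow> x \<in> K A \<Longrightarrow> y \<in> K B \<Longrightarrow> \<eta> \<le> dist x y"
    using finite_compact_family_separated[of P K, OF P_fin K(2) K_disj] by metis
  \<comment> \<open>Radius half the separation makes these neighbourhoods disjoint, so at each point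
    at most one cell gets the large value \<open>1 - \<delta>\<close> and the values still sum to at
    most 1.\<close>
  define U where "U A = (\<Union>x\<in>K A. ball x (\<eta> / 2))" for A
  have U_disj: "A = B" if AB: "A \<in> P" "B \<in> P" "y \<in> U A" "y \<in> U B" for A B y
  proof (rule ccontr)
    assume "A \<noteq> B"
    obtain x z where "x \<in> K A" "dist x y < \<eta> / 2" "z \<in> K B" "dist z y < \<eta> / 2"
      using AB(3,4) unfolding U_def UN_iff mem_ball by blast
    then show False
      using \<eta>(2)[OF AB(1,2) \<open>A \<noteq> B\<close>, of x z] dist_triangle2[of x z y] by simp
  qed
  define r where "r A y = (if y \<in> U A then 1 - \<delta> else \<delta> / k)" for A y
  define KK where "KK = (\<Union>A\<in>P. K A)"
  define \<kappa> where "\<kappa> x = (if x \<in> KK then - ln (1 - \<delta>) else c)" for x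
  have K_sets: "K A \<in> sets \<mu>" if "A \<in> P" for A
  proof -
    have "A \<subseteq> X" using P_part that by (auto simp: partition_on_def)
    then show ?thesis
      using K(1,2)[OF that] X compact_imp_closed[of "K A"]
      by (subst sets, subst sets_restrict_space_iff) auto
  qed
  have KK_sets: "KK \<in> sets \<mu>"
    unfolding KK_def using P_fin K_sets by (intro sets.finite_UN) auto
  have \<kappa>_eq: "\<kappa> x = - ln (1 - \<delta>) * indicator KK x + c * indicator (X - KK) x" if "x \<in> X" for x
    using that by (simp add: \<kappa>_def indicator_def)
  have int: "integrable \<mu> (\<lambda>x. - ln (1 - \<delta>) * indicator KK x + c * indicator (X - KK) x)"
    using KK_sets sets.top[of \<mu>] space
    by (intro Bochner_Integration.integrable_add integrable_mult_right)
       (auto simp: emeasure_eq_measure intro!: integrable_real_indicator)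
  have small: "prob (X - KK) \<le> k * \<epsilon>"
  proof -
    have "X - KK \<subseteq> (\<Union>A\<in>P. A - K A)"
      using P_part by (auto simp: KK_def partition_on_def)
    moreover have AK: "A - K A \<in> sets \<mu>" if "A \<in> P" for A
      using that P_sets K_sets by blast
    ultimately have "prob (X - KK) \<le> prob (\<Union>A\<in>P. A - K A)"
      using P_fin by (intro finite_measure_mono sets.finite_UN) auto
    also have "\<dots> \<le> (\<Sum>A\<in>P. prob (A - K A))"
      using P_fin AK by (intro finite_measure_subadditive_finite) auto
    also have "\<dots> \<le> (\<Sum>A\<in>P. \<epsilon>)" using K(3) by (intro sum_mono)
    finally show ?thesis by (simp add: k_def)
  qed
  show ?thesis
  proof (rule that[of r \<kappa> "\<eta> / 2"])
    show "0 < \<eta> / 2" using \<eta>(1) by simp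
    show "r A \<in> borel_measurable borel" for A
    proof -
      have [measurable]: "U A \<in> sets borel"
        unfolding U_def by (intro borel_open open_UN ballI open_ball)
      show ?thesis unfolding r_def by measurable
    qed
    show "0 < r A y" "r A y \<le> 1" for A y using \<delta> \<delta>k by (auto simp: r_def)
    show "(\<Sum>A\<in>P. r A y) \<le> 1" for y
    proof (cases "\<exists>A\<in>P. y \<in> U A")
      case True
      then obtain A where A: "A \<in> P" "y \<in> U A" by blast
      have "(\<Sum>B\<in>P. r B y) = r A y + (\<Sum>B\<in>P - {A}. r B y)"
        using P_fin A(1) by (simp add: sum.remove)
      also have "(\<Sum>B\<in>P - {A}. r B y) = (\<Sum>B\<in>P - {A}. \<delta> / k)"
        using U_disj A by (intro sum.cong) (auto simp: r_def)
      also have "\<dots> = (k - 1) * (\<delta> / k)"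
        using P_fin A(1) k by (simp add: k_def of_nat_diff)
      also have "r A y + (k - 1) * (\<delta> / k) = 1 - \<delta> / k"
        using A k by (simp add: r_def field_simps)
      finally show ?thesis using \<delta>k by simp
    next
      case False
      then have "(\<Sum>A\<in>P. r A y) = (\<Sum>A\<in>P. \<delta> / k)" by (intro sum.cong) (auto simp: r_def)
      also have "\<dots> = \<delta>" using k by (simp add: k_def)
      finally show ?thesis using \<delta> by simp
    qed
    show "integrable \<mu> \<kappa>"
      using int by (subst Bochner_Integration.integrable_cong[OF refl \<kappa>_eq]) (simp_all add: space)
    have "(\<integral>x. \<kappa> x \<partial>\<mu>) = (\<integral>x. - ln (1 - \<delta>) * indicator KK x + c * indicator (X - KK) x \<partial>\<mu>)"
      by (rule Bochner_Integration.integral_cong[OF refl \<kappa>_eq]) (simp add: space)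
    also have "\<dots> = - ln (1 - \<delta>) * prob KK + c * prob (X - KK)"
      using KK_sets sets.top[of \<mu>] space
      by (subst Bochner_Integration.integral_add)
         (auto simp: emeasure_eq_measure intro!: integrable_mult_right integrable_real_indicator)
    also have "\<dots> \<le> e / 2 * 1 + c * (k * \<epsilon>)"
    proof (rule add_mono[OF mult_mono mult_left_mono])
      have "- (e / 2) \<le> ln (1 - \<delta>)" using \<delta> by (subst ln_ge_iff) auto
      then show "- ln (1 - \<delta>) \<le> e / 2" by simp
    qed (use small c e in auto)
    also have "c * (k * \<epsilon>) = e / 2 * (c / (c + 1))"
      using k c by (simp add: \<epsilon>_def)
    also have "e / 2 * (c / (c + 1)) \<le> e / 2 * 1"
      using e c by (intro mult_left_mono) (auto simp: field_simps)
    finally show "(\<integral>x. \<kappa> x \<partial>\<mu>) \<le> e" by simp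
    show "exp (- \<kappa> x) \<le> r (cell P x) y" if x: "x \<in> X" and y: "dist x y < \<eta> / 2" for x y
    proof (cases "x \<in> KK")
      case True
      then obtain A where A: "A \<in> P" "x \<in> K A" by (auto simp: KK_def)
      then have "cell P x = A" using cell_eq[OF P_part A(1)] K(1) by blast
      moreover have "y \<in> U A" using A(2) y by (auto simp: U_def)
      ultimately show ?thesis using True \<delta> by (simp add: r_def \<kappa>_def)
    next
      case False
      then have "exp (- \<kappa> x) = \<delta> / k" using \<delta>k by (simp add: \<kappa>_def c_def)
      then show ?thesis using \<delta> \<delta>k by (simp add: r_def)
    qed
  qed
qed

section \<open>Conformal measures\<close>

context contraction
begin

text \<open>The sets in the branch identity are built from \<open>E\<close> by means of codes and
  the map alone, and \<open>theta\<close> respects both; the identity is therefore pulled back to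
  \<open>measure_half_branch\<close>.\<close>

lemma fair_conformal_exists: "\<exists>m. fair_conformal lam m"
proof -
  interpret L: prob_space unit_lebesgue by (rule prob_space_unit_lebesgue)
  interpret coded_system lam unit_lebesgue "F (1 / 2)" "code (1 / 2)"
  proof
    show "F (1 / 2) \<in> unit_lebesgue \<rightarrow>\<^sub>M unit_lebesgue"
      using half.F_measurable measurable_cong_sets[OF sets_unit_lebesgue sets_unit_lebesgue] by blast
    show "code (1 / 2) \<in> unit_lebesgue \<rightarrow>\<^sub>M count_space UNIV"
      using half.code_measurable measurable_cong_sets[OF sets_unit_lebesgue refl] by blast
  qed (simp_all only: space_unit_lebesgue half.code_pos half.code_F)
  define m where "m = pushed unit_lebesgue"
  have prob: "prob_space m"
    unfolding m_def by (rule prob_space_pushed[OF refl prob_space_unit_lebesgue])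
  have sets: "sets m = sets (restrict_space borel {0<..1})"
    by (simp add: m_def sets_pushed)
  have meas: "measure m A = measure unit_lebesgue (theta -` A \<inter> {0<..1})"
    if "A \<in> sets borel" "A \<subseteq> {0<..1}" for A
    unfolding m_def using that sets_unit_iff measure_pushed[OF refl, of A] by (simp add: space_unit_lebesgue)
  have "fair_conformal lam m"
  proof (rule fair_conformal.intro)
    show "contraction lam" by unfold_locales
    show "fair_conformal_axioms lam m"
    proof
      fix n :: nat and E assume n: "1 \<le> n" and "E \<in> sets m"
      then have E: "E \<in> sets borel" "E \<subseteq> {0<..1}" by (auto simp: sets sets_unit_iff)
      have "F lam -` E \<inter> {0<..1} \<in> sets (restrict_space borel {0<..1})"
        using measurable_sets[OF F_measurable, of E] E sets_unit_iff by (simp add: space_restrict_space)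
      then have "W lam n \<inter> (F lam -` E \<inter> {0<..1}) \<in> sets borel"
        by (auto simp: sets_unit_iff)
      moreover have "W lam n \<inter> (F lam -` E \<inter> {0<..1}) = W lam n \<inter> F lam -` E"
        using W_subset by blast
      ultimately have "measure m (W lam n \<inter> F lam -` E) =
          measure unit_lebesgue (theta -` (W lam n \<inter> F lam -` E) \<inter> {0<..1})"
        using W_subset by (intro meas) auto
      also have "theta -` (W lam n \<inter> F lam -` E) \<inter> {0<..1} =
          W (1 / 2) n \<inter> F (1 / 2) -` (theta -` E \<inter> {0<..1})"
        unfolding in_W_iff[OF n] half.in_W_iff[OF n] half.W_eq[OF n] W_eq[OF n]
        using theta_in code_theta F_theta half.F_closed unfolding space_unit_lebesgue
        by (auto simp del: greaterThanAtMost_iff)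
      also have "measure unit_lebesgue \<dots> =
          weight n * measure unit_lebesgue (theta -` E \<inter> {0<..1} \<inter> {0<..(1 / 2) ^ (n - 2)})"
      proof (rule measure_half_branch[OF n])
        show "theta -` E \<inter> {0<..1} \<in> sets unit_lebesgue"
          using measurable_sets[OF theta_meas, of E] E sets_unit_iff by (simp add: space_unit_lebesgue)
      qed
      also have "theta -` E \<inter> {0<..1} \<inter> {0<..(1 / 2) ^ (n - 2)} = theta -` (E \<inter> {0<..lam ^ (n - 2)}) \<inter> {0<..1}"
      proof -
        have "x \<le> (1 / 2) ^ (n - 2) \<longleftrightarrow> theta x \<le> lam ^ (n - 2)" if "x \<in> {0<..1}" for x
          using half.le_code_iff[OF that, of n] le_code_iff[OF theta_in, of x n] code_theta[of x] that
          by (simp only: space_unit_lebesgue)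
        then show ?thesis using theta_in by (auto simp: space_unit_lebesgue)
      qed
      also have "measure unit_lebesgue \<dots> = measure m (E \<inter> {0<..lam ^ (n - 2)})"
        using E by (intro meas[symmetric]) auto
      finally show "measure m (W lam n \<inter> F lam -` E) = weight n * measure m (E \<inter> {0<..lam ^ (n - 2)})" .
    qed (rule sets)
  qed (rule prob)
  then show ?thesis ..
qed

lemma nn_integral_branch:
  assumes t: "lam powr t = 1 / 2" and n: "1 \<le> n"
    and sets: "sets m = sets (restrict_space borel {0<..1})" and A: "A \<in> sets m" "A \<subseteq> W lam n"
  shows "(\<integral>\<^sup>+x\<in>A. ennreal (exp (ln 2 + t * ln (1 - lam) - Phi lam t x)) \<partial>m) =
    ennreal (1 / weight n) * emeasure m A"
proof -
  have "(\<integral>\<^sup>+x\<in>A. ennreal (exp (ln 2 + t * ln (1 - lam) - Phi lam t x)) \<partial>m) =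
      (\<integral>\<^sup>+x. ennreal (1 / weight n) * indicator A x \<partial>m)"
    using A(2) exp_minus_Phi(1)[OF t n] by (intro nn_integral_cong) (auto simp: indicator_def)
  then show ?thesis using A(1) by (simp add: nn_integral_cmult_indicator)
qed

lemma weight_pos: "0 < weight n"
  by (simp add: weight_def)

lemma conformal_imp_fair:
  assumes t: "lam powr t = 1 / 2"
    and m: "conformal {0<..1} (F lam) (Phi lam t) (ln 2 + t * ln (1 - lam)) m"
  shows "fair_conformal lam m"
proof -
  have bp: "borel_prob {0<..1} m" using m by (simp add: conformal_def)
  interpret prob_space m using bp by (simp add: borel_prob_def)
  have sets: "sets m = sets (restrict_space borel {0<..1})" using bp by (simp add: borel_prob_def)
  have space: "space m = {0<..1}"
    using sets_eq_imp_space_eq[OF sets] by (simp add: space_restrict_space)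
  have F: "F lam \<in> m \<rightarrow>\<^sub>M m" using F_measurable measurable_cong_sets[OF sets sets] by blast
  show ?thesis
  proof
    show "sets m = sets (restrict_space borel {0<..1})" by (rule sets)
    fix n :: nat and E assume n: "1 \<le> n" and E: "E \<in> sets m"
    define A where "A = W lam n \<inter> F lam -` E"
    have "A = W lam n \<inter> (F lam -` E \<inter> space m)" using W_subset by (auto simp: A_def space)
    moreover have "W lam n \<in> sets m" using W_subset by (simp add: sets sets_unit_iff)
    ultimately have A: "A \<in> sets m" "A \<subseteq> W lam n"
      using measurable_sets[OF F E] by (auto simp: A_def)
    then have "inj_on (F lam) A" using F_inj_on_W[OF n] inj_on_subset by blast
    then have "emeasure m (F lam ` A) = ennreal (1 / weight n) * emeasure m A"
      using m A nn_integral_branch[OF t n sets A] by (simp add: conformal_def)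
    moreover have "F lam ` A = E \<inter> {0<..lam ^ (n - 2)}"
      unfolding A_def using E sets_unit_iff sets by (intro F_image_W[OF n]) auto
    ultimately have "prob (E \<inter> {0<..lam ^ (n - 2)}) = 1 / weight n * prob A"
      by (simp add: measure_def enn2real_mult weight_def)
    then show "prob (W lam n \<inter> F lam -` E) = weight n * prob (E \<inter> {0<..lam ^ (n - 2)})"
      using weight_pos[of n] by (simp add: A_def)
  qed
qed

end

context fair_conformal
begin

text \<open>A set on which \<open>F lam\<close> is injective is cut along the branch domains;
  injectivity makes the images of the pieces disjoint, so countable additivity applies on both
  sides.\<close>

lemma conformal:
  assumes t: "lam powr t = 1 / 2"
  shows "conformal {0<..1} (F lam) (Phi lam t) (ln 2 + t * ln (1 - lam)) m"
  unfolding conformal_def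
proof (intro conjI ballI impI)
  show "borel_prob {0<..1} m" by (simp add: borel_prob_def prob_space_axioms sets_m)
  fix A assume A: "A \<in> sets m" and inj: "inj_on (F lam) A"
  define B where "B n = W lam (Suc n) \<inter> A" for n
  have B_sets: "B n \<in> sets m" for n using W_in_sets A by (simp add: B_def)
  have B_disj: "disjoint_family B"
    unfolding disjoint_family_on_def B_def using in_W_iff by auto
  have A_eq: "A = (\<Union>n. B n)"
    using space_eq_UN_W A unfolding B_def sets_m_iff by blast
  \<comment> \<open>Direct images of Borel sets need care; here the image is the preimage of
    \<open>B n\<close> under the affine inverse branch, cut to the range of the branch.\<close>
  have FB_sets: "F lam ` B n \<in> sets m" for n
  proof -
    have "F lam ` B n = {y \<in> {0<..1}. y \<le> lam ^ (Suc n - 2) \<and>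
        lam ^ Suc n + width lam (Suc n) * y \<in> B n}"
    proof (intro set_eqI iffI)
      fix y assume "y \<in> F lam ` B n"
      then obtain x where x: "x \<in> B n" "y = F lam x" by blast
      then have "x \<in> {0<..1}" "code lam x = Suc n" using in_W_iff by (auto simp: B_def)
      then show "y \<in> {y \<in> {0<..1}. y \<le> lam ^ (Suc n - 2) \<and>
          lam ^ Suc n + width lam (Suc n) * y \<in> B n}"
        using x F_range[of x] F_closed[of x] F_eq[of x] width_pos[of "Suc n"] by auto
    next
      fix y assume "y \<in> {y \<in> {0<..1}. y \<le> lam ^ (Suc n - 2) \<and>
          lam ^ Suc n + width lam (Suc n) * y \<in> B n}"
      then have y: "lam ^ Suc n + width lam (Suc n) * y \<in> B n" by simp
      then have "lam ^ Suc n + width lam (Suc n) * y \<in> {0<..1}"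
        "code lam (lam ^ Suc n + width lam (Suc n) * y) = Suc n"
        using in_W_iff[of "Suc n"] by (simp_all add: B_def del: greaterThanAtMost_iff power_Suc)
      then have "F lam (lam ^ Suc n + width lam (Suc n) * y) = y"
        using F_eq width_pos[of "Suc n"] by simp
      with y show "y \<in> F lam ` B n" by (metis imageI)
    qed
    moreover have "{y \<in> {0<..1}. y \<le> lam ^ (Suc n - 2) \<and>
        lam ^ Suc n + width lam (Suc n) * y \<in> B n} =
        {0<..1} \<inter> {..lam ^ (Suc n - 2)} \<inter>
        ((\<lambda>y. lam ^ Suc n + width lam (Suc n) * y) -` B n \<inter> space borel)" by auto
    moreover have "(\<lambda>y. lam ^ Suc n + width lam (Suc n) * y) -` B n \<inter> space borel \<in> sets borel"
      using B_sets[of n] by (intro measurable_sets[of _ borel borel]) (auto simp: sets_m_iff)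
    ultimately show ?thesis by (auto simp: sets_m_iff)
  qed
  have FB_disj: "disjoint_family (\<lambda>n. F lam ` B n)"
    unfolding disjoint_family_on_def
  proof (intro ballI impI)
    fix i j :: nat assume "i \<noteq> j"
    then have "B i \<inter> B j = {}" using B_disj by (simp add: disjoint_family_on_def)
    moreover have "B i \<subseteq> A" "B j \<subseteq> A" by (auto simp: B_def)
    ultimately show "F lam ` B i \<inter> F lam ` B j = {}"
      using inj_on_image_Int[OF inj, of "B i" "B j"] by simp
  qed
  have branch: "emeasure m (F lam ` B n) = ennreal (1 / weight (Suc n)) * emeasure m (B n)" for n
  proof -
    have "W lam (Suc n) \<inter> F lam -` (F lam ` B n) = B n"
    proof
      show "W lam (Suc n) \<inter> F lam -` (F lam ` B n) \<subseteq> B n"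
      proof
        fix x assume x: "x \<in> W lam (Suc n) \<inter> F lam -` (F lam ` B n)"
        then obtain z where z: "z \<in> B n" "F lam x = F lam z" by blast
        then have "x = z"
          using x inj_onD[OF F_inj_on_W[of "Suc n"]] by (simp add: B_def)
        with z show "x \<in> B n" by simp
      qed
    qed (auto simp: B_def)
    moreover have "F lam ` B n \<inter> {0<..lam ^ (Suc n - 2)} = F lam ` B n"
    proof -
      have "F lam x \<in> {0<..lam ^ (Suc n - 2)}" if "x \<in> B n" for x
      proof -
        have "x \<in> {0<..1}" "code lam x = Suc n"
          using that in_W_iff[of "Suc n"] by (simp_all add: B_def)
        then show ?thesis using F_range[of x] by simp
      qed
      then show ?thesis by blast
    qed
    ultimately have "prob (B n) = weight (Suc n) * prob (F lam ` B n)"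
      using measure_branch[of "Suc n", OF _ FB_sets[of n]] by simp
    then show ?thesis
      using weight_pos[of "Suc n"] by (simp add: emeasure_eq_measure flip: ennreal_mult)
  qed
  define f where "f x = ennreal (1 / weight (code lam x))" for x
  have f: "f \<in> borel_measurable m"
    unfolding f_def measurable_cong_sets[OF sets_m refl]
    by (rule measurable_compose[OF code_measurable]) simp
  have f_eq: "ennreal (exp (ln 2 + t * ln (1 - lam) - Phi lam t x)) = f x" if "x \<in> space m" for x
    unfolding f_def using that exp_minus_Phi(1)[OF t code_pos in_W_code, of x] by (simp add: space_m)
  have "(\<integral>\<^sup>+x\<in>A. ennreal (exp (ln 2 + t * ln (1 - lam) - Phi lam t x)) \<partial>m) = (\<integral>\<^sup>+x\<in>(\<Union>n. B n). f x \<partial>m)"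
    unfolding A_eq using f_eq by (intro nn_integral_cong) simp
  also have "\<dots> = (\<Sum>n. (\<integral>\<^sup>+x\<in>B n. f x \<partial>m))"
    by (rule nn_integral_disjoint_family[OF f B_sets B_disj])
  also have "\<dots> = (\<Sum>n. emeasure m (F lam ` B n))"
  proof (rule suminf_cong)
    fix n
    have "(\<integral>\<^sup>+x\<in>B n. f x \<partial>m) = (\<integral>\<^sup>+x. ennreal (1 / weight (Suc n)) * indicator (B n) x \<partial>m)"
      using in_W_iff[of "Suc n"] by (intro nn_integral_cong) (auto simp: f_def B_def indicator_def)
    then show "(\<integral>\<^sup>+x\<in>B n. f x \<partial>m) = emeasure m (F lam ` B n)"
      using B_sets by (simp add: branch nn_integral_cmult_indicator)
  qed
  also have "\<dots> = emeasure m (\<Union>n. F lam ` B n)"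
    using FB_sets FB_disj by (intro suminf_emeasure) auto
  also have "(\<Union>n. F lam ` B n) = F lam ` A" unfolding A_eq by blast
  finally show "emeasure m (F lam ` A) =
      (\<integral>\<^sup>+x\<in>A. ennreal (exp (ln 2 + t * ln (1 - lam) - Phi lam t x)) \<partial>m)" ..
qed

end

section \<open>Upper bound for the pressure\<close>

definition lump :: "nat \<Rightarrow> real \<Rightarrow> real \<Rightarrow> nat"
  where "lump N lam x = min (code lam x) (Suc N)"

context contraction
begin

text \<open>All codes above \<open>N\<close> are merged, so that words of bounded length have mass bounded below; this
  still localises points because the merged cell \<open>{0<..lam ^ N}\<close> is itself short.\<close>

lemma lump_close:
  assumes "x \<in> {0<..1}" "y \<in> {0<..1}"
    and "\<And>i. i < l \<Longrightarrow> lump N lam ((F lam ^^ i) x) = lump N lam ((F lam ^^ i) y)"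
  shows "\<bar>x - y\<bar> \<le> max ((1 - lam) ^ l) (lam ^ N)"
  using assms
proof (induction l arbitrary: x y)
  case 0
  then show ?case by auto
next
  case (Suc l)
  have eq: "lump N lam x = lump N lam y" using Suc.prems(3)[of 0] by simp
  show ?case
  proof (cases "code lam x \<le> N")
    case True
    then have code: "code lam x = code lam y" using eq by (auto simp: lump_def)
    have "\<bar>F lam x - F lam y\<bar> \<le> max ((1 - lam) ^ l) (lam ^ N)"
    proof (rule Suc.IH)
      fix i assume "i < l"
      then show "lump N lam ((F lam ^^ i) (F lam x)) = lump N lam ((F lam ^^ i) (F lam y))"
        using Suc.prems(3)[of "Suc i"] by (simp add: funpow_swap1)
    qed (use Suc.prems(1,2) F_closed in blast)+
    then have "\<bar>x - y\<bar> \<le> (1 - lam) * max ((1 - lam) ^ l) (lam ^ N)"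
      unfolding F_diff[OF Suc.prems(1,2) code] abs_mult
      using width_pos[of "code lam x"] width_le[of "code lam x"] lam_less_1
      by (intro mult_mono) auto
    also have "\<dots> \<le> max ((1 - lam) ^ Suc l) (lam ^ N)"
    proof (cases "lam ^ N \<le> (1 - lam) ^ l")
      case False
      have "(1 - lam) * lam ^ N \<le> 1 * lam ^ N"
        using lam_pos by (intro mult_right_mono) auto
      with False show ?thesis by (simp add: max_def)
    qed (simp add: max_def)
    finally show ?thesis .
  next
    case False
    then have "N < code lam x" "N < code lam y" using eq by (auto simp: lump_def min_def split: if_splits)
    then have "x \<le> lam ^ N" "y \<le> lam ^ N" using less_code_iff Suc.prems by auto
    then show ?thesis using Suc.prems by auto
  qed
qed

text \<open>Puts the information per step in the form whose mean is the entropy bound; the indicator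
  later cancels against the one in the integral of the potential.\<close>

lemma neg_ln_weight_code:
  assumes "x \<in> {0<..1}"
  shows "- ln (weight (code lam x)) = ln 2 * (1 + indicator {0<..lam} x)"
proof -
  have "code lam x = 1 \<longleftrightarrow> \<not> x \<le> lam"
    using less_code_iff[of x 1] code_pos[OF assms] assms by auto
  moreover have "ln (4::real) = 2 * ln 2" using ln_realpow[of 2 2] by simp
  ultimately show ?thesis using assms by (auto simp: weight_def ln_div indicator_def)
qed

end

context fair_conformal
begin

definition block :: "nat \<Rightarrow> nat \<Rightarrow> real \<Rightarrow> real set"
  where "block N n x =
    {y \<in> {0<..1}. \<forall>i<n. lump N lam ((F lam ^^ i) y) = lump N lam ((F lam ^^ i) x)}"

lemma block_sets: "block N n x \<in> sets m"
proof -
  have "(\<lambda>y. lump N lam ((F lam ^^ i) y)) \<in> m \<rightarrow>\<^sub>M count_space UNIV" for i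
  proof -
    have "code lam \<in> m \<rightarrow>\<^sub>M count_space UNIV"
      using code_measurable measurable_cong_sets[OF sets_m refl] by blast
    then have "(\<lambda>y. min (code lam ((F lam ^^ i) y)) (Suc N)) \<in> m \<rightarrow>\<^sub>M count_space UNIV"
      by (rule measurable_compose[OF measurable_compose[OF measurable_funpow[OF F_meas_m]]]) simp
    then show ?thesis by (simp add: lump_def)
  qed
  then have "{y \<in> space m. lump N lam ((F lam ^^ i) y) = k} \<in> sets m" for i k
    using measurable_sets[of "\<lambda>y. lump N lam ((F lam ^^ i) y)" m "count_space UNIV" "{k}"]
    by (simp add: vimage_def Int_def conj_commute)
  then have "{y \<in> space m. \<forall>i\<in>{..<n}. lump N lam ((F lam ^^ i) y) = lump N lam ((F lam ^^ i) x)} \<in> sets m"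
    by (intro sets.sets_Collect_finite_All) auto
  then show ?thesis by (simp add: block_def space_m Ball_def)
qed

text \<open>Follows the branches with the lumped codes of the orbit: lumping never decreases the
  weight of a branch, and it respects the transition rule. The domain at the last time has index at
  most \<open>Suc N\<close> and so mass at least \<open>(1 / 2) ^ Suc N\<close>, which stands in for
  the last weight.\<close>

lemma prob_block_ge:
  assumes "x \<in> {0<..1}"
  shows "(1 / 2) ^ Suc N * (\<Prod>i<n. weight (code lam ((F lam ^^ i) x))) \<le> prob (block N (Suc n) x)"
  using assms
proof (induction n arbitrary: x)
  case 0
  define k where "k = lump N lam x"
  have k: "1 \<le> k" "k \<le> Suc N" using code_pos[OF 0] by (auto simp: k_def lump_def)
  have "W lam k \<subseteq> block N (Suc 0) x"
  proof
    fix y assume "y \<in> W lam k"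
    then have "y \<in> {0<..1}" "code lam y = k" using in_W_iff[OF k(1)] by blast+
    then show "y \<in> block N (Suc 0) x" using k(2) by (simp add: block_def lump_def k_def)
  qed
  then have "prob (W lam k) \<le> prob (block N (Suc 0) x)"
    by (intro finite_measure_mono block_sets)
  moreover have "(1 / 2) ^ Suc N \<le> (1 / 2 :: real) ^ k"
    using k by (intro power_decreasing) auto
  ultimately show ?case using prob_W[OF k(1)] by simp
next
  case (Suc n)
  define k where "k = lump N lam x"
  have k: "1 \<le> k" "k \<le> code lam x" using code_pos[OF Suc.prems] by (auto simp: k_def lump_def)
  have Fx: "F lam x \<in> {0<..1}" using F_closed[OF Suc.prems] .
  define D where "D = block N (Suc n) (F lam x)"
  have D_sub: "D \<subseteq> {0<..lam ^ (k - 2)}"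
  proof
    fix y assume "y \<in> D"
    then have y: "y \<in> {0<..1}" "lump N lam y = lump N lam (F lam x)"
      by (auto simp: D_def block_def dest: spec[of _ 0])
    have "k - 1 \<le> lump N lam (F lam x)"
      using code_F[OF Suc.prems] by (auto simp: k_def lump_def)
    then have "k - 1 \<le> code lam y" unfolding y(2)[symmetric] by (simp add: lump_def)
    then show "y \<in> {0<..lam ^ (k - 2)}" using le_code_iff[OF y(1), of k] y(1) by simp
  qed
  have "W lam k \<inter> F lam -` D \<subseteq> block N (Suc (Suc n)) x"
  proof
    fix y assume y: "y \<in> W lam k \<inter> F lam -` D"
    then have "y \<in> {0<..1}" "code lam y = k" using in_W_iff[OF k(1)] by blast+
    then have "lump N lam ((F lam ^^ i) y) = lump N lam ((F lam ^^ i) x)" if "i < Suc (Suc n)" for i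
    proof (cases i)
      case 0
      then show ?thesis using \<open>code lam y = k\<close> by (simp add: k_def lump_def)
    next
      case (Suc j)
      then show ?thesis using y that by (auto simp: D_def block_def funpow_swap1)
    qed
    with \<open>y \<in> {0<..1}\<close> show "y \<in> block N (Suc (Suc n)) x" by (simp add: block_def)
  qed
  then have "prob (W lam k \<inter> F lam -` D) \<le> prob (block N (Suc (Suc n)) x)"
    by (intro finite_measure_mono block_sets)
  moreover have "prob (W lam k \<inter> F lam -` D) = weight k * prob D"
    using measure_branch[OF k(1), of D] block_sets D_sub by (simp add: D_def Int_absorb2)
  moreover have "weight (code lam x) * ((1 / 2) ^ Suc N * (\<Prod>i<n. weight (code lam ((F lam ^^ i) (F lam x)))))
      \<le> weight k * prob D"
  proof (rule mult_mono)
    show "weight (code lam x) \<le> weight k" using k by (auto simp: weight_def)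
    show "(1 / 2) ^ Suc N * (\<Prod>i<n. weight (code lam ((F lam ^^ i) (F lam x)))) \<le> prob D"
      unfolding D_def by (rule Suc.IH[OF Fx])
  qed (auto simp: weight_def intro!: mult_nonneg_nonneg prod_nonneg)
  moreover have "(\<Prod>i<Suc n. weight (code lam ((F lam ^^ i) x))) =
      weight (code lam x) * (\<Prod>i<n. weight (code lam ((F lam ^^ i) (F lam x))))"
    unfolding prod.lessThan_Suc_shift by (simp add: funpow_swap1)
  ultimately show ?case by (simp add: mult_ac)
qed

text \<open>Words are weighted by how well they are guessed along an \<open>m\<close>-random orbit.
  An orbit that shares lumped codes with that of \<open>x\<close> stays close to it and guesses its
  cells up to the loss \<open>\<kappa>\<close>; such orbits have mass bounded below by
  \<open>prob_block_ge\<close>. Gibbs' inequality and invariance then give the rate, with error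
  \<open>e\<close> from the mean of \<open>\<kappa>\<close>.\<close>

lemma entropy_rate_upper:
  assumes \<mu>: "\<mu> \<in> invariant_probs {0<..1} (F lam)" and P: "P \<in> finite_partitions \<mu>"
  shows "entropy_rate \<mu> (F lam) P \<le> ln 2 * (1 + measure \<mu> {0<..lam})"
proof (rule field_le_epsilon)
  fix e :: real assume e: "0 < e"
  have bp: "borel_prob {0<..1} \<mu>" and F\<mu>: "F lam \<in> \<mu> \<rightarrow>\<^sub>M \<mu>" "distr \<mu> \<mu> (F lam) = \<mu>"
    using \<mu> by (auto simp: invariant_probs_def)
  interpret \<mu>: prob_space \<mu> using bp by (simp add: borel_prob_def)
  interpret \<mu>: partitioned \<mu> "F lam" P
    by standard (use F\<mu> P in auto)
  have sets_\<mu>: "sets \<mu> = sets m" using bp by (simp add: borel_prob_def sets_m)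
  have space_\<mu>: "space \<mu> = {0<..1}" using sets_eq_imp_space_eq[OF sets_\<mu>] space_m by simp
  obtain r \<kappa> \<eta> where r: "\<And>A. r A \<in> borel_measurable borel" "\<And>A y. 0 < r A y" "\<And>A y. r A y \<le> 1"
      "\<And>y. (\<Sum>A\<in>P. r A y) \<le> 1"
    and \<kappa>: "integrable \<mu> \<kappa>" "(\<integral>x. \<kappa> x \<partial>\<mu>) \<le> e" and "0 < \<eta>"
    and near: "\<And>x y. x \<in> {0<..1::real} \<Longrightarrow> dist x y < \<eta> \<Longrightarrow> exp (- \<kappa> x) \<le> r (cell P x) y"
    using partition_kernel[OF bp _ P e] by auto
  \<comment> \<open>\<open>l\<close> codes of look-ahead and lumping above \<open>N\<close> bring
    the distance in \<open>lump_close\<close> below the scale of the kernel.\<close>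
  obtain l where l: "(1 - lam) ^ l < \<eta>"
    using real_arch_pow_inv[OF \<open>0 < \<eta>\<close>, of "1 - lam"] lam_pos by auto
  obtain N where N: "lam ^ N < \<eta>"
    using real_arch_pow_inv[OF \<open>0 < \<eta>\<close> lam_less_1] by auto
  define L where "L = ln 2 * (1 + \<mu>.prob {0<..lam})"
  \<comment> \<open>The overhead independent of \<open>n\<close>: the lumped code at the last time
    and the \<open>l\<close> steps of look-ahead.\<close>
  define C where "C = real (Suc N) * ln 2 + real l * L"
  have "entropy_rate \<mu> (F lam) P \<le> L + e"
  proof (rule \<mu>.entropy_rate_le)
    fix n :: nat
    define q where "q a = (\<integral>y. (\<Prod>i<n. r (a i) ((F lam ^^ i) y)) \<partial>m)" for a
    have r_meas: "(\<lambda>y. r A ((F lam ^^ i) y)) \<in> borel_measurable m" for A i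
    proof (rule measurable_compose[OF measurable_funpow[OF F_meas_m]])
      show "r A \<in> borel_measurable m"
        unfolding measurable_cong_sets[OF sets_m refl]
        by (rule measurable_restrict_space1[OF r(1)])
    qed
    have prod_int: "integrable m (\<lambda>y. \<Prod>i<n. r (a i) ((F lam ^^ i) y))" for a
    proof (rule integrable_const_bound[of _ 1])
      have "norm (\<Prod>i<n. r (a i) ((F lam ^^ i) y)) \<le> 1" for y
        using r(2,3) unfolding real_norm_def abs_prod
        by (intro prod_le_1) (simp add: abs_of_nonneg less_imp_le)
      then show "AE y in m. norm (\<Prod>i<n. r (a i) ((F lam ^^ i) y)) \<le> 1" by simp
    qed (intro borel_measurable_prod r_meas)
    have lower: "(1 / 2) ^ Suc N * (\<Prod>i<n + l. weight (code lam ((F lam ^^ i) x))) *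
        (\<Prod>i<n. exp (- \<kappa> ((F lam ^^ i) x))) \<le> q (itinerary (F lam) P n x)"
      if x: "x \<in> {0<..1}" for x
    proof -
      define c where "c = (\<Prod>i<n. exp (- \<kappa> ((F lam ^^ i) x)))"
      have "(1 / 2) ^ Suc N * (\<Prod>i<n + l. weight (code lam ((F lam ^^ i) x))) * c
          \<le> prob (block N (Suc (n + l)) x) * c"
        using prob_block_ge[OF x] by (intro mult_right_mono) (auto simp: c_def intro: prod_nonneg)
      also have "\<dots> = (\<integral>y. c * indicator (block N (Suc (n + l)) x) y \<partial>m)"
        using block_sets by simp
      also have "\<dots> \<le> q (itinerary (F lam) P n x)"
        unfolding q_def
      proof (rule integral_mono[OF _ prod_int])
        show "integrable m (\<lambda>y. c * indicator (block N (Suc (n + l)) x) y)"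
          using block_sets by (intro integrable_mult_right integrable_real_indicator)
            (auto simp: emeasure_eq_measure)
        fix y
        show "c * indicator (block N (Suc (n + l)) x) y
            \<le> (\<Prod>i<n. r (itinerary (F lam) P n x i) ((F lam ^^ i) y))"
        proof (cases "y \<in> block N (Suc (n + l)) x")
          case True
          have "exp (- \<kappa> ((F lam ^^ i) x)) \<le> r (cell P ((F lam ^^ i) x)) ((F lam ^^ i) y)"
            if "i < n" for i
          proof (rule near)
            show Fx: "(F lam ^^ i) x \<in> {0<..1}" by (rule F_funpow_closed[OF x])
            have Fy: "(F lam ^^ i) y \<in> {0<..1}" using F_funpow_closed True by (simp add: block_def)
            have "\<bar>(F lam ^^ i) x - (F lam ^^ i) y\<bar> \<le> max ((1 - lam) ^ l) (lam ^ N)"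
            proof (rule lump_close[OF Fx Fy])
              fix j assume "j < l"
              then have "lump N lam ((F lam ^^ (j + i)) y) = lump N lam ((F lam ^^ (j + i)) x)"
                using True \<open>i < n\<close> by (simp add: block_def)
              then show "lump N lam ((F lam ^^ j) ((F lam ^^ i) x)) =
                  lump N lam ((F lam ^^ j) ((F lam ^^ i) y))"
                by (simp add: funpow_add)
            qed
            also have "\<dots> < \<eta>" using l N by simp
            finally show "dist ((F lam ^^ i) x) ((F lam ^^ i) y) < \<eta>" by (simp add: dist_real_def)
          qed
          then have "c \<le> (\<Prod>i<n. r (cell P ((F lam ^^ i) x)) ((F lam ^^ i) y))"
            unfolding c_def by (intro prod_mono) auto
          also have "\<dots> = (\<Prod>i<n. r (itinerary (F lam) P n x i) ((F lam ^^ i) y))"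
            by (intro prod.cong) (auto simp: itinerary_def)
          finally show ?thesis using True by simp
        next
          case False
          then show ?thesis using r(2) by (auto intro!: prod_nonneg intro: less_imp_le)
        qed
      qed
      finally show ?thesis by (simp add: c_def)
    qed
    have lower_pos: "0 < (1 / 2) ^ Suc N * (\<Prod>i<n + l. weight (code lam ((F lam ^^ i) x))) *
        (\<Prod>i<n. exp (- \<kappa> ((F lam ^^ i) x)))" for x
      by (intro mult_pos_pos prod_pos) (auto simp: weight_pos)
    define B where "B x = real (Suc N) * ln 2 +
      (\<Sum>i<n + l. ln 2 * (1 + indicator {0<..lam} ((F lam ^^ i) x))) + (\<Sum>i<n. \<kappa> ((F lam ^^ i) x))" for x
    have code_le: "- ln (q (itinerary (F lam) P n x)) \<le> B x" if x: "x \<in> space \<mu>" for x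
    proof -
      have x': "x \<in> {0<..1}" using x space_\<mu> by simp
      have "- ln (q (itinerary (F lam) P n x)) \<le>
          - ln ((1 / 2) ^ Suc N * (\<Prod>i<n + l. weight (code lam ((F lam ^^ i) x))) *
            (\<Prod>i<n. exp (- \<kappa> ((F lam ^^ i) x))))"
        using lower[OF x'] lower_pos[of x] by simp
      also have "\<dots> = real (Suc N) * ln 2 + (\<Sum>i<n + l. - ln (weight (code lam ((F lam ^^ i) x)))) +
          (\<Sum>i<n. \<kappa> ((F lam ^^ i) x))"
      proof -
        have w: "0 < (\<Prod>i<n + l. weight (code lam ((F lam ^^ i) x)))"
          by (intro prod_pos) (simp add: weight_pos)
        have k: "0 < (\<Prod>i<n. exp (- \<kappa> ((F lam ^^ i) x)))" by (intro prod_pos) simp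
        have "ln ((1 / 2 :: real) ^ Suc N) = - (real (Suc N) * ln 2)"
          by (simp add: ln_realpow ln_div del: power_Suc)
        moreover have "ln (\<Prod>i<n + l. weight (code lam ((F lam ^^ i) x))) =
            (\<Sum>i<n + l. ln (weight (code lam ((F lam ^^ i) x))))"
          by (rule ln_prod) (simp_all add: weight_def)
        moreover have "ln (\<Prod>i<n. exp (- \<kappa> ((F lam ^^ i) x))) = (\<Sum>i<n. - \<kappa> ((F lam ^^ i) x))"
          by (subst ln_prod) simp_all
        ultimately show ?thesis
          using w k by (simp add: ln_mult_pos sum_negf del: power_Suc)
      qed
      also have "(\<Sum>i<n + l. - ln (weight (code lam ((F lam ^^ i) x)))) =
          (\<Sum>i<n + l. ln 2 * (1 + indicator {0<..lam} ((F lam ^^ i) x)))"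
        by (intro sum.cong refl neg_ln_weight_code F_funpow_closed[OF x'])
      finally show ?thesis by (simp add: B_def)
    qed
    have head: "{0<..lam} \<in> sets \<mu>" using head_in_sets[of 1] sets_\<mu> by simp
    have ind_int: "integrable \<mu> (\<lambda>x. ln (2::real) * (1 + indicator {0<..lam} x))"
    proof -
      have "integrable \<mu> (indicator {0<..lam} :: real \<Rightarrow> real)"
        using head by (rule integrable_real_indicator) (simp add: \<mu>.emeasure_eq_measure)
      then show ?thesis
        by (intro integrable_mult_right Bochner_Integration.integrable_add) auto
    qed
    have ind_val: "(\<integral>x. ln 2 * (1 + indicator {0<..lam} x) \<partial>\<mu>) = L"
    proof -
      have "integrable \<mu> (indicator {0<..lam} :: real \<Rightarrow> real)"
        using head by (rule integrable_real_indicator) (simp add: \<mu>.emeasure_eq_measure)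
      then show ?thesis
        using head \<mu>.prob_space by (simp add: L_def)
    qed
    have B_int: "integrable \<mu> B"
      unfolding B_def using \<mu>.integrable_funpow[OF ind_int] \<mu>.integrable_funpow[OF \<kappa>(1)]
      by (intro Bochner_Integration.integrable_add Bochner_Integration.integrable_sum) auto
    have "(\<integral>x. B x \<partial>\<mu>) = real (Suc N) * ln 2 + real (n + l) * L + real n * (\<integral>x. \<kappa> x \<partial>\<mu>)"
    proof -
      have 1: "(\<integral>x. (\<Sum>i<n + l. ln 2 * (1 + indicator {0<..lam} ((F lam ^^ i) x))) \<partial>\<mu>) = real (n + l) * L"
        using \<mu>.integrable_funpow[OF ind_int]
          \<mu>.integral_funpow[OF borel_measurable_integrable[OF ind_int]]
        by (subst Bochner_Integration.integral_sum) (simp_all only: ind_val sum_constant card_lessThan)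
      have 2: "(\<integral>x. (\<Sum>i<n. \<kappa> ((F lam ^^ i) x)) \<partial>\<mu>) = real n * (\<integral>x. \<kappa> x \<partial>\<mu>)"
        using \<mu>.integrable_funpow[OF \<kappa>(1)]
          \<mu>.integral_funpow[OF borel_measurable_integrable[OF \<kappa>(1)]]
        by (subst Bochner_Integration.integral_sum) (simp_all only: sum_constant card_lessThan)
      have "(\<integral>x. B x \<partial>\<mu>) = (\<integral>x. real (Suc N) * ln 2 \<partial>\<mu>) +
          (\<integral>x. (\<Sum>i<n + l. ln 2 * (1 + indicator {0<..lam} ((F lam ^^ i) x))) \<partial>\<mu>) +
          (\<integral>x. (\<Sum>i<n. \<kappa> ((F lam ^^ i) x)) \<partial>\<mu>)"
        unfolding B_def using \<mu>.integrable_funpow[OF ind_int] \<mu>.integrable_funpow[OF \<kappa>(1)]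
        by (subst Bochner_Integration.integral_add Bochner_Integration.integral_add;
            (intro Bochner_Integration.integrable_add Bochner_Integration.integrable_sum)?; simp)+
      then show ?thesis using 1 2 \<mu>.prob_space by simp
    qed
    also have "\<dots> \<le> real n * (L + e) + C"
      using \<kappa>(2) mult_left_mono[of "\<integral>x. \<kappa> x \<partial>\<mu>" e "real n"] by (simp add: C_def algebra_simps)
    finally have B_le: "(\<integral>x. B x \<partial>\<mu>) \<le> real n * (L + e) + C" .
    have q_pos: "0 < q a" if "a \<in> itinerary (F lam) P n ` space \<mu>" for a
    proof -
      obtain x where "x \<in> {0<..1}" "a = itinerary (F lam) P n x" using \<open>a \<in> _\<close> space_\<mu> by auto
      then show ?thesis using less_le_trans[OF lower_pos lower] by simp
    qed
    have q_nonneg: "0 \<le> q a" for a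
      unfolding q_def using r(2) by (intro integral_nonneg_AE AE_I2 prod_nonneg) (auto intro: less_imp_le)
    have fin: "finite ({..<n} \<rightarrow>\<^sub>E P)" using \<mu>.P_finite by (intro finite_PiE) auto
    have "(\<Sum>a\<in>itinerary (F lam) P n ` space \<mu>. q a) \<le> (\<Sum>a\<in>{..<n} \<rightarrow>\<^sub>E P. q a)"
      using \<mu>.itinerary_PiE q_nonneg fin by (intro sum_mono2) auto
    also have "\<dots> = (\<integral>y. (\<Sum>a\<in>{..<n} \<rightarrow>\<^sub>E P. \<Prod>i<n. r (a i) ((F lam ^^ i) y)) \<partial>m)"
      unfolding q_def by (rule Bochner_Integration.integral_sum[symmetric, OF prod_int])
    \<comment> \<open>Expanding a product of sums: summing over all words turns the guesses at each
      time into a factor at most 1, so \<open>q\<close> has total mass at most 1.\<close>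
    also have "\<dots> = (\<integral>y. (\<Prod>i<n. \<Sum>A\<in>P. r A ((F lam ^^ i) y)) \<partial>m)"
      using \<mu>.P_finite by (subst prod_sum_PiE) auto
    also have "\<dots> \<le> 1"
    proof (rule integral_le_const)
      show "integrable m (\<lambda>y. \<Prod>i<n. \<Sum>A\<in>P. r A ((F lam ^^ i) y))"
        using \<mu>.P_finite prod_int by (subst prod_sum_PiE) (auto intro!: Bochner_Integration.integrable_sum)
      show "AE y in m. (\<Prod>i<n. \<Sum>A\<in>P. r A ((F lam ^^ i) y)) \<le> 1"
        using r(2,4) by (intro AE_I2 prod_le_1) (auto intro!: sum_nonneg intro: less_imp_le)
    qed
    finally have q_sum: "(\<Sum>a\<in>itinerary (F lam) P n ` space \<mu>. q a) \<le> 1" .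
    show "partition_entropy \<mu> (refinement \<mu> (F lam) P n) \<le> real n * (L + e) + C"
      unfolding \<mu>.partition_entropy_eq
      by (rule order_trans[OF \<mu>.entropy_le_integral[where q = q and B = B] B_le])
         (fact \<mu>.itinerary_simple q_pos q_sum B_int code_le)+
  qed
  then show "entropy_rate \<mu> (F lam) P \<le> ln 2 * (1 + measure \<mu> {0<..lam}) + e"
    by (simp add: L_def)
qed

end

section \<open>Lower bound for the pressure\<close>

text \<open>The invariant measures of nearly maximal free energy come from the random walk of codes reflected
  at \<open>N\<close>, whose stationary distribution is uniform on \<open>{1..N}\<close>.\<close>

locale truncation =
  fixes N :: nat
  assumes N: "2 \<le> N"
begin

abbreviation H :: real where "H \<equiv> 1 / 2"

text \<open>Doubling is a single branch for all codes from \<open>N\<close> on. It maps their union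
  onto the codes from \<open>N - 1\<close> on, so from \<open>N\<close> the walk moves to
  \<open>N\<close> or \<open>N - 1\<close> with probability \<open>1 / 2\<close> each.\<close>

definition G :: "real \<Rightarrow> real"
  where "G x = (if x \<le> H ^ (N - 1) then 2 * x else F H x)"

definition b :: "real \<Rightarrow> nat"
  where "b x = min N (code H x)"

definition wt :: "nat \<Rightarrow> real"
  where "wt k = (if k = N then 1 / 2 else weight k)"

text \<open>The reciprocal Lebesgue mass of \<open>cyl k\<close> divided by \<open>N\<close>, so
  that all truncated codes become equally likely.\<close>

definition rho :: "nat \<Rightarrow> real"
  where "rho k = (if k = N then 2 ^ (N - 1) else 2 ^ k) / N"

definition cyl :: "nat \<Rightarrow> real set"
  where "cyl k = {x \<in> {0<..1}. b x = k}"

lemma le_iff_code: "x \<in> {0<..1} \<Longrightarrow> x \<le> H ^ (N - 1) \<longleftrightarrow> N \<le> code H x"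
  using half.less_code_iff[of x "N - 1"] N by auto

lemma b_bounds: "x \<in> {0<..1} \<Longrightarrow> 1 \<le> b x" "b x \<le> N"
  using half.code_pos[of x] N by (auto simp: b_def)

lemma cyl_less: "1 \<le> k \<Longrightarrow> k < N \<Longrightarrow> cyl k = W H k"
proof -
  assume "1 \<le> k" "k < N"
  then have "min N c = k \<longleftrightarrow> c = k" for c :: nat by auto
  then show ?thesis unfolding half.W_eq[OF \<open>1 \<le> k\<close>] cyl_def b_def by simp
qed

lemma cyl_N: "cyl N = {0<..H ^ (N - 1)}"
proof -
  have "cyl N = {x \<in> {0<..1}. x \<le> H ^ (N - 1)}"
    unfolding cyl_def b_def
  proof (rule Collect_cong)
    fix x
    have "min N c = N \<longleftrightarrow> N \<le> c" for c :: nat by auto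
    then show "x \<in> {0<..1} \<and> min N (code H x) = N \<longleftrightarrow> x \<in> {0<..1} \<and> x \<le> H ^ (N - 1)"
      using le_iff_code[of x] by blast
  qed
  then show ?thesis using half.lam_power_le_1[of "N - 1"] by fastforce
qed

lemma cyl_sets: "1 \<le> k \<Longrightarrow> k \<le> N \<Longrightarrow> cyl k \<in> sets borel"
  using cyl_less[of k] cyl_N half.sets_W[of k] by (cases "k = N") auto

lemma G_closed: "x \<in> {0<..1} \<Longrightarrow> G x \<in> {0<..1}"
proof -
  assume x: "x \<in> {0<..1}"
  have "H ^ (N - 1) \<le> H ^ 1" using N by (intro power_decreasing) auto
  then show ?thesis using x half.F_closed[OF x] by (auto simp: G_def)
qed

lemma sets_iff: "A \<in> sets unit_lebesgue \<longleftrightarrow> A \<in> sets borel \<and> A \<subseteq> {0<..1}"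
  by (simp add: sets_unit_lebesgue half.sets_unit_iff)

lemma G_meas: "G \<in> unit_lebesgue \<rightarrow>\<^sub>M unit_lebesgue"
  unfolding measurable_cong_sets[OF sets_unit_lebesgue sets_unit_lebesgue]
proof (rule measurable_restrict_space2)
  have "F H \<in> borel_measurable (restrict_space borel {0<..1})"
    using half.F_measurable by (simp add: measurable_restrict_space2_iff)
  moreover have "(\<lambda>x. x :: real) \<in> borel_measurable (restrict_space borel {0<..1})"
    by (rule measurable_restrict_space1) simp
  ultimately show "G \<in> borel_measurable (restrict_space borel {0<..1})"
    unfolding G_def[abs_def] by measurable
qed (use G_closed in \<open>auto simp: space_restrict_space\<close>)

lemma b_meas: "b \<in> unit_lebesgue \<rightarrow>\<^sub>M count_space UNIV"
  unfolding measurable_cong_sets[OF sets_unit_lebesgue refl] b_def[abs_def]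
  by (rule measurable_compose[OF half.code_measurable]) simp

lemma b_step:
  assumes x: "x \<in> {0<..1}" shows "b x - 1 \<le> b (G x)"
proof (cases "x \<le> H ^ (N - 1)")
  case True
  have "N - 1 = Suc (N - 2)" using N by simp
  then have "H ^ (N - 1) = H * H ^ (N - 2)" by (simp only: power_Suc)
  then have "G x \<le> H ^ (N - 2)" using True by (simp add: G_def)
  then have "N - 1 \<le> code H (G x)" using half.le_code_iff[OF G_closed[OF x], of N] by blast
  then show ?thesis unfolding b_def by linarith
next
  case False
  then have "G x = F H x" by (simp add: G_def)
  with half.code_F[OF x] have "code H x - 1 \<le> code H (G x)" by (simp only:)
  then show ?thesis unfolding b_def by linarith
qed

lemma L_cyl_G_vimage:
  assumes k: "1 \<le> k" "k \<le> N" and E: "E \<in> sets unit_lebesgue"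
  shows "measure unit_lebesgue (cyl k \<inter> G -` E) =
    wt k * measure unit_lebesgue (E \<inter> {0<..H ^ (k - 2)})"
proof (cases "k = N")
  case True
  have E': "E \<in> sets borel" "E \<subseteq> {0<..1}" using E sets_iff by auto
  have "cyl N \<inter> G -` E = {0<..0 + H ^ (N - 1)} \<inter> {x. (x - 0) / H \<in> E}"
    by (auto simp: cyl_N G_def mult.commute)
  moreover have "H ^ (N - 1) / H = H ^ (N - 2)"
    using N by (simp add: power_diff power_one_over)
  moreover have "cyl N \<inter> G -` E \<subseteq> {0<..1}" by (auto simp: cyl_def)
  moreover have "E \<inter> {0<..H ^ (N - 2)} \<subseteq> {0<..1}" using E'(2) by blast
  ultimately show ?thesis
    using measure_lborel_affine_branch[of H E 0 "H ^ (N - 1)"] E'(1) True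
    by (simp only: measure_unit_lebesgue wt_def if_True) simp
next
  case False
  then have "k < N" using k by simp
  have "cyl k \<inter> G -` E = W H k \<inter> F H -` E"
  proof -
    have "G x = F H x" if "x \<in> cyl k" for x
      using that \<open>k < N\<close> le_iff_code[of x] by (auto simp: cyl_def b_def G_def min_def split: if_splits)
    then show ?thesis unfolding cyl_less[OF k(1) \<open>k < N\<close>, symmetric] by auto
  qed
  then show ?thesis using measure_half_branch[OF k(1) E] False by (simp add: wt_def)
qed

interpretation L: prob_space unit_lebesgue
  by (rule prob_space_unit_lebesgue)

text \<open>The image of branch \<open>j\<close> consists of the cylinders with index at least
  \<open>j - 1\<close>. Writing this as an \<open>if\<close> over the fixed range
  \<open>{1..N}\<close> lets the double sum in \<open>distr_kappa\<close> be exchanged.\<close>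

lemma L_split:
  assumes "E \<in> sets unit_lebesgue" and j: "j \<le> N"
  shows "L.prob (E \<inter> {0<..H ^ (j - 2)}) = (\<Sum>k\<in>{1..N}. if j - 1 \<le> k then L.prob (E \<inter> cyl k) else 0)"
proof -
  have E: "E \<in> sets borel" "E \<subseteq> {0<..1}" using assms(1) sets_iff by auto
  have eq: "E \<inter> {0<..H ^ (j - 2)} = (\<Union>k\<in>{k \<in> {1..N}. j - 1 \<le> k}. E \<inter> cyl k)"
  proof (intro set_eqI)
    fix x
    have "x \<le> H ^ (j - 2) \<longleftrightarrow> j - 1 \<le> b x" if "x \<in> {0<..1}"
      using half.le_code_iff[OF that, of j] j by (auto simp: b_def)
    then show "x \<in> E \<inter> {0<..H ^ (j - 2)} \<longleftrightarrow> x \<in> (\<Union>k\<in>{k \<in> {1..N}. j - 1 \<le> k}. E \<inter> cyl k)"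
      using E(2) b_bounds[of x] by (auto simp: cyl_def)
  qed
  have "L.prob (E \<inter> {0<..H ^ (j - 2)}) = (\<Sum>k\<in>{k \<in> {1..N}. j - 1 \<le> k}. L.prob (E \<inter> cyl k))"
    unfolding eq using E cyl_sets
    by (intro L.finite_measure_finite_Union) (auto simp: disjoint_family_on_def cyl_def sets_iff)
  also have "\<dots> = (\<Sum>k\<in>{1..N}. if j - 1 \<le> k then L.prob (E \<inter> cyl k) else 0)"
    by (rule sum.inter_filter) simp
  finally show ?thesis .
qed

lemma L_split_all: "E \<in> sets unit_lebesgue \<Longrightarrow> L.prob E = (\<Sum>k\<in>{1..N}. L.prob (E \<inter> cyl k))"
  using L_split[of E 0] sets_iff[of E] by (simp add: Int_absorb2)

definition kappa :: "real measure"
  where "kappa = density unit_lebesgue (\<lambda>x. ennreal (rho (b x)))"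

lemma sets_kappa: "sets kappa = sets unit_lebesgue"
  by (simp add: kappa_def)

lemma space_kappa: "space kappa = {0<..1}"
  by (simp add: kappa_def space_unit_lebesgue)

lemma rho_nonneg: "0 \<le> rho k"
  by (simp add: rho_def)

lemma emeasure_kappa:
  assumes A: "A \<in> sets unit_lebesgue"
  shows "emeasure kappa A = ennreal (\<Sum>k\<in>{1..N}. rho k * L.prob (A \<inter> cyl k))"
proof -
  have cyl: "A \<inter> cyl k \<in> sets unit_lebesgue" if "k \<in> {1..N}" for k
    using A cyl_sets[of k] that by (auto simp: sets_iff)
  have "(\<lambda>x. ennreal (rho (b x))) \<in> borel_measurable unit_lebesgue"
    by (rule measurable_compose[OF b_meas]) simp
  then have "emeasure kappa A = (\<integral>\<^sup>+x. ennreal (rho (b x)) * indicator A x \<partial>unit_lebesgue)"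
    unfolding kappa_def using A by (rule emeasure_density)
  also have "\<dots> = (\<integral>\<^sup>+x. (\<Sum>k\<in>{1..N}. ennreal (rho k) * indicator (A \<inter> cyl k) x) \<partial>unit_lebesgue)"
  proof (rule nn_integral_cong)
    fix x assume "x \<in> space unit_lebesgue"
    then have x: "x \<in> {0<..1}" by (simp add: space_unit_lebesgue)
    then have "(\<Sum>k\<in>{1..N}. ennreal (rho k) * indicator (A \<inter> cyl k) x) =
        (\<Sum>k\<in>{1..N}. if k = b x then ennreal (rho k) * indicator A x else 0)"
      by (intro sum.cong) (auto simp: cyl_def indicator_def)
    also have "\<dots> = ennreal (rho (b x)) * indicator A x"
      using b_bounds[of x] x by simp
    finally show "ennreal (rho (b x)) * indicator A x =
        (\<Sum>k\<in>{1..N}. ennreal (rho k) * indicator (A \<inter> cyl k) x)" ..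
  qed
  also have "\<dots> = (\<Sum>k\<in>{1..N}. ennreal (rho k) * emeasure unit_lebesgue (A \<inter> cyl k))"
    using cyl by (subst nn_integral_sum) (auto simp: nn_integral_cmult_indicator)
  also have "\<dots> = ennreal (\<Sum>k\<in>{1..N}. rho k * L.prob (A \<inter> cyl k))"
    using rho_nonneg by (simp add: L.emeasure_eq_measure sum_nonneg flip: ennreal_mult sum_ennreal)
  finally show ?thesis .
qed

lemma measure_kappa:
  "A \<in> sets unit_lebesgue \<Longrightarrow> measure kappa A = (\<Sum>k\<in>{1..N}. rho k * L.prob (A \<inter> cyl k))"
  using rho_nonneg by (simp add: measure_def emeasure_kappa sum_nonneg)

lemma L_cyl:
  assumes "1 \<le> k" "k \<le> N"
  shows "rho k * L.prob (cyl k) = 1 / N"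
proof (cases "k = N")
  case True
  have "L.prob (cyl N) = measure lborel {0<..H ^ (N - 1)}"
    using half.lam_power_le_1[of "N - 1"] unfolding cyl_N by (intro measure_unit_lebesgue) auto
  then show ?thesis using True by (simp add: rho_def power_one_over)
next
  case False
  then have "cyl k = W H k" using assms cyl_less by simp
  then have "L.prob (cyl k) = measure lborel {H ^ k<..H ^ (k - 1)}"
    using half.W_subset[of k] unfolding W_def by (simp only: measure_unit_lebesgue)
  also have "\<dots> = H ^ (k - 1) - H ^ k"
    by (intro measure_lborel_Ioc power_decreasing) auto
  also have "H ^ (k - 1) = 2 * H ^ k"
    using assms(1) by (cases k) auto
  finally show ?thesis using False N by (simp add: rho_def power_one_over)
qed

lemma measure_kappa_cyl:
  assumes "1 \<le> k" "k \<le> N"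
  shows "measure kappa (cyl k) = 1 / N"
proof -
  have "cyl k \<in> sets unit_lebesgue" using cyl_sets[OF assms] by (auto simp: sets_iff cyl_def)
  moreover have "cyl k \<inter> cyl j = (if j = k then cyl k else {})" for j
    by (auto simp: cyl_def)
  ultimately have "measure kappa (cyl k) = (\<Sum>j\<in>{1..N}. if j = k then rho k * L.prob (cyl k) else 0)"
    unfolding measure_kappa[OF \<open>cyl k \<in> sets unit_lebesgue\<close>] by (intro sum.cong) auto
  also have "\<dots> = rho k * L.prob (cyl k)" using assms by simp
  finally show ?thesis unfolding L_cyl[OF assms] .
qed

lemma prob_space_kappa: "prob_space kappa"
proof (rule prob_spaceI)
  have "space unit_lebesgue \<in> sets unit_lebesgue" by (rule sets.top)
  then have "emeasure kappa {0<..1} = ennreal (\<Sum>k\<in>{1..N}. rho k * L.prob ({0<..1} \<inter> cyl k))"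
    unfolding space_unit_lebesgue by (rule emeasure_kappa)
  also have "(\<Sum>k\<in>{1..N}. rho k * L.prob ({0<..1} \<inter> cyl k)) = (\<Sum>k\<in>{1..N}. 1 / N)"
  proof (rule sum.cong[OF refl])
    fix k assume "k \<in> {1..N}"
    moreover have "{0<..1} \<inter> cyl k = cyl k" by (auto simp: cyl_def)
    ultimately show "rho k * L.prob ({0<..1} \<inter> cyl k) = 1 / N" using L_cyl[of k] by simp
  qed
  finally show "emeasure kappa (space kappa) = 1" using N by (simp add: space_kappa)
qed

text \<open>Stationarity of \<open>rho\<close>: the sources of code \<open>k\<close> are the codes
  \<open>j \<le> k + 1\<close>, and each term is \<open>2 ^ (j - 2) / N\<close>. The truncated
  exponent counts the value \<open>1 / N\<close> twice, for \<open>j = 1\<close> and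
  \<open>j = 2\<close>, which makes the geometric sum an exact power of 2.\<close>

lemma sum_rho_wt:
  assumes "1 \<le> k" "k \<le> N"
  shows "(\<Sum>j\<in>{1..N}. if j - 1 \<le> k then rho j * wt j else 0) = rho k"
proof -
  have geo: "(\<Sum>j\<in>{1..Suc K}. 2 ^ (j - 2)) = (2 ^ K :: real)" for K
    by (induction K) auto
  have rw: "rho j * wt j = 2 ^ (j - 2) / N" if j: "j \<in> {1..N}" for j
  proof -
    consider "j = 1" | "j = Suc (Suc (j - 2))" using j by force
    then show ?thesis
    proof cases
      case 2
      then obtain i where "j = Suc (Suc i)" ..
      then show ?thesis by (auto simp: rho_def wt_def weight_def)
    qed (use N in \<open>simp add: rho_def wt_def weight_def\<close>)
  qed
  define K where "K = min k (N - 1)"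
  have "(\<Sum>j\<in>{1..N}. if j - 1 \<le> k then rho j * wt j else 0) = (\<Sum>j\<in>{1..Suc K}. rho j * wt j)"
  proof -
    have "{j \<in> {1..N}. j - 1 \<le> k} = {1..Suc K}" using N by (auto simp: K_def)
    then show ?thesis using sum.inter_filter[of "{1..N}" "\<lambda>j. rho j * wt j" "\<lambda>j. j - 1 \<le> k"]
      by (simp only: finite_atLeastAtMost)
  qed
  also have "\<dots> = (\<Sum>j\<in>{1..Suc K}. 2 ^ (j - 2) / N)"
    using N by (intro sum.cong refl rw) (auto simp: K_def)
  also have "\<dots> = 2 ^ K / N" unfolding sum_divide_distrib[symmetric] geo ..
  also have "\<dots> = rho k" using assms by (auto simp: K_def rho_def min_def)
  finally show ?thesis .
qed

lemma distr_kappa: "distr kappa kappa G = kappa"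
proof (rule measure_eqI)
  have G: "G \<in> kappa \<rightarrow>\<^sub>M kappa"
    using G_meas measurable_cong_sets[OF sets_kappa sets_kappa] by blast
  fix E assume "E \<in> sets (distr kappa kappa G)"
  then have E: "E \<in> sets unit_lebesgue" by (simp add: sets_kappa)
  have pre: "G -` E \<inter> {0<..1} \<in> sets unit_lebesgue"
    using measurable_sets[OF G_meas E] by (simp add: space_unit_lebesgue)
  have "emeasure (distr kappa kappa G) E = emeasure kappa (G -` E \<inter> {0<..1})"
    using E G by (simp add: emeasure_distr sets_kappa space_kappa)
  also have "\<dots> = ennreal (\<Sum>j\<in>{1..N}. rho j * L.prob (G -` E \<inter> {0<..1} \<inter> cyl j))"
    by (rule emeasure_kappa[OF pre])
  also have "(\<Sum>j\<in>{1..N}. rho j * L.prob (G -` E \<inter> {0<..1} \<inter> cyl j)) =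
      (\<Sum>j\<in>{1..N}. \<Sum>k\<in>{1..N}. if j - 1 \<le> k then rho j * wt j * L.prob (E \<inter> cyl k) else 0)"
  proof (rule sum.cong[OF refl])
    fix j assume j: "j \<in> {1..N}"
    have "G -` E \<inter> {0<..1} \<inter> cyl j = cyl j \<inter> G -` E" by (auto simp: cyl_def)
    then have "L.prob (G -` E \<inter> {0<..1} \<inter> cyl j) =
        wt j * (\<Sum>k\<in>{1..N}. if j - 1 \<le> k then L.prob (E \<inter> cyl k) else 0)"
      using L_cyl_G_vimage[of j E] L_split[OF E, of j] j E by simp
    then show "rho j * L.prob (G -` E \<inter> {0<..1} \<inter> cyl j) =
        (\<Sum>k\<in>{1..N}. if j - 1 \<le> k then rho j * wt j * L.prob (E \<inter> cyl k) else 0)"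
      by (auto simp: sum_distrib_left mult.assoc intro!: sum.cong)
  qed
  also have "\<dots> = (\<Sum>k\<in>{1..N}. (\<Sum>j\<in>{1..N}. if j - 1 \<le> k then rho j * wt j else 0) * L.prob (E \<inter> cyl k))"
    unfolding sum_distrib_right by (subst sum.swap) (auto intro!: sum.cong)
  also have "\<dots> = (\<Sum>k\<in>{1..N}. rho k * L.prob (E \<inter> cyl k))"
    using sum_rho_wt by (intro sum.cong) auto
  finally show "emeasure (distr kappa kappa G) E = emeasure kappa E"
    using emeasure_kappa[OF E] by simp
qed simp

lemma wt_pos: "0 < wt k"
  by (simp add: wt_def weight_def)

definition word_set :: "nat \<Rightarrow> (nat \<Rightarrow> nat) \<Rightarrow> real set"
  where "word_set n d = {x \<in> {0<..1}. \<forall>i<n. b ((G ^^ i) x) = d i}"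

lemma G_funpow_in: "x \<in> {0<..1} \<Longrightarrow> (G ^^ i) x \<in> {0<..1}"
  by (induction i) (simp_all add: G_closed del: greaterThanAtMost_iff)

lemma word_set_Suc: "word_set (Suc n) d = cyl (d 0) \<inter> G -` word_set n (\<lambda>i. d (Suc i))"
proof (intro set_eqI iffI)
  fix x assume "x \<in> word_set (Suc n) d"
  then have x: "x \<in> {0<..1}" and d: "\<And>i. i < Suc n \<Longrightarrow> b ((G ^^ i) x) = d i"
    by (auto simp: word_set_def)
  have "b ((G ^^ i) (G x)) = d (Suc i)" if "i < n" for i
    using d[of "Suc i"] that by (simp add: funpow_swap1)
  then show "x \<in> cyl (d 0) \<inter> G -` word_set n (\<lambda>i. d (Suc i))"
    using x d[of 0] G_closed[OF x] by (simp add: word_set_def cyl_def)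
next
  fix x assume x: "x \<in> cyl (d 0) \<inter> G -` word_set n (\<lambda>i. d (Suc i))"
  have "b ((G ^^ i) x) = d i" if "i < Suc n" for i
    using x that by (cases i) (auto simp: word_set_def cyl_def funpow_swap1)
  then show "x \<in> word_set (Suc n) d" using x by (simp add: word_set_def cyl_def)
qed

text \<open>Only an inequality, because each step drops the restriction to the image of the branch;
  it thus also covers words that break the transition rule.\<close>

lemma L_word_set_le:
  assumes "\<And>i. i < n \<Longrightarrow> d i \<in> {1..N}"
  shows "word_set n d \<in> sets unit_lebesgue \<and> L.prob (word_set n d) \<le> (\<Prod>i<n. wt (d i))"
  using assms
proof (induction n arbitrary: d)
  case 0
  have "word_set 0 d = space unit_lebesgue" by (auto simp: word_set_def space_unit_lebesgue)
  then show ?case by simp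
next
  case (Suc n)
  define E where "E = word_set n (\<lambda>i. d (Suc i))"
  have E: "E \<in> sets unit_lebesgue" "L.prob E \<le> (\<Prod>i<n. wt (d (Suc i)))"
    using Suc.IH[of "\<lambda>i. d (Suc i)"] Suc.prems by (auto simp: E_def)
  have d0: "1 \<le> d 0" "d 0 \<le> N" using Suc.prems[of 0] by auto
  have "cyl (d 0) \<inter> G -` E = cyl (d 0) \<inter> (G -` E \<inter> {0<..1})" by (auto simp: cyl_def)
  also have "\<dots> \<in> sets unit_lebesgue"
  proof (rule sets.Int)
    show "cyl (d 0) \<in> sets unit_lebesgue" using cyl_sets[OF d0] by (auto simp: sets_iff cyl_def)
    show "G -` E \<inter> {0<..1} \<in> sets unit_lebesgue"
      using measurable_sets[OF G_meas E(1)] by (simp add: space_unit_lebesgue)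
  qed
  finally have sets: "cyl (d 0) \<inter> G -` E \<in> sets unit_lebesgue" .
  have "L.prob (cyl (d 0) \<inter> G -` E) = wt (d 0) * L.prob (E \<inter> {0<..H ^ (d 0 - 2)})"
    by (rule L_cyl_G_vimage[OF d0 E(1)])
  also have "\<dots> \<le> wt (d 0) * (\<Prod>i<n. wt (d (Suc i)))"
    using E(1) wt_pos[of "d 0"] order_trans[OF L.finite_measure_mono[OF _ E(1)] E(2)]
    by (intro mult_left_mono) auto
  finally show ?case
    using sets unfolding word_set_Suc E_def[symmetric] prod.lessThan_Suc_shift by simp
qed

text \<open>Bounding the density costs a factor independent of the word length, which disappears in
  the entropy rate.\<close>

lemma measure_kappa_le: "A \<in> sets unit_lebesgue \<Longrightarrow> measure kappa A \<le> 2 ^ N * L.prob A"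
proof -
  assume A: "A \<in> sets unit_lebesgue"
  have "rho k \<le> 2 ^ N" if "k \<in> {1..N}" for k
  proof -
    have "(if k = N then 2 ^ (N - 1) else 2 ^ k :: real) \<le> 2 ^ N"
      using that by (auto intro: power_increasing)
    moreover have "rho k \<le> (if k = N then 2 ^ (N - 1) else 2 ^ k) / 1"
      unfolding rho_def using N by (intro divide_left_mono) auto
    ultimately show ?thesis by simp
  qed
  then have "measure kappa A \<le> (\<Sum>k\<in>{1..N}. 2 ^ N * L.prob (A \<inter> cyl k))"
    unfolding measure_kappa[OF A] by (intro sum_mono mult_right_mono) auto
  then show ?thesis unfolding L_split_all[OF A] by (simp add: sum_distrib_left)
qed

end

section \<open>The reflected walk as an invariant measure of the given map\<close>

locale truncated_system = contraction lam + truncation N for lam :: real and N :: nat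
begin

sublocale coded_system lam unit_lebesgue G b
proof
  show "G \<in> unit_lebesgue \<rightarrow>\<^sub>M unit_lebesgue" by (rule G_meas)
  show "b \<in> unit_lebesgue \<rightarrow>\<^sub>M count_space UNIV" by (rule b_meas)
qed (simp_all only: space_unit_lebesgue b_bounds b_step)

definition M :: "real measure"
  where "M = pushed kappa"

definition part :: "nat \<Rightarrow> real set"
  where "part k = {x \<in> {0<..1}. min N (code lam x) = k}"

lemma M_invariant: "M \<in> invariant_probs {0<..1} (F lam)"
  unfolding M_def by (rule pushed_invariant[OF sets_kappa prob_space_kappa distr_kappa])

lemma space_M: "space M = {0<..1}"
  by (simp add: M_def space_pushed)

lemma sets_M: "sets M = sets (restrict_space borel {0<..1})"
  by (simp add: M_def sets_pushed)

lemma part_sets: "part k \<in> sets M"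
proof -
  have "(\<lambda>x. min N (code lam x)) \<in> restrict_space borel {0<..1} \<rightarrow>\<^sub>M count_space UNIV"
    by (rule measurable_compose[OF code_measurable]) simp
  from measurable_sets[OF this, of "{k}"] show ?thesis
    by (simp add: part_def sets_M space_restrict_space vimage_def Int_def conj_commute)
qed

lemma min_code_theta: "x \<in> {0<..1} \<Longrightarrow> min N (code lam (theta x)) = b x"
  using code_theta[of x] b_bounds(2)[of x] by (simp add: space_unit_lebesgue)

lemma theta_in_unit: "x \<in> {0<..1} \<Longrightarrow> theta x \<in> {0<..1}"
  using theta_in[of x] by (simp only: space_unit_lebesgue)

lemma measure_M_part:
  assumes "1 \<le> k" "k \<le> N"
  shows "measure M (part k) = 1 / N"
proof -
  have "theta -` part k \<inter> {0<..1} = cyl k"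
  proof (rule set_eqI)
    fix x
    show "x \<in> theta -` part k \<inter> {0<..1} \<longleftrightarrow> x \<in> cyl k"
      using min_code_theta[of x] theta_in_unit[of x]
      by (auto simp: part_def cyl_def simp del: greaterThanAtMost_iff)
  qed
  then have "measure M (part k) = measure kappa (cyl k)"
    using measure_pushed[OF sets_kappa, of "part k"] part_sets[of k]
    unfolding M_def sets_pushed space_unit_lebesgue by simp
  then show ?thesis using measure_kappa_cyl[OF assms] by simp
qed

lemma measure_M_itinerary_le:
  assumes x: "x \<in> {0<..1}"
    and Z: "Z = {y \<in> {0<..1}. \<forall>i<n. min N (code lam ((F lam ^^ i) y)) = min N (code lam ((F lam ^^ i) x))}"
    and Z_sets: "Z \<in> sets M"
  shows "measure M Z \<le> 2 ^ N * (\<Prod>i<n. wt (min N (code lam ((F lam ^^ i) x))))"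
proof -
  define d where "d i = min N (code lam ((F lam ^^ i) x))" for i
  have d: "d i \<in> {1..N}" for i
    using code_pos[OF F_funpow_closed[OF x], of i] N by (auto simp: d_def)
  have L: "word_set n d \<in> sets unit_lebesgue" "measure unit_lebesgue (word_set n d) \<le> (\<Prod>i<n. wt (d i))"
    using L_word_set_le[of n d] d by blast+
  have "theta -` Z \<inter> {0<..1} = word_set n d"
  proof (rule set_eqI)
    fix y
    have "min N (code lam ((F lam ^^ i) (theta y))) = b ((G ^^ i) y)" if "y \<in> {0<..1}" for i
      using F_funpow_theta[of y i] min_code_theta[OF G_funpow_in[OF that]] that
      by (simp only: space_unit_lebesgue)
    then show "y \<in> theta -` Z \<inter> {0<..1} \<longleftrightarrow> y \<in> word_set n d"
      using theta_in_unit[of y] unfolding Z word_set_def d_def[symmetric] by auto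
  qed
  then have "measure M Z = measure kappa (word_set n d)"
    using measure_pushed[OF sets_kappa, of Z] Z_sets
    unfolding M_def sets_pushed space_unit_lebesgue by simp
  also have "\<dots> \<le> 2 ^ N * measure unit_lebesgue (word_set n d)"
    by (rule measure_kappa_le[OF L(1)])
  also have "\<dots> \<le> 2 ^ N * (\<Prod>i<n. wt (d i))" using L(2) by simp
  finally show ?thesis by (simp only: d_def)
qed

definition P :: "real set set"
  where "P = part ` {1..N}"

lemma min_code_bounds: "x \<in> {0<..1} \<Longrightarrow> min N (code lam x) \<in> {1..N}"
  using code_pos[of x] N by simp

lemma partition_on_P: "partition_on {0<..1} P"
proof (rule partition_onI)
  show "\<Union> P = {0<..1}"
  proof
    show "{0<..1} \<subseteq> \<Union> P"
    proof
      fix x :: real assume x: "x \<in> {0<..1}"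
      then have "x \<in> part (min N (code lam x))" by (simp add: part_def)
      with min_code_bounds[OF x] show "x \<in> \<Union> P" unfolding P_def by blast
    qed
  qed (auto simp: P_def part_def)
  show "disjnt p q" if "p \<in> P" "q \<in> P" "p \<noteq> q" for p q
    using that by (auto simp: P_def part_def disjnt_def)
  show "{} \<notin> P"
  proof
    assume "{} \<in> P"
    then obtain k where k: "{} = part k" "1 \<le> k" "k \<le> N" by (auto simp: P_def)
    then show False using measure_M_part[of k] N by simp
  qed
qed

lemma P_finite_partition: "P \<in> finite_partitions M"
  using partition_on_P part_sets by (auto simp: finite_partitions_def space_M P_def)

text \<open>Reads the truncated code off a cell through an arbitrary point of it, so that the mass
  bound becomes a function of the word, as \<open>integral_le_entropy\<close> demands.\<close>

definition cell_code :: "real set \<Rightarrow> nat"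
  where "cell_code A = min N (code lam (SOME x. x \<in> A))"

lemma cell_P: "x \<in> {0<..1} \<Longrightarrow> cell P x = part (min N (code lam x))"
  using min_code_bounds[of x] by (intro cell_eq[OF partition_on_P]) (auto simp: P_def part_def)

lemma cell_code_cell:
  assumes "x \<in> {0<..1}"
  shows "cell_code (cell P x) = min N (code lam x)"
proof -
  have "(SOME z. z \<in> cell P x) \<in> part (min N (code lam x))"
    unfolding cell_P[OF assms] by (rule someI[of _ x]) (use assms in \<open>simp add: part_def\<close>)
  then show ?thesis by (simp add: cell_code_def part_def)
qed

lemma neg_ln_wt:
  assumes "x \<in> {0<..1}"
  shows "- ln (wt (min N (code lam x))) = ln 2 * (2 - indicator (part 1) x - indicator (part N) x)"
proof -
  have "ln (4::real) = 2 * ln 2" using ln_realpow[of 2 2] by simp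
  then show ?thesis
    using assms N by (auto simp: wt_def weight_def part_def ln_div indicator_def)
qed

text \<open>Only the codes 1 and \<open>N\<close> have weight \<open>1 / 2\<close>, the others
  \<open>1 / 4\<close>. Each code has mass \<open>1 / N\<close>, so the mean information per step is
  \<open>2 * ln 2\<close> less \<open>ln 2 / N\<close> for each of these two.\<close>

lemma entropy_rate_ge_truncated: "ln 2 * (2 - 2 / N) \<le> entropy_rate M (F lam) P"
proof -
  interpret M: prob_space M
    using M_invariant by (simp add: invariant_probs_def borel_prob_def)
  interpret M: partitioned M "F lam" P
    by standard (use M_invariant P_finite_partition in \<open>auto simp: invariant_probs_def\<close>)
  show ?thesis
  proof (rule M.entropy_rate_ge)
    fix n :: nat
    define u where "u a = 2 ^ N * (\<Prod>i<n. wt (cell_code (a i)))" for a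
    have u: "u (itinerary (F lam) P n x) = 2 ^ N * (\<Prod>i<n. wt (min N (code lam ((F lam ^^ i) x))))"
      if "x \<in> {0<..1}" for x
      using cell_code_cell[OF F_funpow_closed[OF that]] by (simp add: u_def itinerary_def)
    have upper: "M.prob (itinerary (F lam) P n -` {a} \<inter> space M) \<le> u a"
      if a: "a \<in> itinerary (F lam) P n ` space M" for a
    proof -
      obtain x where x: "x \<in> {0<..1}" "a = itinerary (F lam) P n x" using a space_M by auto
      have "itinerary (F lam) P n -` {a} \<inter> space M =
          {y \<in> {0<..1}. \<forall>i<n. min N (code lam ((F lam ^^ i) y)) = min N (code lam ((F lam ^^ i) x))}"
      proof (intro set_eqI iffI)
        fix y assume y: "y \<in> itinerary (F lam) P n -` {a} \<inter> space M"
        then have y': "y \<in> {0<..1}" and eq: "itinerary (F lam) P n y = itinerary (F lam) P n x"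
          using x space_M by auto
        have "min N (code lam ((F lam ^^ i) y)) = min N (code lam ((F lam ^^ i) x))" if "i < n" for i
          using fun_cong[OF eq, of i] that cell_code_cell[OF F_funpow_closed[OF y'], of i]
            cell_code_cell[OF F_funpow_closed[OF x(1)], of i] by (simp add: itinerary_def)
        with y' show "y \<in> {y \<in> {0<..1}. \<forall>i<n. min N (code lam ((F lam ^^ i) y)) = min N (code lam ((F lam ^^ i) x))}"
          by blast
      next
        fix y assume "y \<in> {y \<in> {0<..1}. \<forall>i<n. min N (code lam ((F lam ^^ i) y)) = min N (code lam ((F lam ^^ i) x))}"
        then have y: "y \<in> {0<..1}" "\<And>i. i < n \<Longrightarrow> min N (code lam ((F lam ^^ i) y)) = min N (code lam ((F lam ^^ i) x))"
          by blast+
        have "itinerary (F lam) P n y i = itinerary (F lam) P n x i" for i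
          unfolding itinerary_def restrict_def
          using y(2)[of i] cell_P[OF F_funpow_closed[OF y(1)], of i] cell_P[OF F_funpow_closed[OF x(1)], of i] by simp
        then show "y \<in> itinerary (F lam) P n -` {a} \<inter> space M"
          using y(1) x(2) space_M by (auto simp: fun_eq_iff)
      qed
      from measure_M_itinerary_le[OF x(1) this simple_functionD(2)[OF M.itinerary_simple]]
      show ?thesis using u[OF x(1)] x(2) by simp
    qed
    have u_pos: "0 < u a" for a
      unfolding u_def by (intro mult_pos_pos prod_pos) (auto simp: wt_pos)
    define g where "g x = ln 2 * (2 - indicator (part 1) x - indicator (part N) x :: real)" for x
    have ind: "integrable M (indicator (part k) :: real \<Rightarrow> real)" for k
      using part_sets by (rule integrable_real_indicator) (simp add: M.emeasure_eq_measure)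
    have g_int: "integrable M g"
      unfolding g_def using ind
      by (intro integrable_mult_right Bochner_Integration.integrable_diff) auto
    have g_val: "(\<integral>x. g x \<partial>M) = ln 2 * (2 - 2 / N)"
    proof -
      have "(\<integral>x. g x \<partial>M) = ln 2 * (2 - M.prob (part 1) - M.prob (part N))"
        unfolding g_def using ind part_sets M.prob_space by simp
      also have "\<dots> = ln 2 * (2 - 2 / N)"
        using measure_M_part[of 1] measure_M_part[of N] N by simp
      finally show ?thesis .
    qed
    have "real n * (ln 2 * (2 - 2 / N)) - real N * ln 2 = (\<integral>x. (\<Sum>i<n. g ((F lam ^^ i) x)) - real N * ln 2 \<partial>M)"
    proof -
      have "(\<integral>x. (\<Sum>i<n. g ((F lam ^^ i) x)) - real N * ln 2 \<partial>M) =
          (\<integral>x. (\<Sum>i<n. g ((F lam ^^ i) x)) \<partial>M) - real N * ln 2"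
        using M.integrable_funpow[OF g_int] M.prob_space
        by (subst Bochner_Integration.integral_diff) (auto intro: Bochner_Integration.integrable_sum)
      also have "(\<integral>x. (\<Sum>i<n. g ((F lam ^^ i) x)) \<partial>M) = (\<Sum>i<n. (\<integral>x. g ((F lam ^^ i) x) \<partial>M))"
        by (rule Bochner_Integration.integral_sum[OF M.integrable_funpow[OF g_int]])
      also have "\<dots> = real n * (ln 2 * (2 - 2 / N))"
        unfolding M.integral_funpow[OF borel_measurable_integrable[OF g_int]] g_val by simp
      finally show ?thesis ..
    qed
    also have "\<dots> = (\<integral>x. - ln (u (itinerary (F lam) P n x)) \<partial>M)"
    proof (rule Bochner_Integration.integral_cong[OF refl])
      fix x assume "x \<in> space M"
      then have x: "x \<in> {0<..1}" by (simp add: space_M)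
      have "ln (u (itinerary (F lam) P n x)) =
          real N * ln 2 + (\<Sum>i<n. ln (wt (min N (code lam ((F lam ^^ i) x)))))"
      proof -
        have "0 < (\<Prod>i<n. wt (min N (code lam ((F lam ^^ i) x))))"
          by (intro prod_pos) (simp add: wt_pos)
        moreover have "ln (\<Prod>i<n. wt (min N (code lam ((F lam ^^ i) x)))) =
            (\<Sum>i<n. ln (wt (min N (code lam ((F lam ^^ i) x)))))"
          by (rule ln_prod) (simp_all add: wt_def weight_def)
        ultimately show ?thesis unfolding u[OF x] by (simp add: ln_mult_pos ln_realpow)
      qed
      moreover have "(\<Sum>i<n. g ((F lam ^^ i) x)) = (\<Sum>i<n. - ln (wt (min N (code lam ((F lam ^^ i) x)))))"
        unfolding g_def by (intro sum.cong refl neg_ln_wt[symmetric] F_funpow_closed[OF x])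
      ultimately show "(\<Sum>i<n. g ((F lam ^^ i) x)) - real N * ln 2 = - ln (u (itinerary (F lam) P n x))"
        by (simp add: sum_negf)
    qed
    also have "\<dots> \<le> partition_entropy M (refinement M (F lam) P n)"
      unfolding M.partition_entropy_eq
      by (rule M.integral_le_entropy[OF M.itinerary_simple upper u_pos])
    finally show "real n * (ln 2 * (2 - 2 / N)) - real N * ln 2
        \<le> partition_entropy M (refinement M (F lam) P n)" .
  qed
qed

lemma measure_M_head: "measure M {0<..lam} = 1 - 1 / N"
proof -
  interpret M: prob_space M
    using M_invariant by (simp add: invariant_probs_def borel_prob_def)
  have "min N c = 1 \<longleftrightarrow> c = 1" for c using N by auto
  then have "part 1 = W lam 1" unfolding W_eq[OF order_refl] part_def by simp
  then have "{0<..lam} = space M - part 1"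
    unfolding W_1 space_M using lam_pos lam_less_1 by auto
  then show ?thesis
    using M.prob_compl[OF part_sets[of 1]] measure_M_part[of 1] N by simp
qed

end

section \<open>The value of the pressure and null recurrence\<close>

lemma ext_integral_eq:
  assumes "integrable \<mu> f"
  shows "ext_integral \<mu> f = ereal (\<integral>x. f x \<partial>\<mu>)"
proof -
  obtain r q where rq: "0 \<le> r" "0 \<le> q" "(\<integral>\<^sup>+x. ennreal (f x) \<partial>\<mu>) = ennreal r"
    "(\<integral>\<^sup>+x. ennreal (- f x) \<partial>\<mu>) = ennreal q" "(\<integral>x. f x \<partial>\<mu>) = r - q"
    using assms by (rule integrableE)
  then show ?thesis by (simp add: ext_integral_def)
qed

context contraction
begin

text \<open>The potential takes two values that differ by \<open>ln 2\<close>, so its integral is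
  finite for every Borel probability and depends only on the mass of
  \<open>{0<..lam}\<close>.\<close>

lemma ext_integral_Phi:
  assumes t: "lam powr t = 1 / 2" and \<mu>: "borel_prob {0<..1} \<mu>"
  shows "ext_integral \<mu> (Phi lam t) = ereal (t * ln (1 - lam) - ln 2 * measure \<mu> {0<..lam})"
proof -
  interpret prob_space \<mu> using \<mu> by (simp add: borel_prob_def)
  have sets: "sets \<mu> = sets (restrict_space borel {0<..1})" using \<mu> by (simp add: borel_prob_def)
  have space: "space \<mu> = {0<..1}"
    using sets_eq_imp_space_eq[OF sets] by (simp add: space_restrict_space)
  have "{0<..lam} \<subseteq> {0<..1}" using lam_less_1 by auto
  then have head: "{0<..lam} \<in> sets \<mu>" by (simp only: sets sets_unit_iff) simp
  have eq: "Phi lam t x = t * ln (1 - lam) - ln 2 * indicator {0<..lam} x" if "x \<in> space \<mu>" for x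
  proof -
    have x: "x \<in> {0<..1}" using that space by simp
    have "code lam x = 1 \<longleftrightarrow> \<not> x \<le> lam"
      using less_code_iff[of x 1] code_pos[OF x] x by auto
    then show ?thesis
      using exp_minus_Phi(2)[OF t code_pos[OF x] in_W_code[OF x]] x by (simp add: indicator_def)
  qed
  have ind: "integrable \<mu> (indicator {0<..lam} :: real \<Rightarrow> real)"
    using head by (rule integrable_real_indicator) (simp add: emeasure_eq_measure)
  then have int: "integrable \<mu> (\<lambda>x. t * ln (1 - lam) - ln 2 * indicator {0<..lam} x)"
    by (intro Bochner_Integration.integrable_diff integrable_mult_right) auto
  have "integrable \<mu> (Phi lam t)"
    using int by (subst Bochner_Integration.integrable_cong[OF refl eq]) simp_all
  moreover have "(\<integral>x. Phi lam t x \<partial>\<mu>) = t * ln (1 - lam) - ln 2 * prob {0<..lam}"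
    using ind head prob_space by (subst Bochner_Integration.integral_cong[OF refl eq]) simp_all
  ultimately show ?thesis using ext_integral_eq[of \<mu> "Phi lam t"] by simp
qed

lemma pressure_eq:
  assumes t: "lam powr t = 1 / 2"
  shows "pressure {0<..1} (F lam) (Phi lam t) = ereal (ln 2 + t * ln (1 - lam))"
proof (rule antisym)
  obtain m where "fair_conformal lam m" using fair_conformal_exists ..
  then interpret fair_conformal lam m .
  show "pressure {0<..1} (F lam) (Phi lam t) \<le> ereal (ln 2 + t * ln (1 - lam))"
    unfolding pressure_def
  proof (rule Sup_least)
    fix z assume "z \<in> {ks_entropy \<mu> (F lam) + ext_integral \<mu> (Phi lam t) |\<mu>.
      \<mu> \<in> invariant_probs {0<..1} (F lam) \<and> - ext_integral \<mu> (Phi lam t) < \<infinity>}"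
    then obtain \<mu> where \<mu>: "\<mu> \<in> invariant_probs {0<..1} (F lam)"
      and z: "z = ks_entropy \<mu> (F lam) + ext_integral \<mu> (Phi lam t)" by blast
    have "ks_entropy \<mu> (F lam) \<le> ereal (ln 2 * (1 + measure \<mu> {0<..lam}))"
      unfolding ks_entropy_def using entropy_rate_upper[OF \<mu>] by (intro SUP_least) simp
    moreover have "ext_integral \<mu> (Phi lam t) = ereal (t * ln (1 - lam) - ln 2 * measure \<mu> {0<..lam})"
      using \<mu> by (intro ext_integral_Phi[OF t]) (simp add: invariant_probs_def)
    ultimately have "z \<le> ereal (ln 2 * (1 + measure \<mu> {0<..lam})) +
        ereal (t * ln (1 - lam) - ln 2 * measure \<mu> {0<..lam})"
      unfolding z by (intro add_mono) simp_all
    then show "z \<le> ereal (ln 2 + t * ln (1 - lam))" by (simp add: algebra_simps)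
  qed
  show "ereal (ln 2 + t * ln (1 - lam)) \<le> pressure {0<..1} (F lam) (Phi lam t)"
  proof (rule ereal_le_epsilon2)
    fix e :: real assume e: "0 < e"
    \<comment> \<open>The walk reflected at \<open>N\<close> has free energy exactly
      \<open>ln 2 / N\<close> below the claimed value in the lower estimate, which fixes how large
      \<open>N\<close> must be.\<close>
    obtain K where K: "ln 2 / e < real K" using reals_Archimedean2 by blast
    define N where "N = max 2 K"
    interpret truncated_system lam N by standard (simp add: N_def)
    have "ln 2 / e < real N" using K by (simp add: N_def)
    then have "ln 2 / N \<le> e" using e by (simp add: N_def field_simps)
    have "ereal (ln 2 * (2 - 2 / N)) \<le> ks_entropy M (F lam)"
      unfolding ks_entropy_def
      using entropy_rate_ge_truncated by (intro SUP_upper2[OF P_finite_partition]) simp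
    moreover have ext: "ext_integral M (Phi lam t) = ereal (t * ln (1 - lam) - ln 2 * (1 - 1 / N))"
      using M_invariant ext_integral_Phi[OF t, of M] measure_M_head by (simp add: invariant_probs_def)
    ultimately have "ereal (ln 2 * (2 - 2 / N)) + ereal (t * ln (1 - lam) - ln 2 * (1 - 1 / N))
        \<le> ks_entropy M (F lam) + ext_integral M (Phi lam t)"
      by (intro add_mono) simp_all
    also have "\<dots> \<le> pressure {0<..1} (F lam) (Phi lam t)"
      unfolding pressure_def
    proof (rule Sup_upper, rule CollectI, intro exI conjI)
      show "- ext_integral M (Phi lam t) < \<infinity>" by (simp add: ext)
    qed (rule refl M_invariant)+
    finally have "ereal (ln 2 * (2 - 2 / N) + (t * ln (1 - lam) - ln 2 * (1 - 1 / N)))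
        \<le> pressure {0<..1} (F lam) (Phi lam t)" by simp
    moreover have "ln 2 * (2 - 2 / N) + (t * ln (1 - lam) - ln 2 * (1 - 1 / N)) =
        ln 2 + t * ln (1 - lam) - ln 2 / N"
      by (simp add: algebra_simps)
    ultimately have "ereal (ln 2 + t * ln (1 - lam) - ln 2 / N) \<le> pressure {0<..1} (F lam) (Phi lam t)"
      by (simp only:)
    then have "ereal (ln 2 + t * ln (1 - lam) - ln 2 / N) + ereal e
        \<le> pressure {0<..1} (F lam) (Phi lam t) + ereal e" by (rule add_right_mono)
    moreover have "ereal (ln 2 + t * ln (1 - lam))
        \<le> ereal (ln 2 + t * ln (1 - lam) - ln 2 / N) + ereal e"
      using \<open>ln 2 / N \<le> e\<close> by simp
    ultimately show "ereal (ln 2 + t * ln (1 - lam)) \<le> pressure {0<..1} (F lam) (Phi lam t) + ereal e"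
      by (rule order_trans[rotated])
  qed
qed

end

theorem lemma3:
  fixes lam t :: real
  assumes "0 < lam" "lam < 1"
    and "lam powr t = 1 / 2"
  shows "null_recurrent {0<..1} (F lam) (Phi lam t)"
proof -
  interpret contraction lam using assms(1,2) by unfold_locales
  note p = pressure_eq[OF assms(3)]
  \<comment> \<open>Stated for all recurrence measures: once the pressure is known, each of them is
    conformal at this same parameter.\<close>
  have fair: "fair_conformal lam m" if "recurrence_measure {0<..1} (F lam) (Phi lam t) m" for m
  proof (rule conformal_imp_fair[OF assms(3)])
    show "conformal {0<..1} (F lam) (Phi lam t) (ln 2 + t * ln (1 - lam)) m"
      using that p by (auto simp: recurrence_measure_def)
  qed
  obtain m where "fair_conformal lam m" using fair_conformal_exists ..
  then interpret m: fair_conformal lam m .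
  have "recurrence_measure {0<..1} (F lam) (Phi lam t) m"
    using p m.conformal[OF assms(3)] m.conservative by (auto simp: recurrence_measure_def)
  then have "recurrent {0<..1} (F lam) (Phi lam t)" by (auto simp: recurrent_def)
  moreover have "\<not> positive_recurrent {0<..1} (F lam) (Phi lam t)"
    unfolding positive_recurrent_def
    using fair fair_conformal.no_invariant_density by blast
  ultimately show ?thesis by (simp add: null_recurrent_def)
qed

end
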